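(* Let $\mathcal{E}$ be a weakly idempotent complete Frobenius category. Let $\mathcal{M}$ be a full subcategory of $\mathcal{E}$ which is rigid and contravariantly finite and contains all the injective objects. Let $\mathcal{W}$ be the class of morphisms $f$ such that $Gf$ is an isomorphism, and let $\sim$ be the homotopy relation on $\mathcal{E}$ given by the model structure on $\mathcal{E}$ whose class of weak equivalences is $\mathcal{W}$, in which all objects are fibrant and the cofibrant objects are those of $\mathrm{pr}\mathcal{M}$. Then: (1) two morphisms $f$ and $g$ (with the same domain and the same codomain) in $\mathcal{E}$ are homotopic if and only if $f-g$ factors through $\mho\mathcal{M}$; (2) if $\mathrm{Ho}\,\mathcal{E}$ denotes the localization of $\mathcal{E}$ at the class $\mathcal{W}$ of weak equivalences, there is an equivalence of categories $\mathrm{pr}\mathcal{M}/(\mho\mathcal{M})\simeq\mathrm{Ho}\,\mathcal{E}$; (3) there is an equivalence of categories $\mathrm{Ho}\,\mathcal{E}\to\mathrm{mod}\,\overline{\mathcal{M}}$.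
   Context: An exact category is weakly idempotent complete if every retraction has a kernel. It is Frobenius if it has enough projectives and enough injectives and these coincide. $\mathcal{M}$ is rigid if $\mathrm{Ext}^1_{\mathcal{E}}(M,M')=0$ for all $M,M'\in\mathcal{M}$. It is contravariantly finite if every $X\in\mathcal{E}$ admits a morphism $M\to X$ with $M\in\mathcal{M}$ through which every morphism $N\to X$ with $N\in\mathcal{M}$ factors. $\mathrm{pr}\mathcal{M}$ is the full subcategory of objects $X$ with a short exact sequence $0\to M_1\to M_0\to X\to 0$, $M_0,M_1\in\mathcal{M}$. $\mho\mathcal{M}$ is the class of objects $X$ with a short exact sequence $0\to M\to I\to X\to 0$, $M\in\mathcal{M}$, $I$ injective. A morphism factors through $\mho\mathcal{M}$ if it factors through an object of $\mho\mathcal{M}$; $\mathrm{pr}\mathcal{M}/(\mho\mathcal{M})$ is the quotient of $\mathrm{pr}\mathcal{M}$ by the ideal of such morphisms. $\overline{\mathcal{E}}$ is the quotient of $\mathcal{E}$ by the ideal of morphisms factoring through injectives, $\overline{\mathcal{M}}$ its full subcategory on $\mathcal{M}$, $\mathrm{Mod}\,\overline{\mathcal{M}}$ the category of additive contravariant functors from $\overline{\mathcal{M}}$ to abelian groups, $\mathrm{mod}\,\overline{\mathcal{M}}$ its full subcategory of finitely presented functors, and $G:\mathcal{E}\to\mathrm{Mod}\,\overline{\mathcal{M}}$, $G(X)=\overline{\mathcal{E}}(-,X)|_{\overline{\mathcal{M}}}$. Homotopy: a path object for $Y$ is a factorization $Y\to Y'\to Y\oplus Y$ of the diagonal with $Y\to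 Y'$ in $\mathcal{W}$. Morphisms $f,g:X\to Y$ are (right) homotopic if there are a path object $Y'$ for $Y$, with second map $(\Delta_1,\Delta_2)^{T}:Y'\to Y\oplus Y$, and $k:X\to Y'$ with $\Delta_1k=f$ and $\Delta_2k=g$.
   Formalization: In (1), "homotopic implies f−g factors through ℧M" is stated only for domain in prM; it fails otherwise (E = mod k[x]/(x²), M the injectives, f = id_k, g = 0). The converse is stated for all f, g. M is read as a full additive subcategory. *)

theory Defs
  imports "HOL-Algebra.Group"
begin

section \<open>Categories and functors\<close>

record ('o, 'm) cat =
  Obj :: "'o set"
  Arr :: "'m set"
  Dom :: "'m \<Rightarrow> 'o"
  Cod :: "'m \<Rightarrow> 'o"
  Ident :: "'o \<Rightarrow> 'm"
  Comp :: "'m \<Rightarrow> 'm \<Rightarrow> 'm" (infixl "\<cdot>\<index>" 70)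

definition Hom :: "('o, 'm, 'x) cat_scheme \<Rightarrow> 'o \<Rightarrow> 'o \<Rightarrow> 'm set" where
  "Hom C X Y = {f \<in> Arr C. Dom C f = X \<and> Cod C f = Y}"

locale category =
  fixes C :: "('o, 'm, 'x) cat_scheme" (structure)
  assumes Dom_in: "f \<in> Arr C \<Longrightarrow> Dom C f \<in> Obj C"
    and Cod_in: "f \<in> Arr C \<Longrightarrow> Cod C f \<in> Obj C"
    and Ident_in: "X \<in> Obj C \<Longrightarrow> Ident C X \<in> Hom C X X"
    and Comp_in: "\<lbrakk>f \<in> Hom C X Y; g \<in> Hom C Y Z\<rbrakk> \<Longrightarrow> g \<cdot> f \<in> Hom C X Z"
    and Ident_right: "f \<in> Hom C X Y \<Longrightarrow> f \<cdot> Ident C X = f"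
    and Ident_left: "f \<in> Hom C X Y \<Longrightarrow> Ident C Y \<cdot> f = f"
    and Comp_assoc: "\<lbrakk>f \<in> Hom C X Y; g \<in> Hom C Y Z; h \<in> Hom C Z V\<rbrakk>
      \<Longrightarrow> (h \<cdot> g) \<cdot> f = h \<cdot> (g \<cdot> f)"

definition is_iso :: "('o, 'm, 'x) cat_scheme \<Rightarrow> 'm \<Rightarrow> bool" where
  "is_iso C f \<longleftrightarrow> f \<in> Arr C \<and>
     (\<exists>g \<in> Hom C (Cod C f) (Dom C f).
        g \<cdot>\<^bsub>C\<^esub> f = Ident C (Dom C f) \<and> f \<cdot>\<^bsub>C\<^esub> g = Ident C (Cod C f))"

definition full_sub :: "('o, 'm, 'x) cat_scheme \<Rightarrow> 'o set \<Rightarrow> ('o, 'm, 'x) cat_scheme" where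
  "full_sub C S = C\<lparr>Obj := Obj C \<inter> S,
                    Arr := {f \<in> Arr C. Dom C f \<in> S \<and> Cod C f \<in> S}\<rparr>"

record ('o, 'm, 'p, 'n) cat_functor =
  on_obj :: "'o \<Rightarrow> 'p"
  on_arr :: "'m \<Rightarrow> 'n"

definition is_functor ::
  "('o, 'm, 'x) cat_scheme \<Rightarrow> ('p, 'n, 'y) cat_scheme \<Rightarrow> ('o, 'm, 'p, 'n) cat_functor \<Rightarrow> bool" where
  "is_functor C D F \<longleftrightarrow>
     (\<forall>X \<in> Obj C. on_obj F X \<in> Obj D) \<and>
     (\<forall>X \<in> Obj C. \<forall>Y \<in> Obj C. \<forall>f \<in> Hom C X Y. on_arr F f \<in> Hom D (on_obj F X) (on_obj F Y)) \<and>
     (\<forall>X \<in> Obj C. on_arr F (Ident C X) = Ident D (on_obj F X)) \<and>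
     (\<forall>X \<in> Obj C. \<forall>Y \<in> Obj C. \<forall>Z \<in> Obj C. \<forall>f \<in> Hom C X Y. \<forall>g \<in> Hom C Y Z.
        on_arr F (g \<cdot>\<^bsub>C\<^esub> f) = on_arr F g \<cdot>\<^bsub>D\<^esub> on_arr F f)"

definition id_functor :: "('o, 'm, 'o, 'm) cat_functor" where
  "id_functor = \<lparr>on_obj = id, on_arr = id\<rparr>"

definition comp_functor ::
  "('p, 'n, 'q, 'l) cat_functor \<Rightarrow> ('o, 'm, 'p, 'n) cat_functor \<Rightarrow> ('o, 'm, 'q, 'l) cat_functor" where
  "comp_functor G F = \<lparr>on_obj = on_obj G \<circ> on_obj F, on_arr = on_arr G \<circ> on_arr F\<rparr>"

definition natural_iso ::
  "('o, 'm, 'x) cat_scheme \<Rightarrow> ('p, 'n, 'y) cat_scheme \<Rightarrow>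
   ('o, 'm, 'p, 'n) cat_functor \<Rightarrow> ('o, 'm, 'p, 'n) cat_functor \<Rightarrow> ('o \<Rightarrow> 'n) \<Rightarrow> bool" where
  "natural_iso C D F F' \<eta> \<longleftrightarrow>
     (\<forall>X \<in> Obj C. \<eta> X \<in> Hom D (on_obj F X) (on_obj F' X) \<and> is_iso D (\<eta> X)) \<and>
     (\<forall>X \<in> Obj C. \<forall>Y \<in> Obj C. \<forall>f \<in> Hom C X Y.
        \<eta> Y \<cdot>\<^bsub>D\<^esub> on_arr F f = on_arr F' f \<cdot>\<^bsub>D\<^esub> \<eta> X)"

definition is_equivalence ::
  "('o, 'm, 'x) cat_scheme \<Rightarrow> ('p, 'n, 'y) cat_scheme \<Rightarrow> ('o, 'm, 'p, 'n) cat_functor \<Rightarrow> bool" where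
  "is_equivalence C D F \<longleftrightarrow> is_functor C D F \<and>
     (\<exists>F' \<eta> \<epsilon>. is_functor D C F' \<and>
        natural_iso C C (comp_functor F' F) id_functor \<eta> \<and>
        natural_iso D D (comp_functor F F') id_functor \<epsilon>)"

section \<open>Preadditive and additive categories\<close>

record ('o, 'm) precat = "('o, 'm) cat" +
  Add :: "'m \<Rightarrow> 'm \<Rightarrow> 'm" (infixl "\<boxplus>\<index>" 65)
  Zero :: "'o \<Rightarrow> 'o \<Rightarrow> 'm"

definition homgrp :: "('o, 'm, 'x) precat_scheme \<Rightarrow> 'o \<Rightarrow> 'o \<Rightarrow> 'm monoid" where
  "homgrp C X Y = \<lparr>carrier = Hom C X Y, monoid.mult = Add C, one = Zero C X Y\<rparr>"

definition Minus :: "('o, 'm, 'x) precat_scheme \<Rightarrow> 'm \<Rightarrow> 'm \<Rightarrow> 'm" where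
  "Minus C f g = f \<boxplus>\<^bsub>C\<^esub> m_inv (homgrp C (Dom C g) (Cod C g)) g"

locale preadditive_category = category C
  for C :: "('o, 'm, 'x) precat_scheme" (structure) +
  assumes homgrp_comm_group: "\<lbrakk>X \<in> Obj C; Y \<in> Obj C\<rbrakk> \<Longrightarrow> comm_group (homgrp C X Y)"
    and Comp_Add_left: "\<lbrakk>f \<in> Hom C X Y; g \<in> Hom C Y Z; g' \<in> Hom C Y Z\<rbrakk>
      \<Longrightarrow> (g \<boxplus> g') \<cdot> f = g \<cdot> f \<boxplus> g' \<cdot> f"
    and Comp_Add_right: "\<lbrakk>f \<in> Hom C X Y; f' \<in> Hom C X Y; g \<in> Hom C Y Z\<rbrakk>
      \<Longrightarrow> g \<cdot> (f \<boxplus> f') = g \<cdot> f \<boxplus> g \<cdot> f'"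

definition zero_object :: "('o, 'm, 'x) cat_scheme \<Rightarrow> 'o \<Rightarrow> bool" where
  "zero_object C Z \<longleftrightarrow> Z \<in> Obj C \<and>
     (\<forall>X \<in> Obj C. (\<exists>!f. f \<in> Hom C X Z) \<and> (\<exists>!f. f \<in> Hom C Z X))"

definition is_biproduct ::
  "('o, 'm, 'x) precat_scheme \<Rightarrow> 'o \<Rightarrow> 'o \<Rightarrow> 'o \<Rightarrow> 'm \<Rightarrow> 'm \<Rightarrow> 'm \<Rightarrow> 'm \<Rightarrow> bool" where
  "is_biproduct C X Y B i1 i2 p1 p2 \<longleftrightarrow> B \<in> Obj C \<and>
     i1 \<in> Hom C X B \<and> i2 \<in> Hom C Y B \<and> p1 \<in> Hom C B X \<and> p2 \<in> Hom C B Y \<and>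
     p1 \<cdot>\<^bsub>C\<^esub> i1 = Ident C X \<and> p2 \<cdot>\<^bsub>C\<^esub> i2 = Ident C Y \<and>
     p1 \<cdot>\<^bsub>C\<^esub> i2 = Zero C Y X \<and> p2 \<cdot>\<^bsub>C\<^esub> i1 = Zero C X Y \<and>
     (i1 \<cdot>\<^bsub>C\<^esub> p1) \<boxplus>\<^bsub>C\<^esub> (i2 \<cdot>\<^bsub>C\<^esub> p2) = Ident C B"

locale additive_category = preadditive_category C
  for C :: "('o, 'm, 'x) precat_scheme" (structure) +
  assumes zero_object_exists: "\<exists>Z. zero_object C Z"
    and biproduct_exists: "\<lbrakk>X \<in> Obj C; Y \<in> Obj C\<rbrakk> \<Longrightarrow> \<exists>B i1 i2 p1 p2. is_biproduct C X Y B i1 i2 p1 p2"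

text \<open>The morphisms that factor through an object of \<open>S\<close>; they form an ideal as soon as \<open>S\<close>
  is closed under finite direct sums.\<close>

definition factoring :: "('o, 'm, 'x) cat_scheme \<Rightarrow> 'o set \<Rightarrow> 'm set" where
  "factoring C S = {f \<in> Arr C. \<exists>U \<in> S \<inter> Obj C. \<exists>a \<in> Hom C (Dom C f) U. \<exists>b \<in> Hom C U (Cod C f).
     f = b \<cdot>\<^bsub>C\<^esub> a}"

text \<open>The quotient of a preadditive category by an ideal \<open>J\<close> of morphisms: the morphisms are the
  cosets \<open>f + J(X,Y)\<close>.  All members of a coset have the same domain and codomain, and the unions
  below are unions of copies of one single coset.\<close>

definition coset :: "('o, 'm, 'x) precat_scheme \<Rightarrow> 'm set \<Rightarrow> 'm \<Rightarrow> 'm set" where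
  "coset C J f = {g \<in> Hom C (Dom C f) (Cod C f). Minus C g f \<in> J}"

definition quotient_cat :: "('o, 'm, 'x) precat_scheme \<Rightarrow> 'm set \<Rightarrow> ('o, 'm set) precat" where
  "quotient_cat C J = \<lparr>
     Obj = Obj C,
     Arr = coset C J ` Arr C,
     Dom = (\<lambda>c. the_elem (Dom C ` c)),
     Cod = (\<lambda>c. the_elem (Cod C ` c)),
     Ident = (\<lambda>X. coset C J (Ident C X)),
     Comp = (\<lambda>d c. \<Union>g \<in> d. \<Union>f \<in> c. coset C J (g \<cdot>\<^bsub>C\<^esub> f)),
     Add = (\<lambda>c d. \<Union>f \<in> c. \<Union>g \<in> d. coset C J (f \<boxplus>\<^bsub>C\<^esub> g)),
     Zero = (\<lambda>X Y. coset C J (Zero C X Y))\<rparr>"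

section \<open>Localization\<close>

text \<open>The localization of \<open>C\<close> at a class \<open>W\<close> of morphisms, in the Gabriel-Zisman construction: the
  objects are those of \<open>C\<close>, and the morphisms are zigzags of morphisms of \<open>C\<close> (\<open>Fwd\<close>) and of formal
  inverses of morphisms in \<open>W\<close> (\<open>Bwd\<close>), modulo the least congruence that turns composition of \<open>Fwd\<close>
  steps into composition in \<open>C\<close> and makes \<open>Bwd w\<close> inverse to \<open>Fwd w\<close>.
  Zigzags are written in the order in which they are travelled, so the first step comes first.\<close>

datatype 'm step = Fwd 'm | Bwd 'm

fun step_from_to :: "('o, 'm, 'x) cat_scheme \<Rightarrow> 'm set \<Rightarrow> 'o \<Rightarrow> 'm step \<Rightarrow> 'o \<Rightarrow> bool" where
  "step_from_to C W X (Fwd f) Y \<longleftrightarrow> f \<in> Hom C X Y"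
| "step_from_to C W X (Bwd w) Y \<longleftrightarrow> w \<in> W \<and> w \<in> Hom C Y X"

fun zigzag :: "('o, 'm, 'x) cat_scheme \<Rightarrow> 'm set \<Rightarrow> 'o \<Rightarrow> 'm step list \<Rightarrow> 'o \<Rightarrow> bool" where
  "zigzag C W X [] Y \<longleftrightarrow> X \<in> Obj C \<and> X = Y"
| "zigzag C W X (s # p) Y \<longleftrightarrow> (\<exists>Z \<in> Obj C. step_from_to C W X s Z \<and> zigzag C W Z p Y)"

inductive zigzag_eq ::
  "('o, 'm, 'x) cat_scheme \<Rightarrow> 'm set \<Rightarrow> 'o \<Rightarrow> 'o \<Rightarrow> 'm step list \<Rightarrow> 'm step list \<Rightarrow> bool"
  for C W where
  refl: "zigzag C W X p Y \<Longrightarrow> zigzag_eq C W X Y p p"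
| sym: "zigzag_eq C W X Y p q \<Longrightarrow> zigzag_eq C W X Y q p"
| trans: "\<lbrakk>zigzag_eq C W X Y p q; zigzag_eq C W X Y q r\<rbrakk> \<Longrightarrow> zigzag_eq C W X Y p r"
| cong: "\<lbrakk>zigzag C W X a X'; zigzag_eq C W X' Y' p q; zigzag C W Y' b Y\<rbrakk>
    \<Longrightarrow> zigzag_eq C W X Y (a @ p @ b) (a @ q @ b)"
| ident: "X \<in> Obj C \<Longrightarrow> zigzag_eq C W X X [Fwd (Ident C X)] []"
| comp: "\<lbrakk>f \<in> Hom C X Y; g \<in> Hom C Y Z\<rbrakk> \<Longrightarrow> zigzag_eq C W X Z [Fwd f, Fwd g] [Fwd (g \<cdot>\<^bsub>C\<^esub> f)]"
| Fwd_Bwd: "\<lbrakk>w \<in> W; w \<in> Hom C X Y\<rbrakk> \<Longrightarrow> zigzag_eq C W X X [Fwd w, Bwd w] []"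
| Bwd_Fwd: "\<lbrakk>w \<in> W; w \<in> Hom C X Y\<rbrakk> \<Longrightarrow> zigzag_eq C W Y Y [Bwd w, Fwd w] []"

definition zigzag_class ::
  "('o, 'm, 'x) cat_scheme \<Rightarrow> 'm set \<Rightarrow> 'o \<Rightarrow> 'o \<Rightarrow> 'm step list \<Rightarrow> 'm step list set" where
  "zigzag_class C W X Y p = {q. zigzag_eq C W X Y p q}"

definition localization ::
  "('o, 'm, 'x) cat_scheme \<Rightarrow> 'm set \<Rightarrow> ('o, 'o \<times> 'm step list set \<times> 'o) cat" where
  "localization C W = \<lparr>
     Obj = Obj C,
     Arr = {(X, zigzag_class C W X Y p, Y) | X Y p. X \<in> Obj C \<and> Y \<in> Obj C \<and> zigzag C W X p Y},
     Dom = fst,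
     Cod = snd \<circ> snd,
     Ident = (\<lambda>X. (X, zigzag_class C W X X [], X)),
     Comp = (\<lambda>(Y', d, Z) (X, c, Y). (X, \<Union>p \<in> c. \<Union>q \<in> d. zigzag_class C W X Z (p @ q), Z))\<rparr>"

section \<open>Modules over a preadditive category\<close>

text \<open>Additive contravariant functors from \<open>C\<close> to abelian groups, the groups being written
  multiplicatively and carried by subsets of the type \<open>'g\<close>.  Thus \<open>'g\<close> fixes a universe of abelian
  groups; it has to be large enough to contain copies of the groups \<open>C(X,Y)\<close> and their quotients.\<close>

record ('o, 'm, 'g) cmodule =
  Sect :: "'o \<Rightarrow> 'g monoid"
  Act :: "'m \<Rightarrow> 'g \<Rightarrow> 'g"

definition is_module :: "('o, 'm, 'x) precat_scheme \<Rightarrow> ('o, 'm, 'g) cmodule \<Rightarrow> bool" where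
  "is_module C F \<longleftrightarrow>
     (\<forall>X \<in> Obj C. comm_group (Sect F X)) \<and>
     (\<forall>X \<in> Obj C. \<forall>Y \<in> Obj C. \<forall>f \<in> Hom C X Y. Act F f \<in> hom (Sect F Y) (Sect F X)) \<and>
     (\<forall>X \<in> Obj C. \<forall>x \<in> carrier (Sect F X). Act F (Ident C X) x = x) \<and>
     (\<forall>X \<in> Obj C. \<forall>Y \<in> Obj C. \<forall>Z \<in> Obj C. \<forall>f \<in> Hom C X Y. \<forall>g \<in> Hom C Y Z.
        \<forall>x \<in> carrier (Sect F Z). Act F (g \<cdot>\<^bsub>C\<^esub> f) x = Act F f (Act F g x)) \<and>
     (\<forall>X \<in> Obj C. \<forall>Y \<in> Obj C. \<forall>f \<in> Hom C X Y. \<forall>g \<in> Hom C X Y. \<forall>y \<in> carrier (Sect F Y).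
        Act F (f \<boxplus>\<^bsub>C\<^esub> g) y = Act F f y \<otimes>\<^bsub>Sect F X\<^esub> Act F g y)"

definition natural_map ::
  "('o, 'm, 'x) precat_scheme \<Rightarrow> ('o, 'm, 'g) cmodule \<Rightarrow> ('o, 'm, 'h) cmodule \<Rightarrow>
   ('o \<Rightarrow> 'g \<Rightarrow> 'h) \<Rightarrow> bool" where
  "natural_map C F F' \<eta> \<longleftrightarrow>
     (\<forall>X \<in> Obj C. \<eta> X \<in> hom (Sect F X) (Sect F' X)) \<and>
     (\<forall>X \<in> Obj C. \<forall>Y \<in> Obj C. \<forall>f \<in> Hom C X Y. \<forall>y \<in> carrier (Sect F Y).
        \<eta> X (Act F f y) = Act F' f (\<eta> Y y))"

text \<open>The category \<open>Mod C\<close>.  Natural transformations are recorded with their source and target and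
  are normalised to be \<open>undefined\<close> outside the objects and carriers, so that equality of morphisms is
  equality of natural transformations.  Modules are not normalised in this way: two that differ only
  in irrelevant values are canonically isomorphic objects.\<close>

definition module_cat ::
  "'g itself \<Rightarrow> ('o, 'm, 'x) precat_scheme \<Rightarrow>
   (('o, 'm, 'g) cmodule,
    ('o, 'm, 'g) cmodule \<times> ('o \<Rightarrow> 'g \<Rightarrow> 'g) \<times> ('o, 'm, 'g) cmodule) cat" where
  "module_cat _ C = \<lparr>
     Obj = {F. is_module C F},
     Arr = {(F, \<eta>, F'). is_module C F \<and> is_module C F' \<and> natural_map C F F' \<eta> \<and>
              \<eta> \<in> extensional (Obj C) \<and> (\<forall>X \<in> Obj C. \<eta> X \<in> extensional (carrier (Sect F X)))},
     Dom = fst,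
     Cod = snd \<circ> snd,
     Ident = (\<lambda>F. (F, \<lambda>X \<in> Obj C. \<lambda>x \<in> carrier (Sect F X). x, F)),
     Comp = (\<lambda>(_, \<theta>, F'') (F, \<eta>, _).
       (F, \<lambda>X \<in> Obj C. \<lambda>x \<in> carrier (Sect F X). \<theta> X (\<eta> X x), F''))\<rparr>"

definition representable :: "('o, 'm, 'x) precat_scheme \<Rightarrow> 'o \<Rightarrow> ('o, 'm, 'm) cmodule" where
  "representable C X = \<lparr>Sect = (\<lambda>Y. homgrp C Y X), Act = (\<lambda>f h. h \<cdot>\<^bsub>C\<^esub> f)\<rparr>"

text \<open>An exact sequence \<open>C(-,A) \<rightarrow> C(-,B) \<rightarrow> F \<rightarrow> 0\<close>.  For an additive category \<open>C\<close> this agrees with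
  presentations by finite direct sums of representables.\<close>

definition finitely_presented :: "('o, 'm, 'x) precat_scheme \<Rightarrow> ('o, 'm, 'g) cmodule \<Rightarrow> bool" where
  "finitely_presented C F \<longleftrightarrow> is_module C F \<and>
     (\<exists>A \<in> Obj C. \<exists>B \<in> Obj C. \<exists>\<alpha> \<beta>.
        natural_map C (representable C A) (representable C B) \<alpha> \<and>
        natural_map C (representable C B) F \<beta> \<and>
        (\<forall>X \<in> Obj C.
           \<beta> X ` Hom C X B = carrier (Sect F X) \<and>
           {h \<in> Hom C X B. \<beta> X h = \<one>\<^bsub>Sect F X\<^esub>} = \<alpha> X ` Hom C X A))"

definition fp_module_cat ::
  "'g itself \<Rightarrow> ('o, 'm, 'x) precat_scheme \<Rightarrow>
   (('o, 'm, 'g) cmodule,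
    ('o, 'm, 'g) cmodule \<times> ('o \<Rightarrow> 'g \<Rightarrow> 'g) \<times> ('o, 'm, 'g) cmodule) cat" where
  "fp_module_cat T C = full_sub (module_cat T C) {F. finitely_presented C F}"

section \<open>Exact categories\<close>

record ('o, 'm) excat = "('o, 'm) precat" +
  conflations :: "('m \<times> 'm) set"

definition is_kernel :: "('o, 'm, 'x) precat_scheme \<Rightarrow> 'm \<Rightarrow> 'm \<Rightarrow> bool" where
  "is_kernel C p k \<longleftrightarrow> p \<in> Arr C \<and> k \<in> Arr C \<and> Cod C k = Dom C p \<and>
     p \<cdot>\<^bsub>C\<^esub> k = Zero C (Dom C k) (Cod C p) \<and>
     (\<forall>T \<in> Obj C. \<forall>t \<in> Hom C T (Dom C p). p \<cdot>\<^bsub>C\<^esub> t = Zero C T (Cod C p) \<longrightarrow>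
        (\<exists>!u. u \<in> Hom C T (Dom C k) \<and> k \<cdot>\<^bsub>C\<^esub> u = t))"

definition is_cokernel :: "('o, 'm, 'x) precat_scheme \<Rightarrow> 'm \<Rightarrow> 'm \<Rightarrow> bool" where
  "is_cokernel C i c \<longleftrightarrow> i \<in> Arr C \<and> c \<in> Arr C \<and> Dom C c = Cod C i \<and>
     c \<cdot>\<^bsub>C\<^esub> i = Zero C (Dom C i) (Cod C c) \<and>
     (\<forall>T \<in> Obj C. \<forall>t \<in> Hom C (Cod C i) T. t \<cdot>\<^bsub>C\<^esub> i = Zero C (Dom C i) T \<longrightarrow>
        (\<exists>!u. u \<in> Hom C (Cod C c) T \<and> u \<cdot>\<^bsub>C\<^esub> c = t))"

definition is_pushout :: "('o, 'm, 'x) cat_scheme \<Rightarrow> 'm \<Rightarrow> 'm \<Rightarrow> 'm \<Rightarrow> 'm \<Rightarrow> bool" where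
  "is_pushout C i f f' i' \<longleftrightarrow> i \<in> Arr C \<and> f \<in> Arr C \<and> f' \<in> Arr C \<and> i' \<in> Arr C \<and>
     Dom C i = Dom C f \<and> Dom C f' = Cod C i \<and> Dom C i' = Cod C f \<and> Cod C f' = Cod C i' \<and>
     f' \<cdot>\<^bsub>C\<^esub> i = i' \<cdot>\<^bsub>C\<^esub> f \<and>
     (\<forall>T \<in> Obj C. \<forall>s \<in> Hom C (Cod C i) T. \<forall>t \<in> Hom C (Cod C f) T. s \<cdot>\<^bsub>C\<^esub> i = t \<cdot>\<^bsub>C\<^esub> f \<longrightarrow>
        (\<exists>!u. u \<in> Hom C (Cod C i') T \<and> u \<cdot>\<^bsub>C\<^esub> f' = s \<and> u \<cdot>\<^bsub>C\<^esub> i' = t))"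

definition is_pullback :: "('o, 'm, 'x) cat_scheme \<Rightarrow> 'm \<Rightarrow> 'm \<Rightarrow> 'm \<Rightarrow> 'm \<Rightarrow> bool" where
  "is_pullback C p f f' p' \<longleftrightarrow> p \<in> Arr C \<and> f \<in> Arr C \<and> f' \<in> Arr C \<and> p' \<in> Arr C \<and>
     Cod C p = Cod C f \<and> Cod C f' = Dom C p \<and> Cod C p' = Dom C f \<and> Dom C f' = Dom C p' \<and>
     p \<cdot>\<^bsub>C\<^esub> f' = f \<cdot>\<^bsub>C\<^esub> p' \<and>
     (\<forall>T \<in> Obj C. \<forall>s \<in> Hom C T (Dom C p). \<forall>t \<in> Hom C T (Dom C f). p \<cdot>\<^bsub>C\<^esub> s = f \<cdot>\<^bsub>C\<^esub> t \<longrightarrow>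
        (\<exists>!u. u \<in> Hom C T (Dom C p') \<and> f' \<cdot>\<^bsub>C\<^esub> u = s \<and> p' \<cdot>\<^bsub>C\<^esub> u = t))"

definition inflation :: "('o, 'm, 'x) excat_scheme \<Rightarrow> 'm \<Rightarrow> bool" where
  "inflation C i \<longleftrightarrow> (\<exists>p. (i, p) \<in> conflations C)"

definition deflation :: "('o, 'm, 'x) excat_scheme \<Rightarrow> 'm \<Rightarrow> bool" where
  "deflation C p \<longleftrightarrow> (\<exists>i. (i, p) \<in> conflations C)"

text \<open>Exact categories in the sense of Quillen, with the axioms in the form given by Buehler.  The
  short exact sequences \<open>0 \<rightarrow> A \<rightarrow> B \<rightarrow> C \<rightarrow> 0\<close> are the conflations.\<close>

locale exact_category = additive_category C
  for C :: "('o, 'm, 'x) excat_scheme" (structure) +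
  assumes conflation_kernel_cokernel:
      "(i, p) \<in> conflations C \<Longrightarrow> is_kernel C p i \<and> is_cokernel C i p"
    and conflation_iso:
      "\<lbrakk>(i, p) \<in> conflations C; is_iso C a; is_iso C b; is_iso C c;
        Dom C a = Dom C i; Dom C b = Cod C i; Dom C c = Cod C p;
        i' \<in> Hom C (Cod C a) (Cod C b); p' \<in> Hom C (Cod C b) (Cod C c);
        i' \<cdot> a = b \<cdot> i; p' \<cdot> b = c \<cdot> p\<rbrakk> \<Longrightarrow> (i', p') \<in> conflations C"
    and inflation_Ident: "X \<in> Obj C \<Longrightarrow> inflation C (Ident C X)"
    and deflation_Ident: "X \<in> Obj C \<Longrightarrow> deflation C (Ident C X)"
    and inflation_Comp:
      "\<lbrakk>inflation C i; inflation C j; Cod C i = Dom C j\<rbrakk> \<Longrightarrow> inflation C (j \<cdot> i)"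
    and deflation_Comp:
      "\<lbrakk>deflation C p; deflation C q; Cod C p = Dom C q\<rbrakk> \<Longrightarrow> deflation C (q \<cdot> p)"
    and inflation_pushout:
      "\<lbrakk>inflation C i; f \<in> Arr C; Dom C f = Dom C i\<rbrakk>
        \<Longrightarrow> \<exists>f' i'. is_pushout C i f f' i' \<and> inflation C i'"
    and deflation_pullback:
      "\<lbrakk>deflation C p; f \<in> Arr C; Cod C f = Cod C p\<rbrakk>
        \<Longrightarrow> \<exists>f' p'. is_pullback C p f f' p' \<and> deflation C p'"

definition weakly_idempotent_complete :: "('o, 'm, 'x) precat_scheme \<Rightarrow> bool" where
  "weakly_idempotent_complete C \<longleftrightarrow>
     (\<forall>X \<in> Obj C. \<forall>Y \<in> Obj C. \<forall>r \<in> Hom C X Y.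
        (\<exists>s \<in> Hom C Y X. r \<cdot>\<^bsub>C\<^esub> s = Ident C Y) \<longrightarrow> (\<exists>k. is_kernel C r k))"

definition projectives :: "('o, 'm, 'x) excat_scheme \<Rightarrow> 'o set" where
  "projectives C = {P \<in> Obj C. \<forall>p f. deflation C p \<longrightarrow> f \<in> Hom C P (Cod C p) \<longrightarrow>
     (\<exists>g \<in> Hom C P (Dom C p). p \<cdot>\<^bsub>C\<^esub> g = f)}"

definition injectives :: "('o, 'm, 'x) excat_scheme \<Rightarrow> 'o set" where
  "injectives C = {I \<in> Obj C. \<forall>i f. inflation C i \<longrightarrow> f \<in> Hom C (Dom C i) I \<longrightarrow>
     (\<exists>g \<in> Hom C (Cod C i) I. g \<cdot>\<^bsub>C\<^esub> i = f)}"

locale frobenius_category = exact_category C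
  for C :: "('o, 'm, 'x) excat_scheme" (structure) +
  assumes enough_projectives:
      "X \<in> Obj C \<Longrightarrow> \<exists>p. deflation C p \<and> Cod C p = X \<and> Dom C p \<in> projectives C"
    and enough_injectives:
      "X \<in> Obj C \<Longrightarrow> \<exists>i. inflation C i \<and> Dom C i = X \<and> Cod C i \<in> injectives C"
    and projectives_eq_injectives: "projectives C = injectives C"

text \<open>The Yoneda group \<open>Ext\<^sup>1(A, B)\<close> as a set: conflations from \<open>B\<close> to \<open>A\<close> modulo isomorphisms that
  are the identity at both ends.  Only its vanishing is used, and a group vanishes iff its underlying
  set is a singleton, so the Baer sum is not needed.\<close>

definition extensions :: "('o, 'm, 'x) excat_scheme \<Rightarrow> 'o \<Rightarrow> 'o \<Rightarrow> ('m \<times> 'm) set" where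
  "extensions C A B = {(i, p) \<in> conflations C. Dom C i = B \<and> Cod C p = A}"

definition extension_equiv ::
  "('o, 'm, 'x) excat_scheme \<Rightarrow> 'o \<Rightarrow> 'o \<Rightarrow> (('m \<times> 'm) \<times> ('m \<times> 'm)) set" where
  "extension_equiv C A B = {((i, p), (i', p')).
     (i, p) \<in> extensions C A B \<and> (i', p') \<in> extensions C A B \<and>
     (\<exists>h \<in> Hom C (Cod C i) (Cod C i'). is_iso C h \<and> h \<cdot>\<^bsub>C\<^esub> i = i' \<and> p' \<cdot>\<^bsub>C\<^esub> h = p)}"

definition Ext1 :: "('o, 'm, 'x) excat_scheme \<Rightarrow> 'o \<Rightarrow> 'o \<Rightarrow> ('m \<times> 'm) set set" where
  "Ext1 C A B = extensions C A B // extension_equiv C A B"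

section \<open>Subcategories of an exact category\<close>

text \<open>A full subcategory is given by its set of objects.\<close>

definition rigid :: "('o, 'm, 'x) excat_scheme \<Rightarrow> 'o set \<Rightarrow> bool" where
  "rigid E M \<longleftrightarrow> (\<forall>A \<in> M. \<forall>B \<in> M. is_singleton (Ext1 E A B))"

definition contravariantly_finite :: "('o, 'm, 'x) cat_scheme \<Rightarrow> 'o set \<Rightarrow> bool" where
  "contravariantly_finite E M \<longleftrightarrow>
     (\<forall>X \<in> Obj E. \<exists>A \<in> M. \<exists>a \<in> Hom E A X.
        \<forall>N \<in> M. \<forall>f \<in> Hom E N X. \<exists>g \<in> Hom E N A. a \<cdot>\<^bsub>E\<^esub> g = f)"

definition pr :: "('o, 'm, 'x) excat_scheme \<Rightarrow> 'o set \<Rightarrow> 'o set" where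
  "pr E M = {X. \<exists>(i, p) \<in> conflations E. Dom E i \<in> M \<and> Cod E i \<in> M \<and> Cod E p = X}"

definition mho :: "('o, 'm, 'x) excat_scheme \<Rightarrow> 'o set \<Rightarrow> 'o set" where
  "mho E M = {X. \<exists>(i, p) \<in> conflations E. Dom E i \<in> M \<and> Cod E i \<in> injectives E \<and> Cod E p = X}"

section \<open>The weak equivalences and the homotopy relation\<close>

definition stable_cat :: "('o, 'm, 'x) excat_scheme \<Rightarrow> ('o, 'm set) precat" where
  "stable_cat E = quotient_cat E (factoring E (injectives E))"

definition stable_sub :: "('o, 'm, 'x) excat_scheme \<Rightarrow> 'o set \<Rightarrow> ('o, 'm set) precat" where
  "stable_sub E M = full_sub (stable_cat E) M"

text \<open>The functor \<open>G\<close> from \<open>E\<close> to modules over \<open>stable_sub E M\<close>; on a morphism \<open>f\<close> it is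
  postcomposition with the class of \<open>f\<close>.\<close>

definition G_obj :: "('o, 'm, 'x) excat_scheme \<Rightarrow> 'o \<Rightarrow> ('o, 'm set, 'm set) cmodule" where
  "G_obj E X = representable (stable_cat E) X"

definition G_functor ::
  "('o, 'm, 'x) excat_scheme \<Rightarrow> 'o set \<Rightarrow>
   ('o, 'm, ('o, 'm set, 'm set) cmodule,
    ('o, 'm set, 'm set) cmodule \<times> ('o \<Rightarrow> 'm set \<Rightarrow> 'm set) \<times> ('o, 'm set, 'm set) cmodule)
   cat_functor" where
  "G_functor E M = \<lparr>
     on_obj = G_obj E,
     on_arr = (\<lambda>f.
       (G_obj E (Dom E f),
        \<lambda>N \<in> Obj (stable_sub E M). \<lambda>h \<in> Hom (stable_cat E) N (Dom E f).
          coset E (factoring E (injectives E)) f \<cdot>\<^bsub>stable_cat E\<^esub> h,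
        G_obj E (Cod E f)))\<rparr>"

definition weak_equivalences :: "('o, 'm, 'x) excat_scheme \<Rightarrow> 'o set \<Rightarrow> 'm set" where
  "weak_equivalences E M =
     {f \<in> Arr E. is_iso (module_cat TYPE('m set) (stable_sub E M)) (on_arr (G_functor E M) f)}"

text \<open>Right homotopy.  It depends on a model structure only through its class \<open>W\<close> of weak
  equivalences.  A path object \<open>Y'\<close> for \<open>Y\<close>: the diagonal \<open>i1 + i2\<close> of \<open>Y\<close> factors as \<open>\<Delta> \<cdot> s\<close> with
  \<open>s : Y \<rightarrow> Y'\<close> in \<open>W\<close> and \<open>\<Delta> : Y' \<rightarrow> B\<close>, where \<open>B\<close> is the direct sum of two copies of \<open>Y\<close>.\<close>

definition path_object ::
  "('o, 'm, 'x) precat_scheme \<Rightarrow> 'm set \<Rightarrow> 'o \<Rightarrow> 'o \<Rightarrow> 'm \<Rightarrow>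
   'o \<Rightarrow> 'm \<Rightarrow> 'm \<Rightarrow> 'm \<Rightarrow> 'm \<Rightarrow> 'm \<Rightarrow> bool" where
  "path_object E W Y Y' s B i1 i2 p1 p2 \<Delta> \<longleftrightarrow>
     is_biproduct E Y Y B i1 i2 p1 p2 \<and>
     s \<in> W \<and> s \<in> Hom E Y Y' \<and> \<Delta> \<in> Hom E Y' B \<and> \<Delta> \<cdot>\<^bsub>E\<^esub> s = i1 \<boxplus>\<^bsub>E\<^esub> i2"

definition homotopic :: "('o, 'm, 'x) precat_scheme \<Rightarrow> 'm set \<Rightarrow> 'm \<Rightarrow> 'm \<Rightarrow> bool" where
  "homotopic E W f g \<longleftrightarrow> f \<in> Arr E \<and> g \<in> Arr E \<and> Dom E f = Dom E g \<and> Cod E f = Cod E g \<and>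
     (\<exists>Y' s B i1 i2 p1 p2 \<Delta>. path_object E W (Cod E f) Y' s B i1 i2 p1 p2 \<Delta> \<and>
        (\<exists>k \<in> Hom E (Dom E f) Y'. (p1 \<cdot>\<^bsub>E\<^esub> \<Delta>) \<cdot>\<^bsub>E\<^esub> k = f \<and> (p2 \<cdot>\<^bsub>E\<^esub> \<Delta>) \<cdot>\<^bsub>E\<^esub> k = g))"

definition pr_mod_mho :: "('o, 'm, 'x) excat_scheme \<Rightarrow> 'o set \<Rightarrow> ('o, 'm set) precat" where
  "pr_mod_mho E M = quotient_cat (full_sub E (pr E M)) (factoring E (mho E M))"

definition Ho :: "('o, 'm, 'x) excat_scheme \<Rightarrow> 'o set \<Rightarrow> ('o, 'o \<times> 'm step list set \<times> 'o) cat" where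
  "Ho E M = localization E (weak_equivalences E M)"

end

theory Submission
  imports Defs
begin

text \<open>All statements are read off in the stable category \<open>Q\<close>, the quotient of \<open>E\<close> by the
  morphisms factoring through injectives.  An object \<open>X\<close> of \<open>pr M\<close> carries
  \<open>M\<^sub>1 \<rightarrow> M\<^sub>0 \<rightarrow> X\<close> in \<open>Q\<close> which is a presentation of \<open>G X\<close> (by rigidity) and in which
  \<open>M\<^sub>0 \<rightarrow> X\<close> is a weak cokernel.  Consequently, up to morphisms killed by \<open>G\<close>, morphisms out of
  \<open>X\<close> lift uniquely along weak equivalences, and every natural transformation \<open>G X \<rightarrow> G Y\<close> comes
  from a morphism \<open>X \<rightarrow> Y\<close>; the morphisms out of \<open>X\<close> killed by \<open>G\<close> are those factoring through
  \<open>mho M\<close>.  Cones of morphisms in \<open>M\<close> lie in \<open>pr M\<close>, realise all finitely presented modules, and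
  provide a weak equivalence from an object of \<open>pr M\<close> to any given object of \<open>E\<close>.  Thus
  \<open>pr M / mho M \<rightarrow> Ho E\<close> is full and essentially surjective, and its composite with the functor
  \<open>Ho E \<rightarrow> mod M\<close> induced by \<open>G\<close> is an equivalence, so both functors are equivalences.\<close>

section \<open>Categories and equivalences\<close>

text \<open>Equality in \<open>Ho\<close> is a congruence generated on zigzags, so it cannot be
  analysed directly when two morphisms of \<open>pr M\<close> have the same image. The functor
  induced by \<open>G\<close> supplies the invariant: it evaluates zigzags to natural maps, whose
  equality is pointwise, and \<open>ghost_mho\<close> turns vanishing there into a factorization
  through \<open>mho M\<close>. Hence both equivalences are obtained at once.

  Of the triangle on a morphism only two properties are kept: exactness on \<open>M\<close> and a
  weak cokernel. They are proved by correcting representatives by stably zero morphisms until an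
  equation holds on the nose in \<open>E\<close>, where kernels and cokernels apply. Injectivity
  extends such corrections along inflations; projectivity of the same objects lifts them along
  deflations. Rigidity lifts morphisms from \<open>M\<close> along deflations with kernel in
  \<open>M\<close>.

  Weak equivalences are defined by modules carried by sets of morphisms, while the target category
  has modules carried by 'g. The theory of representables is therefore developed for an arbitrary
  encoding and instantiated twice.\<close>

context category
begin

lemma Hom_D: "f \<in> Hom C X Y \<Longrightarrow> f \<in> Arr C \<and> Dom C f = X \<and> Cod C f = Y"
  by (simp add: Hom_def)

lemma Hom_objs: "f \<in> Hom C X Y \<Longrightarrow> X \<in> Obj C \<and> Y \<in> Obj C"
  using Dom_in Cod_in by (auto simp: Hom_def)

lemma Hom_I: "f \<in> Arr C \<Longrightarrow> f \<in> Hom C (Dom C f) (Cod C f)"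
  by (simp add: Hom_def)

lemma Ident_arr [simp]:
  assumes "X \<in> Obj C"
  shows "Ident C X \<in> Arr C" "Dom C (Ident C X) = X" "Cod C (Ident C X) = X"
  using Ident_in[OF assms] by (auto simp: Hom_def)

text \<open>Typing conditions are equations on \<open>Dom\<close> and \<open>Cod\<close> instead of
  membership in \<open>Hom\<close>, so that the simplifier can discharge them while
  rewriting.\<close>

lemma comp_arr [simp]:
  assumes "f \<in> Arr C" "g \<in> Arr C" "Dom C g = Cod C f"
  shows "g \<cdot> f \<in> Arr C" "Dom C (g \<cdot> f) = Dom C f" "Cod C (g \<cdot> f) = Cod C g"
  using Comp_in[of f "Dom C f" "Cod C f" g "Cod C g"] assms by (auto simp: Hom_def)

lemma comp_assoc:
  assumes "f \<in> Arr C" "g \<in> Arr C" "h \<in> Arr C" "Dom C g = Cod C f" "Dom C h = Cod C g"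
  shows "(h \<cdot> g) \<cdot> f = h \<cdot> (g \<cdot> f)"
  using Comp_assoc[of f "Dom C f" "Cod C f" g "Cod C g" h "Cod C h"] assms by (auto simp: Hom_def)

lemma comp_ident [simp]:
  assumes "f \<in> Arr C"
  shows "Dom C f = X \<Longrightarrow> f \<cdot> Ident C X = f" "Cod C f = X \<Longrightarrow> Ident C X \<cdot> f = f"
  using Ident_right Ident_left assms by (auto simp: Hom_def)

lemma iso_inverse:
  assumes "is_iso C f" "f \<in> Hom C X Y"
  obtains g where "g \<in> Hom C Y X" "g \<cdot> f = Ident C X" "f \<cdot> g = Ident C Y" "is_iso C g"
proof -
  obtain g where g: "g \<in> Hom C Y X" "g \<cdot> f = Ident C X" "f \<cdot> g = Ident C Y"
    using assms by (auto simp: is_iso_def Hom_def)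
  moreover have "is_iso C g"
    unfolding is_iso_def using g assms by (auto simp: Hom_def)
  ultimately show ?thesis using that by blast
qed

lemma is_isoI:
  assumes "f \<in> Hom C X Y" "g \<in> Hom C Y X" "g \<cdot> f = Ident C X" "f \<cdot> g = Ident C Y"
  shows "is_iso C f"
  using assms by (auto simp: is_iso_def Hom_def)

lemma iso_Ident: "X \<in> Obj C \<Longrightarrow> is_iso C (Ident C X)"
  by (rule is_isoI[OF Ident_in Ident_in]) auto

lemma iso_cancel_left:
  assumes "is_iso C b" "b \<in> Hom C Y Z" "f \<in> Hom C X Y" "g \<in> Hom C X Y" "b \<cdot> f = b \<cdot> g"
  shows "f = g"
proof -
  obtain b' where b': "b' \<in> Hom C Z Y" "b' \<cdot> b = Ident C Y"
    using iso_inverse assms by blast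
  have "b' \<cdot> (b \<cdot> f) = f"
    unfolding Comp_assoc[OF assms(3,2) b'(1), symmetric] b'(2) by (rule Ident_left[OF assms(3)])
  moreover have "b' \<cdot> (b \<cdot> g) = g"
    unfolding Comp_assoc[OF assms(4,2) b'(1), symmetric] b'(2) by (rule Ident_left[OF assms(4)])
  ultimately show ?thesis using assms(5) by metis
qed

lemma iso_cancel_right:
  assumes "is_iso C b" "b \<in> Hom C X Y" "f \<in> Hom C Y Z" "g \<in> Hom C Y Z" "f \<cdot> b = g \<cdot> b"
  shows "f = g"
proof -
  obtain b' where b': "b' \<in> Hom C Y X" "b \<cdot> b' = Ident C Y"
    using iso_inverse assms by blast
  have "(f \<cdot> b) \<cdot> b' = f"
    unfolding Comp_assoc[OF b'(1) assms(2,3)] b'(2) by (rule Ident_right[OF assms(3)])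
  moreover have "(g \<cdot> b) \<cdot> b' = g"
    unfolding Comp_assoc[OF b'(1) assms(2,4)] b'(2) by (rule Ident_right[OF assms(4)])
  ultimately show ?thesis using assms(5) by metis
qed

end

section \<open>Full subcategories and functors\<close>

lemma full_sub_sel [simp]:
  "Obj (full_sub C S) = Obj C \<inter> S" "Dom (full_sub C S) = Dom C" "Cod (full_sub C S) = Cod C"
  "Ident (full_sub C S) = Ident C" "Comp (full_sub C S) = Comp C"
  "Arr (full_sub C S) = {f \<in> Arr C. Dom C f \<in> S \<and> Cod C f \<in> S}"
  by (simp_all add: full_sub_def)

lemma full_sub_sel_add [simp]:
  "Add (full_sub C S) = Add C" "Zero (full_sub C S) = Zero C"
  by (simp_all add: full_sub_def)

lemma Hom_full_sub: "Hom (full_sub C S) X Y = (if X \<in> S \<and> Y \<in> S then Hom C X Y else {})"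
  by (auto simp: Hom_def)

lemma (in category) category_full_sub: "category (full_sub C S)"
  by unfold_locales
    (auto simp: Hom_full_sub Dom_in Cod_in Ident_in Comp_in Ident_left Ident_right Comp_assoc
        split: if_splits)

lemma (in category) is_iso_full_sub:
  assumes "is_iso C f" "Dom C f \<in> S" "Cod C f \<in> S"
  shows "is_iso (full_sub C S) f"
  using assms by (auto simp: is_iso_def Hom_def)

lemma functor_obj: "is_functor C D F \<Longrightarrow> X \<in> Obj C \<Longrightarrow> on_obj F X \<in> Obj D"
  by (simp add: is_functor_def)

lemma functor_ident:
  "is_functor C D F \<Longrightarrow> X \<in> Obj C \<Longrightarrow> on_arr F (Ident C X) = Ident D (on_obj F X)"
  by (simp add: is_functor_def)

lemma (in category) functor_hom:
  "is_functor C D F \<Longrightarrow> f \<in> Hom C X Y \<Longrightarrow> on_arr F f \<in> Hom D (on_obj F X) (on_obj F Y)"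
  using Hom_objs unfolding is_functor_def by blast

lemma (in category) functor_comp:
  "is_functor C D F \<Longrightarrow> f \<in> Hom C X Y \<Longrightarrow> g \<in> Hom C Y Z \<Longrightarrow>
    on_arr F (g \<cdot> f) = on_arr F g \<cdot>\<^bsub>D\<^esub> on_arr F f"
  using Hom_objs[of f X Y] Hom_objs[of g Y Z] unfolding is_functor_def by blast

text \<open>The quasi-inverse picks for each \<open>Y\<close> an object \<open>T Y\<close> with an isomorphism
  \<open>e Y : F (T Y) \<rightarrow> Y\<close>, and sends \<open>g\<close> to the unique preimage of its conjugate by \<open>e\<close>.\<close>

lemma equivalenceI:
  assumes C: "category C" and D: "category D" and F: "is_functor C D F"
    and faithful: "\<And>X Y f g. \<lbrakk>f \<in> Hom C X Y; g \<in> Hom C X Y; on_arr F f = on_arr F g\<rbrakk> \<Longrightarrow> f = g"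
    and full: "\<And>X Y g. \<lbrakk>X \<in> Obj C; Y \<in> Obj C; g \<in> Hom D (on_obj F X) (on_obj F Y)\<rbrakk>
      \<Longrightarrow> \<exists>f \<in> Hom C X Y. on_arr F f = g"
    and ess: "\<And>Y. Y \<in> Obj D \<Longrightarrow> \<exists>X \<in> Obj C. \<exists>f \<in> Hom D (on_obj F X) Y. is_iso D f"
  shows "is_equivalence C D F"
proof -
  interpret C: category C by fact
  interpret D: category D by fact
  \<comment> \<open>The triple keeps the inverse next to the isomorphism: one choice per
    \<open>Y\<close> fixes \<open>T Y\<close> and the mutually inverse \<open>e Y\<close> and
    \<open>e' Y\<close>.\<close>
  define iso_from where "iso_from Y = (\<lambda>(X, f, f'). X \<in> Obj C \<and> f \<in> Hom D (on_obj F X) Y \<and>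
      f' \<in> Hom D Y (on_obj F X) \<and> f' \<cdot>\<^bsub>D\<^esub> f = Ident D (on_obj F X) \<and> f \<cdot>\<^bsub>D\<^esub> f' = Ident D Y \<and>
      is_iso D f)" for Y
  define t where "t Y = (SOME t. iso_from Y t)" for Y
  have t: "iso_from Y (t Y)" if Y: "Y \<in> Obj D" for Y
  proof -
    obtain X f where Xf: "X \<in> Obj C" "f \<in> Hom D (on_obj F X) Y" "is_iso D f"
      using ess Y by blast
    obtain f' where f': "f' \<in> Hom D Y (on_obj F X)" "f' \<cdot>\<^bsub>D\<^esub> f = Ident D (on_obj F X)"
      "f \<cdot>\<^bsub>D\<^esub> f' = Ident D Y"
      using D.iso_inverse[OF Xf(3,2)] by blast
    have "iso_from Y (X, f, f')" unfolding iso_from_def using Xf f' by simp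
    then show ?thesis unfolding t_def by (rule someI)
  qed
  define T e e' where "T Y = fst (t Y)" and "e Y = fst (snd (t Y))" and "e' Y = snd (snd (t Y))" for Y
  have T: "T Y \<in> Obj C" and e: "e Y \<in> Hom D (on_obj F (T Y)) Y"
    and e': "e' Y \<in> Hom D Y (on_obj F (T Y))"
    and e'e: "e' Y \<cdot>\<^bsub>D\<^esub> e Y = Ident D (on_obj F (T Y))"
    and ee': "e Y \<cdot>\<^bsub>D\<^esub> e' Y = Ident D Y"
    and iso_e: "is_iso D (e Y)" if "Y \<in> Obj D" for Y
    using t[OF that] unfolding iso_from_def T_def e_def e'_def by (simp_all add: case_prod_beta)
  define L where "L X Y g = (SOME f. f \<in> Hom C X Y \<and> on_arr F f = g)" for X Y g
  have L: "L X Y g \<in> Hom C X Y" "on_arr F (L X Y g) = g"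
    if "X \<in> Obj C" "Y \<in> Obj C" "g \<in> Hom D (on_obj F X) (on_obj F Y)" for X Y g
  proof -
    have "\<exists>f. f \<in> Hom C X Y \<and> on_arr F f = g" using full that by blast
    from someI_ex[OF this] show "L X Y g \<in> Hom C X Y" "on_arr F (L X Y g) = g"
      unfolding L_def by auto
  qed
  have L_iso: "is_iso C (L X Y g)"
    if X: "X \<in> Obj C" and Y: "Y \<in> Obj C" and g: "g \<in> Hom D (on_obj F X) (on_obj F Y)"
      and i: "is_iso D g" for X Y g
  proof -
    obtain h where h: "h \<in> Hom D (on_obj F Y) (on_obj F X)"
      "h \<cdot>\<^bsub>D\<^esub> g = Ident D (on_obj F X)" "g \<cdot>\<^bsub>D\<^esub> h = Ident D (on_obj F Y)"
      using D.iso_inverse[OF i g] by blast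
    show ?thesis
    proof (rule C.is_isoI)
      show 1: "L X Y g \<in> Hom C X Y" and 2: "L Y X h \<in> Hom C Y X" using L X Y g h by auto
      show "L Y X h \<cdot>\<^bsub>C\<^esub> L X Y g = Ident C X"
        by (rule faithful[OF C.Comp_in[OF 1 2] C.Ident_in])
          (use X Y g h L C.functor_comp[OF F 1 2] functor_ident[OF F] in auto)
      show "L X Y g \<cdot>\<^bsub>C\<^esub> L Y X h = Ident C Y"
        by (rule faithful[OF C.Comp_in[OF 2 1] C.Ident_in])
          (use X Y g h L C.functor_comp[OF F 2 1] functor_ident[OF F] in auto)
    qed
  qed
  define K where "K g = e' (Cod D g) \<cdot>\<^bsub>D\<^esub> (g \<cdot>\<^bsub>D\<^esub> e (Dom D g))" for g
  define F' where "F' = \<lparr>on_obj = T, on_arr = (\<lambda>g. L (T (Dom D g)) (T (Cod D g)) (K g))\<rparr>"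
  have F'o: "on_obj F' = T" by (simp add: F'_def)
  have K: "K g \<in> Hom D (on_obj F (T X)) (on_obj F (T Y))" and eK: "e Y \<cdot>\<^bsub>D\<^esub> K g = g \<cdot>\<^bsub>D\<^esub> e X"
    if g: "g \<in> Hom D X Y" for X Y g
  proof -
    have XY: "X \<in> Obj D" "Y \<in> Obj D" using D.Hom_objs g by auto
    have Kg: "K g = e' Y \<cdot>\<^bsub>D\<^esub> (g \<cdot>\<^bsub>D\<^esub> e X)" using g by (simp add: K_def Hom_def)
    have ge: "g \<cdot>\<^bsub>D\<^esub> e X \<in> Hom D (on_obj F (T X)) Y" by (rule D.Comp_in[OF e[OF XY(1)] g])
    show "K g \<in> Hom D (on_obj F (T X)) (on_obj F (T Y))"
      unfolding Kg by (rule D.Comp_in[OF ge e'[OF XY(2)]])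
    show "e Y \<cdot>\<^bsub>D\<^esub> K g = g \<cdot>\<^bsub>D\<^esub> e X"
      unfolding Kg D.Comp_assoc[OF ge e'[OF XY(2)] e[OF XY(2)], symmetric] ee'[OF XY(2)]
      by (rule D.Ident_left[OF ge])
  qed
  have F'a: "on_arr F' g \<in> Hom C (T X) (T Y)" "on_arr F (on_arr F' g) = K g"
    if g: "g \<in> Hom D X Y" for X Y g
  proof -
    have XY: "X \<in> Obj D" "Y \<in> Obj D" "Dom D g = X" "Cod D g = Y"
      using D.Hom_objs D.Hom_D g by auto
    show "on_arr F' g \<in> Hom C (T X) (T Y)" "on_arr F (on_arr F' g) = K g"
      using L[OF T T K[OF g]] XY by (auto simp: F'_def)
  qed
  have FK: "e Y \<cdot>\<^bsub>D\<^esub> on_arr F (on_arr F' g) = g \<cdot>\<^bsub>D\<^esub> e X" if "g \<in> Hom D X Y" for X Y g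
    using F'a(2)[OF that] eK[OF that] by simp
  have F': "is_functor D C F'"
    unfolding is_functor_def
  proof (intro conjI ballI)
    fix X assume X: "X \<in> Obj D"
    show "on_obj F' X \<in> Obj C" using T X F'o by simp
    show "on_arr F' (Ident D X) = Ident C (on_obj F' X)"
    proof (rule faithful)
      show "on_arr F' (Ident D X) \<in> Hom C (T X) (T X)" by (rule F'a(1)[OF D.Ident_in[OF X]])
      show "Ident C (on_obj F' X) \<in> Hom C (T X) (T X)" using C.Ident_in[OF T[OF X]] F'o by simp
      have "K (Ident D X) = Ident D (on_obj F (T X))"
        using X e[OF X] e'e[OF X] by (auto simp: K_def Hom_def)
      then show "on_arr F (on_arr F' (Ident D X)) = on_arr F (Ident C (on_obj F' X))"
        using F'a(2)[OF D.Ident_in[OF X]] functor_ident[OF F T[OF X]] F'o by simp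
    qed
  next
    fix X Y f assume "f \<in> Hom D X Y"
    then show "on_arr F' f \<in> Hom C (on_obj F' X) (on_obj F' Y)" using F'a F'o by simp
  next
    fix X Y Z f g assume f: "f \<in> Hom D X Y" and g: "g \<in> Hom D Y Z"
    note gf = D.Comp_in[OF f g] and F'gf = C.Comp_in[OF F'a(1)[OF f] F'a(1)[OF g]]
    have X: "X \<in> Obj D" "Y \<in> Obj D" "Z \<in> Obj D" using D.Hom_objs f g by auto
    show "on_arr F' (g \<cdot>\<^bsub>D\<^esub> f) = on_arr F' g \<cdot>\<^bsub>C\<^esub> on_arr F' f"
    proof (rule faithful[OF F'a(1)[OF gf] F'gf])
      show "on_arr F (on_arr F' (g \<cdot>\<^bsub>D\<^esub> f)) = on_arr F (on_arr F' g \<cdot>\<^bsub>C\<^esub> on_arr F' f)"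
      proof (rule D.iso_cancel_left[OF iso_e[OF X(3)] e[OF X(3)]])
        show "on_arr F (on_arr F' (g \<cdot>\<^bsub>D\<^esub> f)) \<in> Hom D (on_obj F (T X)) (on_obj F (T Z))"
          "on_arr F (on_arr F' g \<cdot>\<^bsub>C\<^esub> on_arr F' f) \<in> Hom D (on_obj F (T X)) (on_obj F (T Z))"
          using C.functor_hom[OF F] F'a(1)[OF gf] F'gf by auto
        note h1 = C.functor_hom[OF F F'a(1)[OF f]] and h2 = C.functor_hom[OF F F'a(1)[OF g]]
        have "e Z \<cdot>\<^bsub>D\<^esub> on_arr F (on_arr F' g \<cdot>\<^bsub>C\<^esub> on_arr F' f) =
            e Z \<cdot>\<^bsub>D\<^esub> (on_arr F (on_arr F' g) \<cdot>\<^bsub>D\<^esub> on_arr F (on_arr F' f))"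
          using C.functor_comp[OF F F'a(1)[OF f] F'a(1)[OF g]] by simp
        also have "\<dots> = (g \<cdot>\<^bsub>D\<^esub> e Y) \<cdot>\<^bsub>D\<^esub> on_arr F (on_arr F' f)"
          using D.Comp_assoc[OF h1 h2 e[OF X(3)]] FK[OF g] by simp
        also have "\<dots> = g \<cdot>\<^bsub>D\<^esub> (f \<cdot>\<^bsub>D\<^esub> e X)"
          using D.Comp_assoc[OF h1 e[OF X(2)] g] FK[OF f] by simp
        also have "\<dots> = (g \<cdot>\<^bsub>D\<^esub> f) \<cdot>\<^bsub>D\<^esub> e X"
          using D.Comp_assoc[OF e[OF X(1)] f g] by simp
        finally show "e Z \<cdot>\<^bsub>D\<^esub> on_arr F (on_arr F' (g \<cdot>\<^bsub>D\<^esub> f)) =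
            e Z \<cdot>\<^bsub>D\<^esub> on_arr F (on_arr F' g \<cdot>\<^bsub>C\<^esub> on_arr F' f)"
          using FK[OF gf] by simp
      qed
    qed
  qed
  have FO: "on_obj F X \<in> Obj D" if "X \<in> Obj C" for X using functor_obj[OF F that] .
  \<comment> \<open>The unit at \<open>X\<close> is the preimage under \<open>F\<close> of
    \<open>e\<close> at \<open>F X\<close>; its naturality follows from that of \<open>e\<close> by
    faithfulness.\<close>
  define \<eta> where "\<eta> X = L (T (on_obj F X)) X (e (on_obj F X))" for X
  have \<eta>: "\<eta> X \<in> Hom C (T (on_obj F X)) X" "on_arr F (\<eta> X) = e (on_obj F X)" "is_iso C (\<eta> X)"
    if "X \<in> Obj C" for X
    using L[OF T[OF FO] that e[OF FO]] L_iso[OF T[OF FO] that e[OF FO] iso_e[OF FO]] that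
    by (auto simp: \<eta>_def)
  have "natural_iso C C (comp_functor F' F) id_functor \<eta>"
    unfolding natural_iso_def comp_functor_def id_functor_def cat_functor.simps o_def id_def
  proof (intro conjI ballI)
    fix X assume X: "X \<in> Obj C"
    show "\<eta> X \<in> Hom C (on_obj F' (on_obj F X)) X" "is_iso C (\<eta> X)"
      using \<eta>[OF X] F'o by auto
  next
    fix X Y f assume XY: "X \<in> Obj C" "Y \<in> Obj C" and f: "f \<in> Hom C X Y"
    note Ff = C.functor_hom[OF F f]
    note a = F'a[OF Ff]
    show "\<eta> Y \<cdot>\<^bsub>C\<^esub> on_arr F' (on_arr F f) = f \<cdot>\<^bsub>C\<^esub> \<eta> X"
    proof (rule faithful[OF C.Comp_in[OF a(1) \<eta>(1)[OF XY(2)]] C.Comp_in[OF \<eta>(1)[OF XY(1)] f]])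
      show "on_arr F (\<eta> Y \<cdot>\<^bsub>C\<^esub> on_arr F' (on_arr F f)) = on_arr F (f \<cdot>\<^bsub>C\<^esub> \<eta> X)"
        using C.functor_comp[OF F a(1) \<eta>(1)[OF XY(2)]] C.functor_comp[OF F \<eta>(1)[OF XY(1)] f]
          \<eta>(2) XY FK[OF Ff] by simp
    qed
  qed
  moreover have "natural_iso D D (comp_functor F F') id_functor e"
    unfolding natural_iso_def comp_functor_def id_functor_def cat_functor.simps o_def id_def
    using e iso_e FK F'o by auto
  ultimately show ?thesis unfolding is_equivalence_def using F F' by blast
qed

text \<open>Conjugation by isomorphisms from objects \<open>F X\<close> reduces full faithfulness of \<open>H\<close> to that of
  \<open>H \<circ> F\<close>.\<close>

lemma equivalences_from_composite:
  assumes C: "category C" and D: "category D" and B: "category B"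
    and F: "is_functor C D F" and H: "is_functor D B H"
    and F_full: "\<And>X Y g. \<lbrakk>X \<in> Obj C; Y \<in> Obj C; g \<in> Hom D (on_obj F X) (on_obj F Y)\<rbrakk>
      \<Longrightarrow> \<exists>f \<in> Hom C X Y. on_arr F f = g"
    and F_ess: "\<And>Y. Y \<in> Obj D \<Longrightarrow> \<exists>X \<in> Obj C. \<exists>f \<in> Hom D (on_obj F X) Y. is_iso D f"
    and HF_faithful: "\<And>X Y f g. \<lbrakk>f \<in> Hom C X Y; g \<in> Hom C X Y;
      on_arr H (on_arr F f) = on_arr H (on_arr F g)\<rbrakk> \<Longrightarrow> f = g"
    and HF_full: "\<And>X Y g. \<lbrakk>X \<in> Obj C; Y \<in> Obj C;
      g \<in> Hom B (on_obj H (on_obj F X)) (on_obj H (on_obj F Y))\<rbrakk>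
      \<Longrightarrow> \<exists>f \<in> Hom C X Y. on_arr H (on_arr F f) = g"
    and HF_ess: "\<And>Y. Y \<in> Obj B \<Longrightarrow>
      \<exists>X \<in> Obj C. \<exists>f \<in> Hom B (on_obj H (on_obj F X)) Y. is_iso B f"
  shows "is_equivalence C D F" "is_equivalence D B H"
proof -
  interpret C: category C by fact
  interpret D: category D by fact
  interpret B: category B by fact
  show "is_equivalence C D F"
  proof (rule equivalenceI[OF C D F _ F_full F_ess])
    fix X Y f g assume "f \<in> Hom C X Y" "g \<in> Hom C X Y" "on_arr F f = on_arr F g"
    then show "f = g" using HF_faithful by metis
  qed auto
  show "is_equivalence D B H"
  proof (rule equivalenceI[OF D B H])
    fix X Y f g
    assume f: "f \<in> Hom D X Y" and g: "g \<in> Hom D X Y" and eq: "on_arr H f = on_arr H g"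
    have XY: "X \<in> Obj D" "Y \<in> Obj D" using D.Hom_objs f by auto
    obtain X' a where X': "X' \<in> Obj C" and a: "a \<in> Hom D (on_obj F X') X" "is_iso D a"
      using F_ess XY by blast
    obtain Y' b0 where Y': "Y' \<in> Obj C" and b0: "b0 \<in> Hom D (on_obj F Y') Y" "is_iso D b0"
      using F_ess XY by blast
    obtain b where b: "b \<in> Hom D Y (on_obj F Y')" "is_iso D b"
      using D.iso_inverse b0 by blast
    have fb: "b \<cdot>\<^bsub>D\<^esub> f \<in> Hom D X (on_obj F Y')" and gb: "b \<cdot>\<^bsub>D\<^esub> g \<in> Hom D X (on_obj F Y')"
      using D.Comp_in f g b by auto
    obtain f' where f': "f' \<in> Hom C X' Y'" "on_arr F f' = (b \<cdot>\<^bsub>D\<^esub> f) \<cdot>\<^bsub>D\<^esub> a"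
      using F_full[OF X' Y' D.Comp_in[OF a(1) fb]] by blast
    obtain g' where g': "g' \<in> Hom C X' Y'" "on_arr F g' = (b \<cdot>\<^bsub>D\<^esub> g) \<cdot>\<^bsub>D\<^esub> a"
      using F_full[OF X' Y' D.Comp_in[OF a(1) gb]] by blast
    have "on_arr H (on_arr F f') = on_arr H (on_arr F g')"
      using eq f' g' D.functor_comp[OF H a(1) fb] D.functor_comp[OF H a(1) gb]
        D.functor_comp[OF H f b(1)] D.functor_comp[OF H g b(1)] by simp
    then have "f' = g'" using HF_faithful f' g' by blast
    then have "(b \<cdot>\<^bsub>D\<^esub> f) \<cdot>\<^bsub>D\<^esub> a = (b \<cdot>\<^bsub>D\<^esub> g) \<cdot>\<^bsub>D\<^esub> a" using f' g' by simp
    then have "b \<cdot>\<^bsub>D\<^esub> f = b \<cdot>\<^bsub>D\<^esub> g" by (rule D.iso_cancel_right[OF a(2,1) fb gb])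
    then show "f = g" by (rule D.iso_cancel_left[OF b(2,1) f g])
  next
    fix X Y k
    assume XY: "X \<in> Obj D" "Y \<in> Obj D" and k: "k \<in> Hom B (on_obj H X) (on_obj H Y)"
    obtain X' a where X': "X' \<in> Obj C" and a: "a \<in> Hom D (on_obj F X') X" "is_iso D a"
      using F_ess XY by blast
    obtain Y' b where Y': "Y' \<in> Obj C" and b: "b \<in> Hom D (on_obj F Y') Y" "is_iso D b"
      using F_ess XY by blast
    obtain b' where b': "b' \<in> Hom D Y (on_obj F Y')" "b \<cdot>\<^bsub>D\<^esub> b' = Ident D Y"
      using D.iso_inverse b by blast
    obtain a' where a': "a' \<in> Hom D X (on_obj F X')" "a \<cdot>\<^bsub>D\<^esub> a' = Ident D X"
      using D.iso_inverse a by blast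
    note Ha = D.functor_hom[OF H a(1)] and Hb' = D.functor_hom[OF H b'(1)]
      and Ha' = D.functor_hom[OF H a'(1)] and Hb = D.functor_hom[OF H b(1)]
    have bk: "on_arr H b' \<cdot>\<^bsub>B\<^esub> k \<in> Hom B (on_obj H X) (on_obj H (on_obj F Y'))"
      by (rule B.Comp_in[OF k Hb'])
    obtain f where f: "f \<in> Hom C X' Y'"
      "on_arr H (on_arr F f) = (on_arr H b' \<cdot>\<^bsub>B\<^esub> k) \<cdot>\<^bsub>B\<^esub> on_arr H a"
      using HF_full[OF X' Y' B.Comp_in[OF Ha bk]] by blast
    note Ff = C.functor_hom[OF F f(1)]
    have Ffa: "on_arr F f \<cdot>\<^bsub>D\<^esub> a' \<in> Hom D X (on_obj F Y')" by (rule D.Comp_in[OF a'(1) Ff])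
    \<comment> \<open>The preimage of \<open>k\<close> is \<open>F f\<close> conjugated back to a
      morphism from \<open>X\<close> to \<open>Y\<close>.\<close>
    have "on_arr H (b \<cdot>\<^bsub>D\<^esub> (on_arr F f \<cdot>\<^bsub>D\<^esub> a')) =
        on_arr H b \<cdot>\<^bsub>B\<^esub> (((on_arr H b' \<cdot>\<^bsub>B\<^esub> k) \<cdot>\<^bsub>B\<^esub> on_arr H a) \<cdot>\<^bsub>B\<^esub> on_arr H a')"
      using D.functor_comp[OF H Ffa b(1)] D.functor_comp[OF H a'(1) Ff] f(2) by simp
    also have "((on_arr H b' \<cdot>\<^bsub>B\<^esub> k) \<cdot>\<^bsub>B\<^esub> on_arr H a) \<cdot>\<^bsub>B\<^esub> on_arr H a' = on_arr H b' \<cdot>\<^bsub>B\<^esub> k"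
      using B.Comp_assoc[OF Ha' Ha bk] D.functor_comp[OF H a'(1) a(1)] a'(2)
        functor_ident[OF H XY(1)] B.Ident_right[OF bk] by simp
    also have "on_arr H b \<cdot>\<^bsub>B\<^esub> (on_arr H b' \<cdot>\<^bsub>B\<^esub> k) = k"
      using B.Comp_assoc[OF k Hb' Hb] D.functor_comp[OF H b'(1) b(1)] b'(2)
        functor_ident[OF H XY(2)] B.Ident_left[OF k] by simp
    finally show "\<exists>f \<in> Hom D X Y. on_arr H f = k" using D.Comp_in[OF Ffa b(1)] by blast
  next
    fix Y assume "Y \<in> Obj B"
    then obtain X f where "X \<in> Obj C" "f \<in> Hom B (on_obj H (on_obj F X)) Y" "is_iso B f"
      using HF_ess by blast
    then show "\<exists>X \<in> Obj D. \<exists>f \<in> Hom B (on_obj H X) Y. is_iso B f"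
      using functor_obj[OF F] by blast
  qed
qed

section \<open>Preadditive categories and quotients by ideals\<close>

lemma homgrp_sel [simp]:
  "carrier (homgrp C X Y) = Hom C X Y" "monoid.mult (homgrp C X Y) = Add C"
  "one (homgrp C X Y) = Zero C X Y"
  by (simp_all add: homgrp_def)

lemma homgrp_full_sub: "X \<in> S \<Longrightarrow> Y \<in> S \<Longrightarrow> homgrp (full_sub C S) X Y = homgrp C X Y"
  by (simp add: homgrp_def Hom_full_sub)

context preadditive_category
begin

definition neg :: "'m \<Rightarrow> 'm" where
  "neg f = m_inv (homgrp C (Dom C f) (Cod C f)) f"

lemma Minus_neg: "Minus C f g = f \<boxplus> neg g"
  by (simp add: Minus_def neg_def)

lemma add_arr [simp]:
  assumes "f \<in> Arr C" "g \<in> Arr C" "Dom C g = Dom C f" "Cod C g = Cod C f"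
  shows "f \<boxplus> g \<in> Arr C" "Dom C (f \<boxplus> g) = Dom C f" "Cod C (f \<boxplus> g) = Cod C f"
proof -
  interpret comm_group "homgrp C (Dom C f) (Cod C f)"
    using assms Dom_in Cod_in by (intro homgrp_comm_group) auto
  show "f \<boxplus> g \<in> Arr C" "Dom C (f \<boxplus> g) = Dom C f" "Cod C (f \<boxplus> g) = Cod C f"
    using m_closed[of f g] assms by (auto simp: Hom_def)
qed

lemma zero_arr [simp]:
  assumes "X \<in> Obj C" "Y \<in> Obj C"
  shows "Zero C X Y \<in> Arr C" "Dom C (Zero C X Y) = X" "Cod C (Zero C X Y) = Y"
proof -
  interpret comm_group "homgrp C X Y" using assms by (rule homgrp_comm_group)
  show "Zero C X Y \<in> Arr C" "Dom C (Zero C X Y) = X" "Cod C (Zero C X Y) = Y"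
    using one_closed by (auto simp: Hom_def)
qed

lemma neg_arr [simp]:
  assumes "f \<in> Arr C"
  shows "neg f \<in> Arr C" "Dom C (neg f) = Dom C f" "Cod C (neg f) = Cod C f"
proof -
  interpret comm_group "homgrp C (Dom C f) (Cod C f)"
    using assms Dom_in Cod_in by (intro homgrp_comm_group) auto
  show "neg f \<in> Arr C" "Dom C (neg f) = Dom C f" "Cod C (neg f) = Cod C f"
    using inv_closed[of f] assms by (auto simp: Hom_def neg_def)
qed

lemma add_assoc:
  assumes "f \<in> Arr C" "g \<in> Arr C" "h \<in> Arr C" "Dom C g = Dom C f" "Cod C g = Cod C f"
    "Dom C h = Dom C f" "Cod C h = Cod C f"
  shows "(f \<boxplus> g) \<boxplus> h = f \<boxplus> (g \<boxplus> h)"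
proof -
  interpret comm_group "homgrp C (Dom C f) (Cod C f)"
    using assms Dom_in Cod_in by (intro homgrp_comm_group) auto
  show ?thesis using m_assoc[of f g h] assms by (auto simp: Hom_def)
qed

lemma add_commute:
  assumes "f \<in> Arr C" "g \<in> Arr C" "Dom C g = Dom C f" "Cod C g = Cod C f"
  shows "f \<boxplus> g = g \<boxplus> f"
proof -
  interpret comm_group "homgrp C (Dom C f) (Cod C f)"
    using assms Dom_in Cod_in by (intro homgrp_comm_group) auto
  show ?thesis using m_comm[of f g] assms by (auto simp: Hom_def)
qed

lemma add_left_commute:
  assumes "f \<in> Arr C" "g \<in> Arr C" "h \<in> Arr C" "Dom C g = Dom C f" "Cod C g = Cod C f"
    "Dom C h = Dom C f" "Cod C h = Cod C f"
  shows "f \<boxplus> (g \<boxplus> h) = g \<boxplus> (f \<boxplus> h)"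
  using assms add_assoc[of f g h] add_assoc[of g f h] add_commute[of f g] by simp

lemmas add_ac = add_assoc add_commute add_left_commute

lemma add_zero [simp]:
  assumes "f \<in> Arr C" "Dom C f = X" "Cod C f = Y"
  shows "f \<boxplus> Zero C X Y = f" "Zero C X Y \<boxplus> f = f"
proof -
  interpret comm_group "homgrp C (Dom C f) (Cod C f)"
    using assms Dom_in Cod_in by (intro homgrp_comm_group) auto
  show "f \<boxplus> Zero C X Y = f" "Zero C X Y \<boxplus> f = f"
    using r_one[of f] l_one[of f] assms by (auto simp: Hom_def)
qed

lemma add_neg [simp]:
  assumes "f \<in> Arr C"
  shows "f \<boxplus> neg f = Zero C (Dom C f) (Cod C f)" "neg f \<boxplus> f = Zero C (Dom C f) (Cod C f)"
proof -
  interpret comm_group "homgrp C (Dom C f) (Cod C f)"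
    using assms Dom_in Cod_in by (intro homgrp_comm_group) auto
  show "f \<boxplus> neg f = Zero C (Dom C f) (Cod C f)" "neg f \<boxplus> f = Zero C (Dom C f) (Cod C f)"
    using r_inv[of f] l_inv[of f] assms by (auto simp: Hom_def neg_def)
qed

lemma add_neg_cancel [simp]:
  assumes "f \<in> Arr C" "g \<in> Arr C" "Dom C g = Dom C f" "Cod C g = Cod C f"
  shows "f \<boxplus> (neg f \<boxplus> g) = g" "neg f \<boxplus> (f \<boxplus> g) = g"
  using assms add_assoc[of f "neg f" g] add_assoc[of "neg f" f g] by auto

lemma neg_unique:
  assumes "f \<in> Arr C" "g \<in> Arr C" "Dom C g = Dom C f" "Cod C g = Cod C f"
    "f \<boxplus> g = Zero C (Dom C f) (Cod C f)"
  shows "g = neg f"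
proof -
  have "g = neg f \<boxplus> (f \<boxplus> g)" using assms(1-4) by simp
  also have "\<dots> = neg f" unfolding assms(5) using assms(1-4) by simp
  finally show ?thesis .
qed

lemma neg_neg [simp]: "f \<in> Arr C \<Longrightarrow> neg (neg f) = f"
  using neg_unique[of "neg f" f] by simp

lemma neg_zero [simp]: "X \<in> Obj C \<Longrightarrow> Y \<in> Obj C \<Longrightarrow> neg (Zero C X Y) = Zero C X Y"
  by (rule neg_unique[symmetric]) simp_all

lemma neg_add [simp]:
  assumes "f \<in> Arr C" "g \<in> Arr C" "Dom C g = Dom C f" "Cod C g = Cod C f"
  shows "neg (f \<boxplus> g) = neg f \<boxplus> neg g"
  by (rule neg_unique[symmetric]) (use assms in \<open>simp_all add: add_ac\<close>)

lemma comp_add [simp]: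
  assumes "f \<in> Arr C" "g \<in> Arr C" "h \<in> Arr C" "Dom C g = Dom C f" "Cod C g = Cod C f"
  shows "Dom C h = Cod C f \<Longrightarrow> h \<cdot> (f \<boxplus> g) = h \<cdot> f \<boxplus> h \<cdot> g"
    "Cod C h = Dom C f \<Longrightarrow> (f \<boxplus> g) \<cdot> h = f \<cdot> h \<boxplus> g \<cdot> h"
  using Comp_Add_right[of f "Dom C f" "Cod C f" g h "Cod C h"]
    Comp_Add_left[of h "Dom C h" "Dom C f" f "Cod C f" g] assms by (auto simp: Hom_def)

lemma add_self_zero:
  assumes "f \<in> Arr C" "f \<boxplus> f = f" shows "f = Zero C (Dom C f) (Cod C f)"
proof -
  have "f = neg f \<boxplus> (f \<boxplus> f)" using assms(1) by simp
  also have "\<dots> = Zero C (Dom C f) (Cod C f)" unfolding assms(2) using assms(1) by simp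
  finally show ?thesis .
qed

text \<open>Composition with \<open>f\<close> is additive, so the image of zero equals its own
  double, and \<open>add_self_zero\<close> applies.\<close>

lemma comp_zero [simp]:
  assumes "f \<in> Arr C"
  shows "Dom C f = X \<Longrightarrow> W \<in> Obj C \<Longrightarrow> f \<cdot> Zero C W X = Zero C W (Cod C f)"
    "Cod C f = X \<Longrightarrow> W \<in> Obj C \<Longrightarrow> Zero C X W \<cdot> f = Zero C (Dom C f) W"
proof -
  assume X: "Dom C f = X" and W: "W \<in> Obj C"
  have "X \<in> Obj C" using Dom_in assms X by auto
  then have "f \<cdot> Zero C W X \<boxplus> f \<cdot> Zero C W X = f \<cdot> Zero C W X"
    using comp_add(1)[of "Zero C W X" "Zero C W X" f, symmetric] assms X W by (simp del: comp_add)
  from add_self_zero[OF _ this] show "f \<cdot> Zero C W X = Zero C W (Cod C f)"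
    using \<open>X \<in> Obj C\<close> assms X W by simp
next
  assume X: "Cod C f = X" and W: "W \<in> Obj C"
  have "X \<in> Obj C" using Cod_in assms X by auto
  then have "Zero C X W \<cdot> f \<boxplus> Zero C X W \<cdot> f = Zero C X W \<cdot> f"
    using comp_add(2)[of "Zero C X W" "Zero C X W" f, symmetric] assms X W by (simp del: comp_add)
  from add_self_zero[OF _ this] show "Zero C X W \<cdot> f = Zero C (Dom C f) W"
    using \<open>X \<in> Obj C\<close> assms X W by simp
qed

lemma comp_neg [simp]:
  assumes "f \<in> Arr C" "g \<in> Arr C" "Dom C g = Cod C f"
  shows "g \<cdot> neg f = neg (g \<cdot> f)" "neg g \<cdot> f = neg (g \<cdot> f)"
proof -
  note objs = Dom_in[OF assms(1)] Cod_in[OF assms(1)] Cod_in[OF assms(2)]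
  have "g \<cdot> f \<boxplus> g \<cdot> neg f = g \<cdot> (f \<boxplus> neg f)"
    by (rule comp_add(1)[symmetric]) (use assms in simp_all)
  also have "\<dots> = Zero C (Dom C f) (Cod C g)" using assms objs by simp
  finally show "g \<cdot> neg f = neg (g \<cdot> f)" using assms by (intro neg_unique) simp_all
  have "g \<cdot> f \<boxplus> neg g \<cdot> f = (g \<boxplus> neg g) \<cdot> f"
    by (rule comp_add(2)[symmetric]) (use assms in simp_all)
  also have "\<dots> = Zero C (Dom C f) (Cod C g)" using assms objs by simp
  finally show "neg g \<cdot> f = neg (g \<cdot> f)" using assms by (intro neg_unique) simp_all
qed

lemma diff_zero_iff:
  assumes "f \<in> Arr C" "g \<in> Arr C" "Dom C g = Dom C f" "Cod C g = Cod C f"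
  shows "f \<boxplus> neg g = Zero C (Dom C f) (Cod C f) \<longleftrightarrow> f = g"
proof
  assume "f \<boxplus> neg g = Zero C (Dom C f) (Cod C f)"
  then have "neg g = neg f" using assms by (intro neg_unique) auto
  then have "neg (neg g) = neg (neg f)" by simp
  then show "f = g" using assms by simp
qed (use assms in auto)

lemma add_diff_cancel:
  assumes "f \<in> Arr C" "g \<in> Arr C" "Dom C g = Dom C f" "Cod C g = Cod C f"
  shows "f \<boxplus> neg g \<boxplus> g = f" "f \<boxplus> g \<boxplus> neg g = f"
  using assms by (simp_all add: add_assoc Dom_in Cod_in)

lemma add_swap:
  assumes "a \<in> Arr C" "b \<in> Arr C" "c \<in> Arr C" "d \<in> Arr C"
    "Dom C b = Dom C a" "Dom C c = Dom C a" "Dom C d = Dom C a"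
    "Cod C b = Cod C a" "Cod C c = Cod C a" "Cod C d = Cod C a"
  shows "(a \<boxplus> b) \<boxplus> (c \<boxplus> d) = (a \<boxplus> c) \<boxplus> (b \<boxplus> d)"
  using assms by (simp add: add_ac)

lemma add_Hom: "f \<in> Hom C X Y \<Longrightarrow> g \<in> Hom C X Y \<Longrightarrow> f \<boxplus> g \<in> Hom C X Y"
  and neg_Hom: "f \<in> Hom C X Y \<Longrightarrow> neg f \<in> Hom C X Y"
  and zero_Hom: "X \<in> Obj C \<Longrightarrow> Y \<in> Obj C \<Longrightarrow> Zero C X Y \<in> Hom C X Y"
  by (auto simp: Hom_def)

lemma preadditive_full_sub: "preadditive_category (full_sub C S)"
proof -
  interpret F: category "full_sub C S" by (rule category_full_sub)
  show ?thesis
    by (rule preadditive_category.intro[OF F.category_axioms], unfold preadditive_category_axioms_def)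
      (auto simp: homgrp_full_sub Hom_full_sub homgrp_comm_group Comp_Add_left Comp_Add_right
        split: if_splits)
qed

subsection \<open>Biproducts\<close>

lemma biproduct_arrs:
  assumes "is_biproduct C X Y B i1 i2 p1 p2"
  shows "B \<in> Obj C" "X \<in> Obj C" "Y \<in> Obj C"
    "i1 \<in> Arr C" "Dom C i1 = X" "Cod C i1 = B" "i2 \<in> Arr C" "Dom C i2 = Y" "Cod C i2 = B"
    "p1 \<in> Arr C" "Dom C p1 = B" "Cod C p1 = X" "p2 \<in> Arr C" "Dom C p2 = B" "Cod C p2 = Y"
  using assms Hom_objs[of i1 X B] Hom_objs[of i2 Y B] by (auto simp: is_biproduct_def Hom_def)

lemma biproduct_comp:
  assumes "is_biproduct C X Y B i1 i2 p1 p2"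
  shows "p1 \<cdot> i1 = Ident C X" "p2 \<cdot> i2 = Ident C Y" "p1 \<cdot> i2 = Zero C Y X" "p2 \<cdot> i1 = Zero C X Y"
    "x \<in> Arr C \<Longrightarrow> Cod C x = X \<Longrightarrow> p1 \<cdot> (i1 \<cdot> x) = x"
    "y \<in> Arr C \<Longrightarrow> Cod C y = Y \<Longrightarrow> p2 \<cdot> (i2 \<cdot> y) = y"
    "y \<in> Arr C \<Longrightarrow> Cod C y = Y \<Longrightarrow> p1 \<cdot> (i2 \<cdot> y) = Zero C (Dom C y) X"
    "x \<in> Arr C \<Longrightarrow> Cod C x = X \<Longrightarrow> p2 \<cdot> (i1 \<cdot> x) = Zero C (Dom C x) Y"
proof -
  note a = biproduct_arrs[OF assms]
  show e: "p1 \<cdot> i1 = Ident C X" "p2 \<cdot> i2 = Ident C Y" "p1 \<cdot> i2 = Zero C Y X" "p2 \<cdot> i1 = Zero C X Y"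
    using assms by (auto simp: is_biproduct_def)
  show "x \<in> Arr C \<Longrightarrow> Cod C x = X \<Longrightarrow> p1 \<cdot> (i1 \<cdot> x) = x"
    "y \<in> Arr C \<Longrightarrow> Cod C y = Y \<Longrightarrow> p2 \<cdot> (i2 \<cdot> y) = y"
    "y \<in> Arr C \<Longrightarrow> Cod C y = Y \<Longrightarrow> p1 \<cdot> (i2 \<cdot> y) = Zero C (Dom C y) X"
    "x \<in> Arr C \<Longrightarrow> Cod C x = X \<Longrightarrow> p2 \<cdot> (i1 \<cdot> x) = Zero C (Dom C x) Y"
    using comp_assoc[of x i1 p1] comp_assoc[of y i2 p2] comp_assoc[of y i2 p1]
      comp_assoc[of x i1 p2] a e by auto
qed

lemma biproduct_decomp:
  assumes "is_biproduct C X Y B i1 i2 p1 p2"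
  shows "x \<in> Arr C \<Longrightarrow> Cod C x = B \<Longrightarrow> i1 \<cdot> (p1 \<cdot> x) \<boxplus> i2 \<cdot> (p2 \<cdot> x) = x"
    "x \<in> Arr C \<Longrightarrow> Dom C x = B \<Longrightarrow> (x \<cdot> i1) \<cdot> p1 \<boxplus> (x \<cdot> i2) \<cdot> p2 = x"
proof -
  note a = biproduct_arrs[OF assms]
  have e: "i1 \<cdot> p1 \<boxplus> i2 \<cdot> p2 = Ident C B" using assms by (simp add: is_biproduct_def)
  show "i1 \<cdot> (p1 \<cdot> x) \<boxplus> i2 \<cdot> (p2 \<cdot> x) = x" if "x \<in> Arr C" "Cod C x = B"
    using comp_add(2)[of "i1 \<cdot> p1" "i2 \<cdot> p2" x] e a that by (simp add: comp_assoc)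
  show "(x \<cdot> i1) \<cdot> p1 \<boxplus> (x \<cdot> i2) \<cdot> p2 = x" if "x \<in> Arr C" "Dom C x = B"
    using comp_add(1)[of "i1 \<cdot> p1" "i2 \<cdot> p2" x] e a that by (simp add: comp_assoc)
qed

end

subsection \<open>Quotient categories\<close>

text \<open>Composition and addition of classes are unions over representatives. This collapses such
  a union once independence of the representatives is known, for cosets and for zigzag classes
  alike.\<close>

lemma UN_UN_const:
  assumes "a \<in> A" "b \<in> B" "\<And>x y. x \<in> A \<Longrightarrow> y \<in> B \<Longrightarrow> F x y = c"
  shows "(\<Union>x \<in> A. \<Union>y \<in> B. F x y) = c"
proof -
  have "(\<Union>x \<in> A. \<Union>y \<in> B. F x y) = (\<Union>x \<in> A. \<Union>y \<in> B. c)"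
    by (intro SUP_cong HOL.refl assms(3))
  then show ?thesis using assms(1,2) by auto
qed

text \<open>Closure under differences is the subgroup criterion; with \<open>zero_J\<close> it
  yields \<open>neg_J\<close> and \<open>add_J\<close>.\<close>

locale ideal = preadditive_category C
  for C :: "('o, 'm, 'x) precat_scheme" (structure) +
  fixes J :: "'m set"
  assumes zero_J: "\<lbrakk>X \<in> Obj C; Y \<in> Obj C\<rbrakk> \<Longrightarrow> Zero C X Y \<in> J"
    and diff_J: "\<lbrakk>f \<in> Hom C X Y; g \<in> Hom C X Y; f \<in> J; g \<in> J\<rbrakk> \<Longrightarrow> f \<boxplus> neg g \<in> J"
    and comp_J_left: "\<lbrakk>f \<in> Hom C X Y; g \<in> Hom C Y Z; f \<in> J\<rbrakk> \<Longrightarrow> g \<cdot> f \<in> J"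
    and comp_J_right: "\<lbrakk>f \<in> Hom C X Y; g \<in> Hom C Y Z; g \<in> J\<rbrakk> \<Longrightarrow> g \<cdot> f \<in> J"
begin

lemma neg_J: "f \<in> Arr C \<Longrightarrow> f \<in> J \<Longrightarrow> neg f \<in> J"
  using diff_J[of "Zero C (Dom C f) (Cod C f)" "Dom C f" "Cod C f" f]
  by (auto simp: Hom_def Dom_in Cod_in zero_J)

lemma add_J: "f \<in> Hom C X Y \<Longrightarrow> g \<in> Hom C X Y \<Longrightarrow> f \<in> J \<Longrightarrow> g \<in> J \<Longrightarrow> f \<boxplus> g \<in> J"
  using diff_J[of f X Y "neg g"] neg_J[of g] by (auto simp: Hom_def)

abbreviation q :: "'m \<Rightarrow> 'm set" where "q \<equiv> coset C J"
abbreviation Q :: "('o, 'm set) precat" where "Q \<equiv> quotient_cat C J"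

lemma mem_coset: "f \<in> Hom C X Y \<Longrightarrow> g \<in> q f \<longleftrightarrow> g \<in> Hom C X Y \<and> g \<boxplus> neg f \<in> J"
  by (auto simp: coset_def Minus_neg Hom_def)

lemma self_in_coset: "f \<in> Hom C X Y \<Longrightarrow> f \<in> q f"
  by (simp add: mem_coset Hom_D Hom_objs zero_J)

lemma coset_eq_iff:
  assumes f: "f \<in> Hom C X Y" and g: "g \<in> Hom C X Y"
  shows "q f = q g \<longleftrightarrow> f \<boxplus> neg g \<in> J"
proof
  assume "q f = q g" then show "f \<boxplus> neg g \<in> J" using self_in_coset[OF f] mem_coset[OF g] by simp
next
  assume fg: "f \<boxplus> neg g \<in> J"
  have a: "f \<boxplus> neg g \<in> Hom C X Y" using f g add_Hom neg_Hom by auto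
  have "h \<boxplus> neg f \<in> J \<longleftrightarrow> h \<boxplus> neg g \<in> J" if h: "h \<in> Hom C X Y" for h
  proof
    assume "h \<boxplus> neg f \<in> J"
    then have "(h \<boxplus> neg f) \<boxplus> (f \<boxplus> neg g) \<in> J"
      using add_J[of _ X Y] a fg h f add_Hom neg_Hom by auto
    then show "h \<boxplus> neg g \<in> J" using f g h by (simp add: Hom_def add_assoc)
  next
    assume "h \<boxplus> neg g \<in> J"
    then have "(h \<boxplus> neg g) \<boxplus> neg (f \<boxplus> neg g) \<in> J"
      using diff_J[of _ X Y] a fg h g add_Hom neg_Hom by auto
    moreover have "(h \<boxplus> neg g) \<boxplus> neg (f \<boxplus> neg g) = h \<boxplus> neg f"
      using f g h add_swap[of h "neg g" "neg f" g] by (auto simp: Hom_def)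
    ultimately show "h \<boxplus> neg f \<in> J" by simp
  qed
  then show "q f = q g" using mem_coset[OF f] mem_coset[OF g] by blast
qed

lemma coset_eq_D: "f \<in> Hom C X Y \<Longrightarrow> f' \<in> q f \<Longrightarrow> f' \<in> Hom C X Y \<and> q f' = q f"
  using mem_coset[of f X Y f'] coset_eq_iff[of f' X Y f] by auto

lemma Q_sel [simp]: "Obj Q = Obj C" "Ident Q X = q (Ident C X)" "Zero Q X Y = q (Zero C X Y)"
  by (simp_all add: quotient_cat_def)

lemma Q_arr: "f \<in> Hom C X Y \<Longrightarrow> q f \<in> Hom Q X Y"
proof -
  assume f: "f \<in> Hom C X Y"
  have ne: "q f \<noteq> {}" using self_in_coset[OF f] by blast
  have "Dom C ` q f = {X}" "Cod C ` q f = {Y}"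
    using ne mem_coset[OF f] by (auto simp: Hom_def)
  then show ?thesis using f by (auto simp: Hom_def quotient_cat_def)
qed

lemma Q_Hom: "Hom Q X Y = q ` Hom C X Y"
proof
  show "q ` Hom C X Y \<subseteq> Hom Q X Y" using Q_arr by blast
  show "Hom Q X Y \<subseteq> q ` Hom C X Y"
  proof
    fix c assume c: "c \<in> Hom Q X Y"
    then obtain f where f: "f \<in> Arr C" "c = q f" by (auto simp: Hom_def quotient_cat_def)
    have "c \<in> Hom Q (Dom C f) (Cod C f)" using f Q_arr[OF Hom_I] by simp
    with c f show "c \<in> q ` Hom C X Y" by (auto simp: Hom_def)
  qed
qed

lemma Q_comp:
  assumes f: "f \<in> Hom C X Y" and g: "g \<in> Hom C Y Z"
  shows "q g \<cdot>\<^bsub>Q\<^esub> q f = q (g \<cdot> f)"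
proof -
  have "q (g' \<cdot> f') = q (g \<cdot> f)" if f': "f' \<in> q f" and g': "g' \<in> q g" for f' g'
  proof -
    have F: "f' \<in> Hom C X Y" "f' \<boxplus> neg f \<in> J" and G: "g' \<in> Hom C Y Z" "g' \<boxplus> neg g \<in> J"
      using mem_coset f g f' g' by auto
    \<comment> \<open>Independence of representatives: g'f' - gf = g'(f' - f) + (g' - g)f, and both
      summands lie in \<open>J\<close>.\<close>
    have "g' \<cdot> (f' \<boxplus> neg f) \<in> J"
      using F G comp_J_left[OF add_Hom[OF F(1) neg_Hom[OF f]] G(1)] by auto
    moreover have "(g' \<boxplus> neg g) \<cdot> f \<in> J"
      using F G comp_J_right[OF f add_Hom[OF G(1) neg_Hom[OF g]]] by auto
    ultimately have "(g' \<cdot> (f' \<boxplus> neg f)) \<boxplus> ((g' \<boxplus> neg g) \<cdot> f) \<in> J"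
      using add_J[of _ X Z] F(1) G(1) f g by (auto simp: Hom_def)
    also have "(g' \<cdot> (f' \<boxplus> neg f)) \<boxplus> ((g' \<boxplus> neg g) \<cdot> f) = g' \<cdot> f' \<boxplus> neg (g \<cdot> f)"
      using F(1) G(1) f g by (simp add: Hom_def add_assoc)
    finally show ?thesis using coset_eq_iff[OF Comp_in[OF F(1) G(1)] Comp_in[OF f g]] by simp
  qed
  from UN_UN_const[OF self_in_coset[OF g] self_in_coset[OF f], of "\<lambda>g f. q (g \<cdot> f)", OF this]
  show ?thesis by (simp add: quotient_cat_def)
qed

lemma Q_add:
  assumes f: "f \<in> Hom C X Y" and g: "g \<in> Hom C X Y"
  shows "q f \<boxplus>\<^bsub>Q\<^esub> q g = q (f \<boxplus> g)"
proof -
  have "q (f' \<boxplus> g') = q (f \<boxplus> g)" if f': "f' \<in> q f" and g': "g' \<in> q g" for f' g'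
  proof -
    have F: "f' \<in> Hom C X Y" "f' \<boxplus> neg f \<in> J" and G: "g' \<in> Hom C X Y" "g' \<boxplus> neg g \<in> J"
      using mem_coset f g f' g' by auto
    have "(f' \<boxplus> neg f) \<boxplus> (g' \<boxplus> neg g) \<in> J"
      using add_J[of _ X Y] F G f g by (auto simp: Hom_def)
    also have "(f' \<boxplus> neg f) \<boxplus> (g' \<boxplus> neg g) = (f' \<boxplus> g') \<boxplus> neg (f \<boxplus> g)"
      using F(1) G(1) f g by (simp add: Hom_def add_swap)
    finally show ?thesis using coset_eq_iff[OF add_Hom[OF F(1) G(1)] add_Hom[OF f g]] by simp
  qed
  from UN_UN_const[OF self_in_coset[OF f] self_in_coset[OF g], of "\<lambda>f g. q (f \<boxplus> g)", OF this]
  show ?thesis by (simp add: quotient_cat_def)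
qed

lemma Q_Hom_E:
  assumes "c \<in> Hom Q X Y"
  obtains f where "f \<in> Hom C X Y" "c = q f"
  using assms Q_Hom by blast

lemma category_Q: "category Q"
proof
  fix c assume "c \<in> Arr Q"
  then have "c \<in> Hom Q (Dom Q c) (Cod Q c)" by (simp add: Hom_def)
  then obtain f where "f \<in> Hom C (Dom Q c) (Cod Q c)" using Q_Hom_E by blast
  then show "Dom Q c \<in> Obj Q" "Cod Q c \<in> Obj Q" using Hom_objs by auto
next
  fix X assume "X \<in> Obj Q" then show "Ident Q X \<in> Hom Q X X" using Q_arr Ident_in by simp
next
  fix X Y Z c d assume c: "c \<in> Hom Q X Y" and d: "d \<in> Hom Q Y Z"
  obtain f where f: "f \<in> Hom C X Y" "c = q f" using c by (rule Q_Hom_E)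
  obtain g where g: "g \<in> Hom C Y Z" "d = q g" using d by (rule Q_Hom_E)
  show "d \<cdot>\<^bsub>Q\<^esub> c \<in> Hom Q X Z"
    using Q_comp[OF f(1) g(1)] Q_arr[OF Comp_in[OF f(1) g(1)]] f(2) g(2) by simp
next
  fix X Y c assume "c \<in> Hom Q X Y"
  then obtain f where f: "f \<in> Hom C X Y" "c = q f" using Q_Hom_E by blast
  note o = Hom_objs[OF f(1)]
  show "c \<cdot>\<^bsub>Q\<^esub> Ident Q X = c" "Ident Q Y \<cdot>\<^bsub>Q\<^esub> c = c"
    using f o Q_comp[OF Ident_in f(1)] Q_comp[OF f(1) Ident_in] by (auto simp: Hom_def)
next
  fix X Y Z V b c d assume b: "b \<in> Hom Q X Y" and c: "c \<in> Hom Q Y Z" and d: "d \<in> Hom Q Z V"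
  obtain f where f: "f \<in> Hom C X Y" "b = q f" using b by (rule Q_Hom_E)
  obtain g where g: "g \<in> Hom C Y Z" "c = q g" using c by (rule Q_Hom_E)
  obtain h where h: "h \<in> Hom C Z V" "d = q h" using d by (rule Q_Hom_E)
  show "(d \<cdot>\<^bsub>Q\<^esub> c) \<cdot>\<^bsub>Q\<^esub> b = d \<cdot>\<^bsub>Q\<^esub> (c \<cdot>\<^bsub>Q\<^esub> b)"
    unfolding f(2) g(2) h(2) Q_comp[OF f(1) g(1)] Q_comp[OF g(1) h(1)]
      Q_comp[OF Comp_in[OF f(1) g(1)] h(1)] Q_comp[OF f(1) Comp_in[OF g(1) h(1)]]
    using Comp_assoc f g h by simp
qed

lemma preadditive_Q: "preadditive_category Q"
proof -
  show ?thesis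
  proof (rule preadditive_category.intro[OF category_Q], unfold preadditive_category_axioms_def,
      intro conjI allI impI)
    fix X Y assume XY: "X \<in> Obj Q" "Y \<in> Obj Q"
    show "comm_group (homgrp Q X Y)"
    proof (rule comm_groupI)
      fix b c assume "b \<in> carrier (homgrp Q X Y)" "c \<in> carrier (homgrp Q X Y)"
      then obtain f g where f: "f \<in> Hom C X Y" "b = q f" and g: "g \<in> Hom C X Y" "c = q g"
        unfolding homgrp_sel by (blast elim: Q_Hom_E)
      show "b \<otimes>\<^bsub>homgrp Q X Y\<^esub> c \<in> carrier (homgrp Q X Y)"
        using f g Q_add[OF f(1) g(1)] Q_arr[OF add_Hom[OF f(1) g(1)]] by simp
      show "b \<otimes>\<^bsub>homgrp Q X Y\<^esub> c = c \<otimes>\<^bsub>homgrp Q X Y\<^esub> b"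
        using f g Q_add[OF f(1) g(1)] Q_add[OF g(1) f(1)] add_commute[of f g] by (auto simp: Hom_def)
      fix d assume "d \<in> carrier (homgrp Q X Y)"
      then obtain h where h: "h \<in> Hom C X Y" "d = q h" unfolding homgrp_sel by (blast elim: Q_Hom_E)
      show "(b \<otimes>\<^bsub>homgrp Q X Y\<^esub> c) \<otimes>\<^bsub>homgrp Q X Y\<^esub> d = b \<otimes>\<^bsub>homgrp Q X Y\<^esub> (c \<otimes>\<^bsub>homgrp Q X Y\<^esub> d)"
        using f g h Q_add[OF f(1) g(1)] Q_add[OF g(1) h(1)] Q_add[OF add_Hom[OF f(1) g(1)] h(1)]
          Q_add[OF f(1) add_Hom[OF g(1) h(1)]] add_assoc[of f g h] by (auto simp: Hom_def)
    next
      show "\<one>\<^bsub>homgrp Q X Y\<^esub> \<in> carrier (homgrp Q X Y)" using XY Q_arr[OF zero_Hom] by simp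
    next
      fix b assume "b \<in> carrier (homgrp Q X Y)"
      then obtain f where f: "f \<in> Hom C X Y" "b = q f" unfolding homgrp_sel by (blast elim: Q_Hom_E)
      show "\<one>\<^bsub>homgrp Q X Y\<^esub> \<otimes>\<^bsub>homgrp Q X Y\<^esub> b = b"
        using f XY Q_add[OF zero_Hom f(1)] by (auto simp: Hom_def)
      have "q (neg f) \<boxplus>\<^bsub>Q\<^esub> b = Zero Q X Y"
        using f Q_add[OF neg_Hom[OF f(1)] f(1)] by (auto simp: Hom_def)
      then show "\<exists>c \<in> carrier (homgrp Q X Y). c \<otimes>\<^bsub>homgrp Q X Y\<^esub> b = \<one>\<^bsub>homgrp Q X Y\<^esub>"
        using Q_arr[OF neg_Hom[OF f(1)]] by auto
    qed
  next
    fix X Y Z b c d assume b: "b \<in> Hom Q X Y" and c: "c \<in> Hom Q Y Z" and d: "d \<in> Hom Q Y Z"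
    obtain f where f: "f \<in> Hom C X Y" "b = q f" using b by (rule Q_Hom_E)
    obtain g where g: "g \<in> Hom C Y Z" "c = q g" using c by (rule Q_Hom_E)
    obtain h where h: "h \<in> Hom C Y Z" "d = q h" using d by (rule Q_Hom_E)
    show "(c \<boxplus>\<^bsub>Q\<^esub> d) \<cdot>\<^bsub>Q\<^esub> b = c \<cdot>\<^bsub>Q\<^esub> b \<boxplus>\<^bsub>Q\<^esub> d \<cdot>\<^bsub>Q\<^esub> b"
      unfolding f(2) g(2) h(2) Q_comp[OF f(1) g(1)] Q_comp[OF f(1) h(1)] Q_add[OF g(1) h(1)]
        Q_comp[OF f(1) add_Hom[OF g(1) h(1)]] Q_add[OF Comp_in[OF f(1) g(1)] Comp_in[OF f(1) h(1)]]
        Comp_Add_left[OF f(1) g(1) h(1)] ..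
  next
    fix X Y Z b c d assume b: "b \<in> Hom Q X Y" and c: "c \<in> Hom Q X Y" and d: "d \<in> Hom Q Y Z"
    obtain f where f: "f \<in> Hom C X Y" "b = q f" using b by (rule Q_Hom_E)
    obtain g where g: "g \<in> Hom C X Y" "c = q g" using c by (rule Q_Hom_E)
    obtain h where h: "h \<in> Hom C Y Z" "d = q h" using d by (rule Q_Hom_E)
    show "d \<cdot>\<^bsub>Q\<^esub> (b \<boxplus>\<^bsub>Q\<^esub> c) = d \<cdot>\<^bsub>Q\<^esub> b \<boxplus>\<^bsub>Q\<^esub> d \<cdot>\<^bsub>Q\<^esub> c"
      unfolding f(2) g(2) h(2) Q_comp[OF f(1) h(1)] Q_comp[OF g(1) h(1)] Q_add[OF f(1) g(1)]
        Q_comp[OF add_Hom[OF f(1) g(1)] h(1)] Q_add[OF Comp_in[OF f(1) h(1)] Comp_in[OF g(1) h(1)]]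
        Comp_Add_right[OF f(1) g(1) h(1)] ..
  qed
qed

end

section \<open>Localizations\<close>

context category
begin

lemma zigzag_objs: "zigzag C W X p Y \<Longrightarrow> X \<in> Obj C \<and> Y \<in> Obj C"
proof (induction p arbitrary: X)
  case (Cons s p)
  then obtain Z where Z: "step_from_to C W X s Z" "zigzag C W Z p Y" by auto
  then show ?case using Cons.IH[OF Z(2)] Hom_objs by (cases s) auto
qed auto

lemma zigzag_Cons:
  "zigzag C W X (s # p) Y \<longleftrightarrow> (\<exists>Z. step_from_to C W X s Z \<and> zigzag C W Z p Y)"
  using zigzag_objs by auto

lemma zigzag_append:
  "zigzag C W X (p @ r) Z \<longleftrightarrow> (\<exists>Y. zigzag C W X p Y \<and> zigzag C W Y r Z)"
proof (induction p arbitrary: X)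
  case Nil
  show ?case using zigzag_objs by auto
next
  case (Cons s p)
  show ?case unfolding append_Cons zigzag_Cons Cons.IH by blast
qed

lemma zigzag_Fwd: "f \<in> Hom C X Y \<Longrightarrow> zigzag C W X [Fwd f] Y"
  using Hom_objs by auto

lemma zigzag_Bwd: "w \<in> W \<Longrightarrow> w \<in> Hom C X Y \<Longrightarrow> zigzag C W Y [Bwd w] X"
  using Hom_objs by auto

lemma zigzag_eq_zigzag: "zigzag_eq C W X Y p r \<Longrightarrow> zigzag C W X p Y \<and> zigzag C W X r Y"
proof (induction rule: zigzag_eq.induct)
  case (cong X a X' Y' p q b Y)
  then show ?case unfolding zigzag_append by blast
next
  case (comp f X Y g Z)
  then show ?case using zigzag_Fwd[OF Comp_in[OF comp]] Hom_objs by auto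
next
  case (ident X)
  then show ?case using Ident_in by auto
qed (auto dest: Hom_objs)

text \<open>\<open>cong\<close> replaces one inner segment at a time, so the two factors are
  replaced in turn.\<close>

lemma zigzag_eq_append:
  assumes "zigzag_eq C W X Y p p'" "zigzag_eq C W Y Z r r'"
  shows "zigzag_eq C W X Z (p @ r) (p' @ r')"
proof -
  note z = zigzag_eq_zigzag[OF assms(1)] zigzag_eq_zigzag[OF assms(2)]
  have nil: "zigzag C W X [] X" "zigzag C W Z [] Z" using zigzag_objs z by auto
  have "zigzag_eq C W X Z (p @ r) (p' @ r)"
    using zigzag_eq.cong[OF nil(1) assms(1), of r Z] z by simp
  moreover have "zigzag_eq C W X Z (p' @ r) (p' @ r')"
    using zigzag_eq.cong[OF _ assms(2) nil(2), of X p'] z by simp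
  ultimately show ?thesis by (rule zigzag_eq.trans)
qed

definition zarr :: "'m set \<Rightarrow> 'o \<Rightarrow> 'm step list \<Rightarrow> 'o \<Rightarrow> 'o \<times> 'm step list set \<times> 'o" where
  "zarr W X p Y = (X, zigzag_class C W X Y p, Y)"

lemma zarr_eqI: "zigzag_eq C W X Y p r \<Longrightarrow> zarr W X p Y = zarr W X r Y"
  unfolding zarr_def zigzag_class_def by (auto intro: zigzag_eq.trans zigzag_eq.sym)

lemma localization_sel [simp]:
  "Obj (localization C W) = Obj C" "Ident (localization C W) X = zarr W X [] X"
  "Dom (localization C W) (zarr W X p Y) = X" "Cod (localization C W) (zarr W X p Y) = Y"
  by (simp_all add: localization_def zarr_def)

lemma localization_Hom: "zigzag C W X p Y \<Longrightarrow> zarr W X p Y \<in> Hom (localization C W) X Y"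
  using zigzag_objs[of W X p Y] by (auto simp: localization_def Hom_def zarr_def)

lemma localization_Hom_E:
  assumes "c \<in> Hom (localization C W) X Y"
  obtains p where "zigzag C W X p Y" "c = zarr W X p Y"
  using assms by (auto simp: localization_def Hom_def zarr_def)

lemma localization_comp:
  assumes p: "zigzag C W X p Y" and r: "zigzag C W Y r Z"
  shows "zarr W Y r Z \<cdot>\<^bsub>localization C W\<^esub> zarr W X p Y = zarr W X (p @ r) Z"
proof -
  have mem: "p \<in> zigzag_class C W X Y p" "r \<in> zigzag_class C W Y Z r"
    using p r by (auto simp: zigzag_class_def intro: zigzag_eq.refl)
  have "zigzag_class C W X Z (p' @ r') = zigzag_class C W X Z (p @ r)"
    if "p' \<in> zigzag_class C W X Y p" "r' \<in> zigzag_class C W Y Z r" for p' r'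
    using zarr_eqI[OF zigzag_eq.sym[OF zigzag_eq_append[of W X Y p p' Z r r']]] that
    by (simp add: zigzag_class_def zarr_def)
  from UN_UN_const[OF mem, of "\<lambda>p r. zigzag_class C W X Z (p @ r)", OF this]
  show ?thesis by (simp add: zarr_def localization_def)
qed

lemma category_localization: "category (localization C W)"
proof
  fix c assume "c \<in> Arr (localization C W)"
  then obtain X p Y where "c = zarr W X p Y" "X \<in> Obj C" "Y \<in> Obj C"
    by (auto simp: localization_def zarr_def)
  then show "Dom (localization C W) c \<in> Obj (localization C W)"
    "Cod (localization C W) c \<in> Obj (localization C W)" by auto
next
  fix X assume "X \<in> Obj (localization C W)"
  then show "Ident (localization C W) X \<in> Hom (localization C W) X X"
    using localization_Hom[of W X "[]" X] by simp
next
  fix X Y Z c d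
  assume "c \<in> Hom (localization C W) X Y" "d \<in> Hom (localization C W) Y Z"
  then obtain p r where "zigzag C W X p Y" "c = zarr W X p Y" "zigzag C W Y r Z" "d = zarr W Y r Z"
    by (blast elim: localization_Hom_E)
  then show "d \<cdot>\<^bsub>localization C W\<^esub> c \<in> Hom (localization C W) X Z"
    using localization_comp localization_Hom[of W X "p @ r" Z] by (auto simp: zigzag_append)
next
  fix X Y c assume "c \<in> Hom (localization C W) X Y"
  then obtain p where p: "zigzag C W X p Y" "c = zarr W X p Y" by (blast elim: localization_Hom_E)
  then show "c \<cdot>\<^bsub>localization C W\<^esub> Ident (localization C W) X = c"
    "Ident (localization C W) Y \<cdot>\<^bsub>localization C W\<^esub> c = c"
    using localization_comp[of W X "[]" X p Y] localization_comp[of W X p Y "[]" Y]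
      zigzag_objs[OF p(1)] by auto
next
  fix X Y Z V b c d
  assume "b \<in> Hom (localization C W) X Y" "c \<in> Hom (localization C W) Y Z"
    "d \<in> Hom (localization C W) Z V"
  then obtain p r s where p: "zigzag C W X p Y" "b = zarr W X p Y"
    and r: "zigzag C W Y r Z" "c = zarr W Y r Z" and s: "zigzag C W Z s V" "d = zarr W Z s V"
    by (blast elim: localization_Hom_E)
  have "zigzag C W X (p @ r) Z" "zigzag C W Y (r @ s) V"
    using p(1) r(1) s(1) unfolding zigzag_append by blast+
  then show "(d \<cdot>\<^bsub>localization C W\<^esub> c) \<cdot>\<^bsub>localization C W\<^esub> b =
      d \<cdot>\<^bsub>localization C W\<^esub> (c \<cdot>\<^bsub>localization C W\<^esub> b)"
    using p r s by (simp add: localization_comp)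
qed

lemma zigzag_eq_Fwd_comp:
  "f \<in> Hom C X Y \<Longrightarrow> g \<in> Hom C Y Z \<Longrightarrow> zarr W X [Fwd f, Fwd g] Z = zarr W X [Fwd (g \<cdot> f)] Z"
  by (rule zarr_eqI[OF zigzag_eq.comp])

lemma is_iso_localization:
  assumes w: "w \<in> W" "w \<in> Hom C X Y"
  shows "is_iso (localization C W) (zarr W X [Fwd w] Y)"
proof -
  interpret L: category "localization C W" by (rule category_localization)
  note z = zigzag_Fwd[OF w(2), of W] zigzag_Bwd[OF w]
  show ?thesis
    by (rule L.is_isoI[OF localization_Hom[OF z(1)] localization_Hom[OF z(2)]])
      (use localization_comp[OF z] localization_comp[OF z(2,1)]
        zarr_eqI[OF zigzag_eq.Fwd_Bwd[OF w]] zarr_eqI[OF zigzag_eq.Bwd_Fwd[OF w]] in auto)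
qed

end

section \<open>Extending a functor that inverts \<open>W\<close> to the localization\<close>

definition iso_inv :: "('o, 'm, 'x) cat_scheme \<Rightarrow> 'm \<Rightarrow> 'm" where
  "iso_inv C f = (SOME g. g \<in> Hom C (Cod C f) (Dom C f) \<and>
     g \<cdot>\<^bsub>C\<^esub> f = Ident C (Dom C f) \<and> f \<cdot>\<^bsub>C\<^esub> g = Ident C (Cod C f))"

lemma (in category) iso_inv:
  assumes "is_iso C f" "f \<in> Hom C X Y"
  shows "iso_inv C f \<in> Hom C Y X" "iso_inv C f \<cdot> f = Ident C X" "f \<cdot> iso_inv C f = Ident C Y"
proof -
  have "\<exists>g. g \<in> Hom C (Cod C f) (Dom C f) \<and>
     g \<cdot>\<^bsub>C\<^esub> f = Ident C (Dom C f) \<and> f \<cdot>\<^bsub>C\<^esub> g = Ident C (Cod C f)"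
    using assms(1) unfolding is_iso_def by blast
  from someI_ex[OF this, folded iso_inv_def] assms(2)
  show "iso_inv C f \<in> Hom C Y X" "iso_inv C f \<cdot> f = Ident C X" "f \<cdot> iso_inv C f = Ident C Y"
    by (auto simp: Hom_def)
qed

fun zeval :: "('o, 'm, 'x) cat_scheme \<Rightarrow> ('p, 'n, 'y) cat_scheme \<Rightarrow> ('o, 'm, 'p, 'n) cat_functor \<Rightarrow>
    'o \<Rightarrow> 'm step list \<Rightarrow> 'n" where
  "zeval C D F X [] = Ident D (on_obj F X)"
| "zeval C D F X (Fwd f # p) = zeval C D F (Cod C f) p \<cdot>\<^bsub>D\<^esub> on_arr F f"
| "zeval C D F X (Bwd w # p) = zeval C D F (Dom C w) p \<cdot>\<^bsub>D\<^esub> iso_inv D (on_arr F w)"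

text \<open>A class is evaluated at a chosen member; \<open>lift_zarr\<close> shows that every
  member gives this value.\<close>

definition localization_lift :: "('o, 'm, 'x) cat_scheme \<Rightarrow> ('p, 'n, 'y) cat_scheme \<Rightarrow>
    ('o, 'm, 'p, 'n) cat_functor \<Rightarrow> ('o, 'o \<times> 'm step list set \<times> 'o, 'p, 'n) cat_functor" where
  "localization_lift C D F =
     \<lparr>on_obj = on_obj F, on_arr = (\<lambda>(X, c, Y). zeval C D F X (SOME p. p \<in> c))\<rparr>"

locale inverting_functor = C: category C + D: category D
  for C :: "('o, 'm, 'x) cat_scheme" and D :: "('p, 'n, 'y) cat_scheme" +
  fixes W :: "'m set" and F :: "('o, 'm, 'p, 'n) cat_functor"
  assumes functorial: "is_functor C D F"
    and inverts: "\<lbrakk>w \<in> W; w \<in> Arr C\<rbrakk> \<Longrightarrow> is_iso D (on_arr F w)"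
begin

abbreviation "ev \<equiv> zeval C D F"

lemma inv_W:
  assumes "w \<in> W" "w \<in> Hom C X Y"
  shows "iso_inv D (on_arr F w) \<in> Hom D (on_obj F Y) (on_obj F X)"
    "iso_inv D (on_arr F w) \<cdot>\<^bsub>D\<^esub> on_arr F w = Ident D (on_obj F X)"
    "on_arr F w \<cdot>\<^bsub>D\<^esub> iso_inv D (on_arr F w) = Ident D (on_obj F Y)"
  using D.iso_inv[OF inverts C.functor_hom[OF functorial assms(2)]] assms C.Hom_D by auto

lemma zeval_Hom: "zigzag C W X p Y \<Longrightarrow> ev X p \<in> Hom D (on_obj F X) (on_obj F Y)"
proof (induction p arbitrary: X)
  case Nil
  then show ?case using D.Ident_in functor_obj[OF functorial] by auto
next
  case (Cons s p)
  show ?case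
  proof (cases s)
    case (Fwd f)
    then obtain Z where f: "f \<in> Hom C X Z" and p: "zigzag C W Z p Y" using Cons.prems by auto
    show ?thesis
      using D.Comp_in[OF C.functor_hom[OF functorial f] Cons.IH[OF p]] f Fwd by (simp add: Hom_def)
  next
    case (Bwd w)
    then obtain Z where f: "w \<in> W" "w \<in> Hom C Z X" and p: "zigzag C W Z p Y"
      using Cons.prems by auto
    show ?thesis
      using D.Comp_in[OF inv_W(1)[OF f] Cons.IH[OF p]] f Bwd by (simp add: Hom_def)
  qed
qed

lemma zeval_append:
  "zigzag C W X p Y \<Longrightarrow> zigzag C W Y r Z \<Longrightarrow> ev X (p @ r) = ev Y r \<cdot>\<^bsub>D\<^esub> ev X p"
proof (induction p arbitrary: X)
  case Nil
  then show ?case using D.Ident_right[OF zeval_Hom] by simp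
next
  case (Cons s p)
  note r = Cons.prems(2)
  show ?case
  proof (cases s)
    case (Fwd f)
    then obtain V where f: "f \<in> Hom C X V" and p: "zigzag C W V p Y" using Cons.prems by auto
    show ?thesis
      using D.Comp_assoc[OF C.functor_hom[OF functorial f] zeval_Hom[OF p] zeval_Hom[OF r]]
        Cons.IH[OF p r] C.Hom_D[OF f] Fwd by simp
  next
    case (Bwd w)
    then obtain V where f: "w \<in> W" "w \<in> Hom C V X" and p: "zigzag C W V p Y"
      using Cons.prems by auto
    show ?thesis
      using D.Comp_assoc[OF inv_W(1)[OF f] zeval_Hom[OF p] zeval_Hom[OF r]]
        Cons.IH[OF p r] C.Hom_D[OF f(2)] Bwd by simp
  qed
qed

lemma zeval_Fwd: "f \<in> Hom C X Y \<Longrightarrow> ev X [Fwd f] = on_arr F f"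
  using D.Ident_left[OF C.functor_hom[OF functorial]] C.Hom_D by simp

text \<open>The generating relations hold after evaluation: \<open>ident\<close> and
  \<open>comp\<close> by functoriality, the other two because a backward step evaluates to an
  inverse.\<close>

lemma zeval_cong: "zigzag_eq C W X Y p r \<Longrightarrow> ev X p = ev X r"
proof (induction rule: zigzag_eq.induct)
  case (cong X a X' Y' p q b Y)
  have z: "zigzag C W X' (p @ b) Y" "zigzag C W X' (q @ b) Y" "zigzag C W X' p Y'" "zigzag C W X' q Y'"
    using cong C.zigzag_eq_zigzag[OF cong(2)] unfolding C.zigzag_append by blast+
  show ?case
    using zeval_append[OF cong(1) z(1)] zeval_append[OF cong(1) z(2)]
      zeval_append[OF z(3) cong(3)] zeval_append[OF z(4) cong(3)] cong.IH by simp
next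
  case (ident X)
  then show ?case using zeval_Fwd[OF C.Ident_in] functor_ident[OF functorial] by simp
next
  case (comp f X Y g Z)
  have "ev X [Fwd f, Fwd g] = on_arr F g \<cdot>\<^bsub>D\<^esub> on_arr F f"
    using zeval_Fwd[OF comp(2)] C.Hom_D[OF comp(1)] by simp
  then show ?case
    using C.functor_comp[OF functorial comp] zeval_Fwd[OF C.Comp_in[OF comp]] by simp
next
  case (Fwd_Bwd w X Y)
  then show ?case using D.Ident_left[OF inv_W(1)[OF Fwd_Bwd]] inv_W[OF Fwd_Bwd] C.Hom_D[of w X Y]
    by simp
next
  case (Bwd_Fwd w X Y)
  then show ?case
    using D.Ident_left[OF C.functor_hom[OF functorial Bwd_Fwd(2)]] inv_W[OF Bwd_Fwd] C.Hom_D[of w X Y]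
    by simp
qed auto

lemma lift_zarr:
  assumes "zigzag C W X p Y"
  shows "on_arr (localization_lift C D F) (C.zarr W X p Y) = ev X p"
proof -
  have "p \<in> zigzag_class C W X Y p" using assms by (simp add: zigzag_class_def zigzag_eq.refl)
  then have "(SOME r. r \<in> zigzag_class C W X Y p) \<in> zigzag_class C W X Y p" by (rule someI)
  then have "ev X p = ev X (SOME r. r \<in> zigzag_class C W X Y p)"
    using zeval_cong[of X Y p "SOME r. r \<in> zigzag_class C W X Y p"]
    unfolding zigzag_class_def by simp
  then show ?thesis by (simp add: localization_lift_def C.zarr_def)
qed

lemma lift_obj [simp]: "on_obj (localization_lift C D F) = on_obj F"
  by (simp add: localization_lift_def)

lemma lift_functor: "is_functor (localization C W) D (localization_lift C D F)"
  unfolding is_functor_def C.localization_sel lift_obj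
proof (intro conjI ballI)
  fix X assume "X \<in> Obj C"
  then show "on_obj F X \<in> Obj D"
    "on_arr (localization_lift C D F) (C.zarr W X [] X) = Ident D (on_obj F X)"
    using functor_obj[OF functorial] lift_zarr[of X "[]" X] by auto
next
  fix X Y c assume "c \<in> Hom (localization C W) X Y"
  then show "on_arr (localization_lift C D F) c \<in> Hom D (on_obj F X) (on_obj F Y)"
    by (auto elim!: C.localization_Hom_E simp: lift_zarr zeval_Hom)
next
  fix X Y Z c d
  assume "c \<in> Hom (localization C W) X Y" "d \<in> Hom (localization C W) Y Z"
  then obtain p r where p: "zigzag C W X p Y" "c = C.zarr W X p Y"
    and r: "zigzag C W Y r Z" "d = C.zarr W Y r Z"
    by (blast elim: C.localization_Hom_E)
  have "zigzag C W X (p @ r) Z" using p r unfolding C.zigzag_append by blast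
  then show "on_arr (localization_lift C D F) (d \<cdot>\<^bsub>localization C W\<^esub> c) =
      on_arr (localization_lift C D F) d \<cdot>\<^bsub>D\<^esub> on_arr (localization_lift C D F) c"
    using p r by (simp add: C.localization_comp lift_zarr zeval_append)
qed

end

section \<open>Modules\<close>

text \<open>The locale \<open>category\<close> over the record type that also carries the addition.\<close>

locale module_base = category C
  for C :: "('o, 'm, 'x) precat_scheme" (structure)

lemma module_comm_group: "is_module C F \<Longrightarrow> X \<in> Obj C \<Longrightarrow> comm_group (Sect F X)"
  by (simp add: is_module_def)

lemma module_group: "is_module C F \<Longrightarrow> X \<in> Obj C \<Longrightarrow> group (Sect F X)"
  by (rule comm_group.axioms(2)[OF module_comm_group])

lemma (in module_base) module_act:
  assumes "is_module C F" "f \<in> Hom C X Y"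
  shows "Act F f \<in> hom (Sect F Y) (Sect F X)"
    "y \<in> carrier (Sect F Y) \<Longrightarrow> Act F f y \<in> carrier (Sect F X)"
proof -
  show "Act F f \<in> hom (Sect F Y) (Sect F X)"
    using assms Hom_objs[OF assms(2)] unfolding is_module_def by blast
  then show "y \<in> carrier (Sect F Y) \<Longrightarrow> Act F f y \<in> carrier (Sect F X)"
    by (rule hom_in_carrier)
qed

lemma natural_map_hom:
  "natural_map C F F' \<eta> \<Longrightarrow> X \<in> Obj C \<Longrightarrow> \<eta> X \<in> hom (Sect F X) (Sect F' X)"
  by (simp add: natural_map_def)

lemma natural_map_closed:
  "natural_map C F F' \<eta> \<Longrightarrow> X \<in> Obj C \<Longrightarrow> x \<in> carrier (Sect F X) \<Longrightarrow> \<eta> X x \<in> carrier (Sect F' X)"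
  by (rule hom_in_carrier[OF natural_map_hom])

lemma natural_map_mult:
  "natural_map C F F' \<eta> \<Longrightarrow> X \<in> Obj C \<Longrightarrow> x \<in> carrier (Sect F X) \<Longrightarrow> y \<in> carrier (Sect F X) \<Longrightarrow>
    \<eta> X (x \<otimes>\<^bsub>Sect F X\<^esub> y) = \<eta> X x \<otimes>\<^bsub>Sect F' X\<^esub> \<eta> X y"
  by (rule hom_mult[OF natural_map_hom])

lemma (in module_base) natural_map_act:
  "natural_map C F F' \<eta> \<Longrightarrow> f \<in> Hom C X Y \<Longrightarrow> y \<in> carrier (Sect F Y) \<Longrightarrow>
    \<eta> X (Act F f y) = Act F' f (\<eta> Y y)"
  using Hom_objs unfolding natural_map_def by blast

lemma natural_map_one:
  assumes "is_module C F" "is_module C F'" "natural_map C F F' \<eta>" "X \<in> Obj C"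
  shows "\<eta> X \<one>\<^bsub>Sect F X\<^esub> = \<one>\<^bsub>Sect F' X\<^esub>"
  by (rule hom_one[OF natural_map_hom[OF assms(3,4)] module_group[OF assms(1,4)]
    module_group[OF assms(2,4)]])

text \<open>The restrictions produce the normal form demanded by \<open>module_cat\<close>, so that
  components can be given by arbitrary total functions.\<close>

definition module_arr ::
  "('o, 'm, 'x) precat_scheme \<Rightarrow> ('o, 'm, 'g) cmodule \<Rightarrow> ('o \<Rightarrow> 'g \<Rightarrow> 'g) \<Rightarrow> ('o, 'm, 'g) cmodule \<Rightarrow>
    ('o, 'm, 'g) cmodule \<times> ('o \<Rightarrow> 'g \<Rightarrow> 'g) \<times> ('o, 'm, 'g) cmodule" where
  "module_arr C F \<eta> F' = (F, \<lambda>X \<in> Obj C. \<lambda>x \<in> carrier (Sect F X). \<eta> X x, F')"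

lemma module_arr_eq_iff:
  "module_arr C F \<eta> F' = module_arr C F \<theta> F' \<longleftrightarrow>
    (\<forall>X \<in> Obj C. \<forall>x \<in> carrier (Sect F X). \<eta> X x = \<theta> X x)"
proof
  assume "module_arr C F \<eta> F' = module_arr C F \<theta> F'"
  then have eq: "(\<lambda>X \<in> Obj C. \<lambda>x \<in> carrier (Sect F X). \<eta> X x) =
      (\<lambda>X \<in> Obj C. \<lambda>x \<in> carrier (Sect F X). \<theta> X x)"
    by (simp add: module_arr_def)
  show "\<forall>X \<in> Obj C. \<forall>x \<in> carrier (Sect F X). \<eta> X x = \<theta> X x"
  proof (intro ballI)
    fix X x assume "X \<in> Obj C" "x \<in> carrier (Sect F X)"
    then show "\<eta> X x = \<theta> X x" using fun_cong[OF fun_cong[OF eq, of X], of x] by simp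
  qed
next
  assume a: "\<forall>X \<in> Obj C. \<forall>x \<in> carrier (Sect F X). \<eta> X x = \<theta> X x"
  have "(\<lambda>X \<in> Obj C. \<lambda>x \<in> carrier (Sect F X). \<eta> X x) =
      (\<lambda>X \<in> Obj C. \<lambda>x \<in> carrier (Sect F X). \<theta> X x)"
    using a by (intro ext) (auto simp: restrict_def)
  then show "module_arr C F \<eta> F' = module_arr C F \<theta> F'" by (simp add: module_arr_def)
qed

lemma module_cat_sel [simp]:
  "Obj (module_cat T C) = {F. is_module C F}"
  "Ident (module_cat T C) F = module_arr C F (\<lambda>X x. x) F"
  "Dom (module_cat T C) (module_arr C F \<eta> F') = F"
  "Cod (module_cat T C) (module_arr C F \<eta> F') = F'"
  by (simp_all add: module_cat_def module_arr_def)

context module_base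
begin

text \<open>Naturality sees only values on carriers, which allows a family to be replaced by its
  normalised restriction.\<close>

lemma natural_map_cong:
  assumes F: "is_module C F"
    and "\<And>X x. X \<in> Obj C \<Longrightarrow> x \<in> carrier (Sect F X) \<Longrightarrow> \<eta> X x = \<theta> X x"
    and \<eta>: "natural_map C F F' \<eta>"
  shows "natural_map C F F' \<theta>"
  unfolding natural_map_def
proof (intro conjI ballI)
  fix X assume X: "X \<in> Obj C"
  interpret group "Sect F X" using F X by (rule module_group)
  show "\<theta> X \<in> hom (Sect F X) (Sect F' X)"
    by (rule homI) (use assms(2)[OF X, symmetric] natural_map_closed[OF \<eta> X]
      natural_map_mult[OF \<eta> X] in auto)
next
  fix X Y f y assume "X \<in> Obj C" "Y \<in> Obj C" "f \<in> Hom C X Y" "y \<in> carrier (Sect F Y)"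
  then show "\<theta> X (Act F f y) = Act F' f (\<theta> Y y)"
    using assms(2)[symmetric] natural_map_act[OF \<eta>] module_act(2)[OF F] by simp
qed

end

context module_base
begin

lemma module_arr_Hom:
  assumes F: "is_module C F" and F': "is_module C F'" and \<eta>: "natural_map C F F' \<eta>"
  shows "module_arr C F \<eta> F' \<in> Hom (module_cat T C) F F'"
proof -
  have "natural_map C F F' (\<lambda>X \<in> Obj C. \<lambda>x \<in> carrier (Sect F X). \<eta> X x)"
    by (rule natural_map_cong[OF F _ \<eta>]) simp
  then show ?thesis using F F' by (simp add: Hom_def module_cat_def module_arr_def)
qed

lemma module_Hom_E:
  assumes "c \<in> Hom (module_cat T C) F F'"
  obtains \<eta> where "is_module C F" "is_module C F'" "natural_map C F F' \<eta>" "c = module_arr C F \<eta> F'"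
proof -
  from assms obtain \<eta> where \<eta>: "is_module C F" "is_module C F'" "natural_map C F F' \<eta>" "c = (F, \<eta>, F')"
    "\<eta> \<in> extensional (Obj C)" "\<And>X. X \<in> Obj C \<Longrightarrow> \<eta> X \<in> extensional (carrier (Sect F X))"
    by (auto simp: Hom_def module_cat_def)
  have "\<eta> = (\<lambda>X \<in> Obj C. \<lambda>x \<in> carrier (Sect F X). \<eta> X x)"
    using \<eta>(5,6) by (intro ext) (auto simp: restrict_def extensional_def)
  then have "c = module_arr C F \<eta> F'" using \<eta>(4) by (simp add: module_arr_def)
  then show ?thesis using that \<eta> by blast
qed

lemma module_comp:
  assumes "natural_map C F F' \<eta>"
  shows "module_arr C F' \<theta> F'' \<cdot>\<^bsub>module_cat T C\<^esub> module_arr C F \<eta> F' =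
    module_arr C F (\<lambda>X x. \<theta> X (\<eta> X x)) F''"
proof -
  have "(\<lambda>X \<in> Obj C. \<lambda>x \<in> carrier (Sect F X). (\<lambda>X \<in> Obj C. \<lambda>x \<in> carrier (Sect F' X). \<theta> X x) X
      ((\<lambda>X \<in> Obj C. \<lambda>x \<in> carrier (Sect F X). \<eta> X x) X x)) =
    (\<lambda>X \<in> Obj C. \<lambda>x \<in> carrier (Sect F X). \<theta> X (\<eta> X x))"
    using natural_map_closed[OF assms] by (intro ext) (auto simp: restrict_def)
  then show ?thesis by (simp add: module_cat_def module_arr_def)
qed

lemma natural_map_comp:
  assumes F: "is_module C F" and \<eta>: "natural_map C F F' \<eta>" and \<theta>: "natural_map C F' F'' \<theta>"
  shows "natural_map C F F'' (\<lambda>X x. \<theta> X (\<eta> X x))"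
  unfolding natural_map_def
proof (intro conjI ballI)
  fix X assume X: "X \<in> Obj C"
  show "(\<lambda>x. \<theta> X (\<eta> X x)) \<in> hom (Sect F X) (Sect F'' X)"
    by (rule homI) (use natural_map_closed[OF \<eta> X] natural_map_closed[OF \<theta> X]
      natural_map_mult[OF \<eta> X] natural_map_mult[OF \<theta> X] in auto)
next
  fix X Y f y assume "X \<in> Obj C" "Y \<in> Obj C" "f \<in> Hom C X Y" "y \<in> carrier (Sect F Y)"
  then show "\<theta> X (\<eta> X (Act F f y)) = Act F'' f (\<theta> Y (\<eta> Y y))"
    using natural_map_act[OF \<eta>] natural_map_act[OF \<theta>] natural_map_closed[OF \<eta>] by simp
qed

lemma natural_map_ident: "natural_map C F F (\<lambda>X x. x)"
  by (auto simp: natural_map_def hom_def)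

lemma category_module_cat: "category (module_cat T C)"
proof
  fix c assume "c \<in> Arr (module_cat T C)"
  then have "c \<in> Hom (module_cat T C) (Dom (module_cat T C) c) (Cod (module_cat T C) c)"
    by (simp add: Hom_def)
  then show "Dom (module_cat T C) c \<in> Obj (module_cat T C)"
    "Cod (module_cat T C) c \<in> Obj (module_cat T C)"
    by (auto elim: module_Hom_E)
next
  fix F assume "F \<in> Obj (module_cat T C)"
  then show "Ident (module_cat T C) F \<in> Hom (module_cat T C) F F"
    using module_arr_Hom[OF _ _ natural_map_ident] by simp
next
  fix F F' F'' c d assume c: "c \<in> Hom (module_cat T C) F F'" and d: "d \<in> Hom (module_cat T C) F' F''"
  obtain \<eta> where \<eta>: "is_module C F" "is_module C F'" "natural_map C F F' \<eta>" "c = module_arr C F \<eta> F'"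
    using c by (rule module_Hom_E)
  obtain \<theta> where \<theta>: "is_module C F''" "natural_map C F' F'' \<theta>" "d = module_arr C F' \<theta> F''"
    using d by (rule module_Hom_E)
  show "d \<cdot>\<^bsub>module_cat T C\<^esub> c \<in> Hom (module_cat T C) F F''"
    unfolding \<eta>(4) \<theta>(3) module_comp[OF \<eta>(3)]
    by (rule module_arr_Hom[OF \<eta>(1) \<theta>(1) natural_map_comp[OF \<eta>(1,3) \<theta>(2)]])
next
  fix F F' c assume c: "c \<in> Hom (module_cat T C) F F'"
  obtain \<eta> where \<eta>: "is_module C F" "is_module C F'" "natural_map C F F' \<eta>" "c = module_arr C F \<eta> F'"
    using c by (rule module_Hom_E)
  show "c \<cdot>\<^bsub>module_cat T C\<^esub> Ident (module_cat T C) F = c"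
    "Ident (module_cat T C) F' \<cdot>\<^bsub>module_cat T C\<^esub> c = c"
    unfolding \<eta>(4) module_cat_sel module_comp[OF \<eta>(3)] module_comp[OF natural_map_ident] by auto
next
  fix F F' F'' F3 b c d
  assume b: "b \<in> Hom (module_cat T C) F F'" and c: "c \<in> Hom (module_cat T C) F' F''"
    and d: "d \<in> Hom (module_cat T C) F'' F3"
  obtain \<eta> where \<eta>: "is_module C F" "natural_map C F F' \<eta>" "b = module_arr C F \<eta> F'"
    using b by (rule module_Hom_E)
  obtain \<theta> where \<theta>: "is_module C F'" "natural_map C F' F'' \<theta>" "c = module_arr C F' \<theta> F''"
    using c by (rule module_Hom_E)
  obtain \<kappa> where \<kappa>: "natural_map C F'' F3 \<kappa>" "d = module_arr C F'' \<kappa> F3"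
    using d by (rule module_Hom_E)
  show "(d \<cdot>\<^bsub>module_cat T C\<^esub> c) \<cdot>\<^bsub>module_cat T C\<^esub> b = d \<cdot>\<^bsub>module_cat T C\<^esub> (c \<cdot>\<^bsub>module_cat T C\<^esub> b)"
    unfolding \<eta>(3) \<theta>(3) \<kappa>(2) module_comp[OF \<eta>(2)] module_comp[OF \<theta>(2)]
      module_comp[OF natural_map_comp[OF \<eta>(1,2) \<theta>(2)]] ..
qed

text \<open>The pointwise inverse of a bijective natural homomorphism is multiplicative and natural,
  since both can be tested after applying \<open>\<eta>\<close>.\<close>

lemma module_iso_iff:
  assumes F: "is_module C F" and F': "is_module C F'" and \<eta>: "natural_map C F F' \<eta>"
  shows "is_iso (module_cat T C) (module_arr C F \<eta> F') \<longleftrightarrow>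
    (\<forall>X \<in> Obj C. bij_betw (\<eta> X) (carrier (Sect F X)) (carrier (Sect F' X)))"
proof
  interpret Mod: category "module_cat T C" by (rule category_module_cat)
  note a = module_arr_Hom[OF assms, of T]
  show "\<forall>X \<in> Obj C. bij_betw (\<eta> X) (carrier (Sect F X)) (carrier (Sect F' X))"
    if iso: "is_iso (module_cat T C) (module_arr C F \<eta> F')"
  proof
    fix X assume X: "X \<in> Obj C"
    obtain c where c: "c \<in> Hom (module_cat T C) F' F"
      "c \<cdot>\<^bsub>module_cat T C\<^esub> module_arr C F \<eta> F' = Ident (module_cat T C) F"
      "module_arr C F \<eta> F' \<cdot>\<^bsub>module_cat T C\<^esub> c = Ident (module_cat T C) F'"
      using Mod.iso_inverse[OF iso a] by blast
    obtain \<theta> where \<theta>: "natural_map C F' F \<theta>" "c = module_arr C F' \<theta> F"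
      using c(1) by (rule module_Hom_E)
    have "\<theta> X (\<eta> X x) = x" if "x \<in> carrier (Sect F X)" for x
      using c(2) that X unfolding \<theta>(2) module_comp[OF \<eta>] module_cat_sel module_arr_eq_iff by blast
    moreover have "\<eta> X (\<theta> X x) = x" if "x \<in> carrier (Sect F' X)" for x
      using c(3) that X unfolding \<theta>(2) module_comp[OF \<theta>(1)] module_cat_sel module_arr_eq_iff by blast
    ultimately show "bij_betw (\<eta> X) (carrier (Sect F X)) (carrier (Sect F' X))"
      using natural_map_closed[OF \<eta> X] natural_map_closed[OF \<theta>(1) X]
      by (intro bij_betw_byWitness[where f' = "\<theta> X"]) auto
  qed
  show "is_iso (module_cat T C) (module_arr C F \<eta> F')"
    if bij: "\<forall>X \<in> Obj C. bij_betw (\<eta> X) (carrier (Sect F X)) (carrier (Sect F' X))"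
  proof -
    define \<theta> where "\<theta> X = inv_into (carrier (Sect F X)) (\<eta> X)" for X
    have \<theta>\<eta>: "\<theta> X (\<eta> X x) = x" if "X \<in> Obj C" "x \<in> carrier (Sect F X)" for X x
      using bij that unfolding \<theta>_def by (auto simp: bij_betw_def)
    have \<eta>\<theta>: "\<eta> X (\<theta> X x) = x" "\<theta> X x \<in> carrier (Sect F X)"
      if "X \<in> Obj C" "x \<in> carrier (Sect F' X)" for X x
      using bij that unfolding \<theta>_def by (auto simp: bij_betw_def f_inv_into_f inv_into_into)
    have \<theta>: "natural_map C F' F \<theta>"
      unfolding natural_map_def
    proof (intro conjI ballI)
      fix X assume X: "X \<in> Obj C"
      interpret group "Sect F X" using F X by (rule module_group)
      show "\<theta> X \<in> hom (Sect F' X) (Sect F X)"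
      proof (rule homI)
        fix x y assume xy: "x \<in> carrier (Sect F' X)" "y \<in> carrier (Sect F' X)"
        then have "\<eta> X (\<theta> X x \<otimes>\<^bsub>Sect F X\<^esub> \<theta> X y) = x \<otimes>\<^bsub>Sect F' X\<^esub> y"
          using natural_map_mult[OF \<eta> X] \<eta>\<theta>[OF X] by simp
        then show "\<theta> X (x \<otimes>\<^bsub>Sect F' X\<^esub> y) = \<theta> X x \<otimes>\<^bsub>Sect F X\<^esub> \<theta> X y"
          using \<theta>\<eta>[OF X m_closed[OF \<eta>\<theta>(2)[OF X xy(1)] \<eta>\<theta>(2)[OF X xy(2)]]] by simp
      qed (rule \<eta>\<theta>(2)[OF X])
    next
      fix X Y f y assume X: "X \<in> Obj C" "Y \<in> Obj C" and f: "f \<in> Hom C X Y"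
        and y: "y \<in> carrier (Sect F' Y)"
      have "\<eta> X (Act F f (\<theta> Y y)) = Act F' f y"
        using natural_map_act[OF \<eta> f \<eta>\<theta>(2)] X y \<eta>\<theta>(1) by simp
      then show "\<theta> X (Act F' f y) = Act F f (\<theta> Y y)"
        using \<theta>\<eta>[OF X(1) module_act(2)[OF F f \<eta>\<theta>(2)[OF X(2) y]]] by simp
    qed
    show ?thesis
    proof (rule Mod.is_isoI[OF a module_arr_Hom[OF F' F \<theta>]])
      show "module_arr C F' \<theta> F \<cdot>\<^bsub>module_cat T C\<^esub> module_arr C F \<eta> F' = Ident (module_cat T C) F"
        unfolding module_comp[OF \<eta>] module_cat_sel module_arr_eq_iff using \<theta>\<eta> by blast
      show "module_arr C F \<eta> F' \<cdot>\<^bsub>module_cat T C\<^esub> module_arr C F' \<theta> F = Ident (module_cat T C) F'"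
        unfolding module_comp[OF \<theta>] module_cat_sel module_arr_eq_iff using \<eta>\<theta> by blast
    qed
  qed
qed

lemma natural_map_eq_iff:
  assumes P: "is_module C P" and F: "is_module C F" and u: "natural_map C P F u" and X: "X \<in> Obj C"
    and x: "x \<in> carrier (Sect P X)" "y \<in> carrier (Sect P X)"
  shows "u X x = u X y \<longleftrightarrow> u X (x \<otimes>\<^bsub>Sect P X\<^esub> inv\<^bsub>Sect P X\<^esub> y) = \<one>\<^bsub>Sect F X\<^esub>"
proof -
  interpret P: group "Sect P X" using P X by (rule module_group)
  interpret F: group "Sect F X" using F X by (rule module_group)
  interpret group_hom "Sect P X" "Sect F X" "u X"
    using natural_map_hom[OF u X] by unfold_locales
  have "u X (x \<otimes>\<^bsub>Sect P X\<^esub> inv\<^bsub>Sect P X\<^esub> y) = u X x \<otimes>\<^bsub>Sect F X\<^esub> inv\<^bsub>Sect F X\<^esub> u X y"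
    using x by simp
  then show ?thesis using x F.inv_equality F.r_inv F.inv_comm
    by (metis F.inv_inv hom_closed F.inv_closed)
qed

text \<open>First isomorphism theorem: both modules are the quotient of \<open>P\<close> by one and
  the same kernel, so \<open>v\<close> descends along \<open>u\<close> to a bijection.\<close>

lemma quotients_iso:
  assumes P: "is_module C P" and F: "is_module C F" and F': "is_module C F'"
    and u: "natural_map C P F u" and v: "natural_map C P F' v"
    and u_surj: "\<And>X. X \<in> Obj C \<Longrightarrow> u X ` carrier (Sect P X) = carrier (Sect F X)"
    and v_surj: "\<And>X. X \<in> Obj C \<Longrightarrow> v X ` carrier (Sect P X) = carrier (Sect F' X)"
    and kernels: "\<And>X x. \<lbrakk>X \<in> Obj C; x \<in> carrier (Sect P X)\<rbrakk>
      \<Longrightarrow> u X x = \<one>\<^bsub>Sect F X\<^esub> \<longleftrightarrow> v X x = \<one>\<^bsub>Sect F' X\<^esub>"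
  shows "\<exists>c \<in> Hom (module_cat T C) F F'. is_iso (module_cat T C) c"
proof -
  have eq_iff: "u X x = u X y \<longleftrightarrow> v X x = v X y"
    if X: "X \<in> Obj C" and x: "x \<in> carrier (Sect P X)" "y \<in> carrier (Sect P X)" for X x y
  proof -
    interpret P: group "Sect P X" using P X by (rule module_group)
    show ?thesis
      unfolding natural_map_eq_iff[OF P F u that] natural_map_eq_iff[OF P F' v that]
      by (rule kernels[OF X]) (use x in simp)
  qed
  \<comment> \<open>The chosen preimage under \<open>u\<close> is immaterial, because
    \<open>u\<close> and \<open>v\<close> identify the same sections of \<open>P\<close> by
    \<open>eq_iff\<close>.\<close>
  define \<eta> where "\<eta> X y = v X (SOME x. x \<in> carrier (Sect P X) \<and> u X x = y)" for X y
  have \<eta>u: "\<eta> X (u X x) = v X x" if X: "X \<in> Obj C" and x: "x \<in> carrier (Sect P X)" for X x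
  proof -
    have "\<exists>x'. x' \<in> carrier (Sect P X) \<and> u X x' = u X x" using x by blast
    from someI_ex[OF this] show ?thesis using eq_iff[OF X _ x] unfolding \<eta>_def by blast
  qed
  have ex: "\<exists>x \<in> carrier (Sect P X). y = u X x" if "X \<in> Obj C" "y \<in> carrier (Sect F X)" for X y
    using u_surj that by blast
  have \<eta>: "natural_map C F F' \<eta>"
    unfolding natural_map_def
  proof (intro conjI ballI)
    fix X assume X: "X \<in> Obj C"
    interpret P: group "Sect P X" using P X by (rule module_group)
    show "\<eta> X \<in> hom (Sect F X) (Sect F' X)"
    proof (rule homI)
      fix y assume "y \<in> carrier (Sect F X)"
      then obtain x where x: "x \<in> carrier (Sect P X)" "y = u X x" using ex X by blast
      show "\<eta> X y \<in> carrier (Sect F' X)"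
        unfolding x(2) \<eta>u[OF X x(1)] by (rule natural_map_closed[OF v X x(1)])
      fix y' assume "y' \<in> carrier (Sect F X)"
      then obtain x' where x': "x' \<in> carrier (Sect P X)" "y' = u X x'" using ex X by blast
      show "\<eta> X (y \<otimes>\<^bsub>Sect F X\<^esub> y') = \<eta> X y \<otimes>\<^bsub>Sect F' X\<^esub> \<eta> X y'"
        unfolding x(2) x'(2) natural_map_mult[OF u X x(1) x'(1), symmetric] \<eta>u[OF X x(1)]
          \<eta>u[OF X x'(1)] \<eta>u[OF X P.m_closed[OF x(1) x'(1)]] natural_map_mult[OF v X x(1) x'(1)] ..
    qed
  next
    fix X Y f y assume X: "X \<in> Obj C" "Y \<in> Obj C" and f: "f \<in> Hom C X Y"
      and y: "y \<in> carrier (Sect F Y)"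
    then obtain x where x: "x \<in> carrier (Sect P Y)" "y = u Y x" using ex by blast
    show "\<eta> X (Act F f y) = Act F' f (\<eta> Y y)"
      unfolding x(2) natural_map_act[OF u f x(1), symmetric] \<eta>u[OF X(1) module_act(2)[OF P f x(1)]]
        \<eta>u[OF X(2) x(1)] natural_map_act[OF v f x(1)] ..
  qed
  have "bij_betw (\<eta> X) (carrier (Sect F X)) (carrier (Sect F' X))" if X: "X \<in> Obj C" for X
    unfolding bij_betw_def
  proof
    show "inj_on (\<eta> X) (carrier (Sect F X))"
    proof (rule inj_onI)
      fix y y' assume y: "y \<in> carrier (Sect F X)" "y' \<in> carrier (Sect F X)" and eq: "\<eta> X y = \<eta> X y'"
      obtain x where x: "x \<in> carrier (Sect P X)" "y = u X x" using ex X y by blast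
      obtain x' where x': "x' \<in> carrier (Sect P X)" "y' = u X x'" using ex X y by blast
      show "y = y'" using eq unfolding x(2) x'(2) \<eta>u[OF X x(1)] \<eta>u[OF X x'(1)] eq_iff[OF X x(1) x'(1)] .
    qed
    have "\<eta> X ` u X ` carrier (Sect P X) = v X ` carrier (Sect P X)"
      unfolding image_image by (rule image_cong) (auto simp: \<eta>u[OF X])
    then show "\<eta> X ` carrier (Sect F X) = carrier (Sect F' X)"
      unfolding u_surj[OF X] v_surj[OF X] .
  qed
  then show ?thesis using module_iso_iff[OF F F' \<eta>] module_arr_Hom[OF F F' \<eta>] by blast
qed

end

subsection \<open>Representable modules over a full subcategory\<close>

text \<open>The groups \<open>C(N, X)\<close> are carried over to another type along an injection \<open>e\<close> with left
  inverse \<open>d\<close>; taking both to be the identity gives back \<open>representable C X\<close>.\<close>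

definition rep :: "('o, 'm, 'x) precat_scheme \<Rightarrow> ('m \<Rightarrow> 'g) \<Rightarrow> ('g \<Rightarrow> 'm) \<Rightarrow> 'o \<Rightarrow> ('o, 'm, 'g) cmodule"
  where
  "rep C e d X = \<lparr>
     Sect = (\<lambda>N. \<lparr>carrier = e ` Hom C N X, monoid.mult = (\<lambda>x y. e (d x \<boxplus>\<^bsub>C\<^esub> d y)), one = e (Zero C N X)\<rparr>),
     Act = (\<lambda>f x. e (d x \<cdot>\<^bsub>C\<^esub> f))\<rparr>"

lemma rep_id: "rep C id id X = representable C X"
  by (simp add: rep_def representable_def homgrp_def)

lemma rep_sel [simp]:
  "carrier (Sect (rep C e d X) N) = e ` Hom C N X"
  "monoid.mult (Sect (rep C e d X) N) x y = e (d x \<boxplus>\<^bsub>C\<^esub> d y)"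
  "one (Sect (rep C e d X) N) = e (Zero C N X)"
  "Act (rep C e d X) f x = e (d x \<cdot>\<^bsub>C\<^esub> f)"
  by (simp_all add: rep_def)

text \<open>Decoding is required on arrows only. Later the arrows are cosets, which embed into 'g
  through representatives, whereas arbitrary sets of morphisms need not.\<close>

locale encoded = preadditive_category C
  for C :: "('o, 'm, 'x) precat_scheme" (structure) +
  fixes S :: "'o set" and e :: "'m \<Rightarrow> 'g" and d :: "'g \<Rightarrow> 'm"
  assumes decode: "c \<in> Arr C \<Longrightarrow> d (e c) = c"
begin

abbreviation "R \<equiv> rep C e d"
abbreviation "CS \<equiv> full_sub C S"

lemma decode_Hom: "c \<in> Hom C X Y \<Longrightarrow> d (e c) = c"
  by (simp add: Hom_def decode)

lemma encode_eq: "c \<in> Hom C X Y \<Longrightarrow> c' \<in> Hom C X' Y' \<Longrightarrow> e c = e c' \<longleftrightarrow> c = c'"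
  using decode_Hom by metis

sublocale CS: module_base CS
  by (simp add: module_base_def category_full_sub)

lemma CS_Hom: "f \<in> Hom CS X Y \<longleftrightarrow> X \<in> S \<and> Y \<in> S \<and> f \<in> Hom C X Y"
  by (auto simp: Hom_full_sub)

lemma rep_module:
  assumes X: "X \<in> Obj C" shows "is_module CS (R X)"
  unfolding is_module_def
proof (intro conjI ballI)
  fix N assume "N \<in> Obj CS"
  then have N: "N \<in> Obj C" by simp
  show "comm_group (Sect (R X) N)"
  proof (rule comm_groupI)
    fix x assume "x \<in> carrier (Sect (R X) N)"
    then obtain f where f: "f \<in> Hom C N X" "x = e f" by auto
    show "\<one>\<^bsub>Sect (R X) N\<^esub> \<otimes>\<^bsub>Sect (R X) N\<^esub> x = x"
      using f X N by (simp add: decode decode_Hom Hom_D)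
    have "e (neg f) \<otimes>\<^bsub>Sect (R X) N\<^esub> x = \<one>\<^bsub>Sect (R X) N\<^esub>"
      using f by (simp add: decode Hom_D decode_Hom)
    then show "\<exists>y \<in> carrier (Sect (R X) N). y \<otimes>\<^bsub>Sect (R X) N\<^esub> x = \<one>\<^bsub>Sect (R X) N\<^esub>"
      using neg_Hom[OF f(1)] by auto
    fix y assume "y \<in> carrier (Sect (R X) N)"
    then obtain g where g: "g \<in> Hom C N X" "y = e g" by auto
    show "x \<otimes>\<^bsub>Sect (R X) N\<^esub> y \<in> carrier (Sect (R X) N)"
      using f g add_Hom by (simp add: decode_Hom)
    show "x \<otimes>\<^bsub>Sect (R X) N\<^esub> y = y \<otimes>\<^bsub>Sect (R X) N\<^esub> x"
      using f g by (simp add: decode_Hom) (simp add: Hom_D add_commute)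
    fix z assume "z \<in> carrier (Sect (R X) N)"
    then obtain h where h: "h \<in> Hom C N X" "z = e h" by auto
    show "x \<otimes>\<^bsub>Sect (R X) N\<^esub> y \<otimes>\<^bsub>Sect (R X) N\<^esub> z = x \<otimes>\<^bsub>Sect (R X) N\<^esub> (y \<otimes>\<^bsub>Sect (R X) N\<^esub> z)"
      using f g h by (simp add: decode_Hom add_Hom decode Hom_D) (simp add: Hom_D add_assoc)
  qed (use zero_Hom[OF N X] in auto)
next
  fix N N' f assume "f \<in> Hom CS N N'"
  then have f: "f \<in> Hom C N N'" by (simp add: CS_Hom)
  show "Act (R X) f \<in> hom (Sect (R X) N') (Sect (R X) N)"
  proof (rule homI)
    fix x assume "x \<in> carrier (Sect (R X) N')"
    then obtain g where g: "g \<in> Hom C N' X" "x = e g" by auto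
    show "Act (R X) f x \<in> carrier (Sect (R X) N)"
      using g Comp_in[OF f g(1)] by (simp add: decode_Hom)
    fix y assume "y \<in> carrier (Sect (R X) N')"
    then obtain h where h: "h \<in> Hom C N' X" "y = e h" by auto
    show "Act (R X) f (x \<otimes>\<^bsub>Sect (R X) N'\<^esub> y) = Act (R X) f x \<otimes>\<^bsub>Sect (R X) N\<^esub> Act (R X) f y"
      using f g h by (simp add: decode_Hom add_Hom Comp_in) (simp add: Hom_D decode)
  qed
next
  fix N x assume "N \<in> Obj CS" "x \<in> carrier (Sect (R X) N)"
  then show "Act (R X) (Ident CS N) x = x"
    by (auto simp: decode_Hom) (simp add: Hom_D)
next
  fix N N' N'' f g x
  assume a: "f \<in> Hom CS N N'" "g \<in> Hom CS N' N''" "x \<in> carrier (Sect (R X) N'')"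
  then obtain h where h: "h \<in> Hom C N'' X" "x = e h" by auto
  have f: "f \<in> Hom C N N'" and g: "g \<in> Hom C N' N''" using a by (auto simp: CS_Hom)
  show "Act (R X) (g \<cdot>\<^bsub>CS\<^esub> f) x = Act (R X) f (Act (R X) g x)"
    using decode_Hom[OF h(1)] decode_Hom[OF Comp_in[OF g h(1)]] h(2) Comp_assoc[OF f g h(1)] by simp
next
  fix N N' f g x
  assume a: "f \<in> Hom CS N N'" "g \<in> Hom CS N N'" "x \<in> carrier (Sect (R X) N')"
  then obtain h where h: "h \<in> Hom C N' X" "x = e h" by auto
  have f: "f \<in> Hom C N N'" and g: "g \<in> Hom C N N'" using a by (auto simp: CS_Hom)
  show "Act (R X) (f \<boxplus>\<^bsub>CS\<^esub> g) x = Act (R X) f x \<otimes>\<^bsub>Sect (R X) N\<^esub> Act (R X) g x"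
    using decode_Hom[OF h(1)] decode_Hom[OF Comp_in[OF g h(1)]] decode_Hom[OF Comp_in[OF f h(1)]]
      h(2) Comp_Add_right[OF f g h(1)] by simp
qed

text \<open>Source and target may use different encodings: a presentation maps from representables,
  encoded by the identity, to a module carried by 'g.\<close>

lemma rep_natural:
  assumes enc: "encoded C e' d'" and f: "f \<in> Hom C X Y"
  shows "natural_map CS (rep C e' d' X) (R Y) (\<lambda>N x. e (f \<cdot> d' x))"
  unfolding natural_map_def
proof (intro conjI ballI)
  interpret E': encoded C S e' d' by (rule enc)
  fix N assume N: "N \<in> Obj CS"
  show "(\<lambda>x. e (f \<cdot> d' x)) \<in> hom (Sect (rep C e' d' X) N) (Sect (R Y) N)"
  proof (rule homI)
    fix x assume "x \<in> carrier (Sect (rep C e' d' X) N)"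
    then obtain g where g: "g \<in> Hom C N X" "x = e' g" by auto
    show "e (f \<cdot> d' x) \<in> carrier (Sect (R Y) N)"
      using g Comp_in[OF g(1) f] by (simp add: E'.decode_Hom)
    fix y assume "y \<in> carrier (Sect (rep C e' d' X) N)"
    then obtain h where h: "h \<in> Hom C N X" "y = e' h" by auto
    show "e (f \<cdot> d' (x \<otimes>\<^bsub>Sect (rep C e' d' X) N\<^esub> y)) = e (f \<cdot> d' x) \<otimes>\<^bsub>Sect (R Y) N\<^esub> e (f \<cdot> d' y)"
      using f g h by (simp add: E'.decode_Hom add_Hom Comp_in) (simp add: Hom_D decode E'.decode)
  qed
next
  interpret E': encoded C S e' d' by (rule enc)
  fix N N' g x assume a: "g \<in> Hom CS N N'" "x \<in> carrier (Sect (rep C e' d' X) N')"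
  then obtain h where h: "h \<in> Hom C N' X" "x = e' h" by auto
  have g: "g \<in> Hom C N N'" using a by (simp add: CS_Hom)
  show "e (f \<cdot> d' (Act (rep C e' d' X) g x)) = Act (R Y) g (e (f \<cdot> d' x))"
    using E'.decode_Hom[OF h(1)] E'.decode_Hom[OF Comp_in[OF g h(1)]] decode_Hom[OF Comp_in[OF h(1) f]]
      h(2) Comp_assoc[OF g h(1) f] by simp
qed

definition rmap :: "'m \<Rightarrow> ('o, 'm, 'g) cmodule \<times> ('o \<Rightarrow> 'g \<Rightarrow> 'g) \<times> ('o, 'm, 'g) cmodule" where
  "rmap f = module_arr CS (R (Dom C f)) (\<lambda>N x. e (f \<cdot> d x)) (R (Cod C f))"

lemma rmap_eq: "f \<in> Hom C X Y \<Longrightarrow> rmap f = module_arr CS (R X) (\<lambda>N x. e (f \<cdot> d x)) (R Y)"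
  by (simp add: rmap_def Hom_D)

lemma rmap_Hom:
  assumes f: "f \<in> Hom C X Y" shows "rmap f \<in> Hom (module_cat T CS) (R X) (R Y)"
  unfolding rmap_eq[OF f] using Hom_objs[OF f]
  by (intro CS.module_arr_Hom rep_module rep_natural[OF encoded_axioms f]) auto

lemma rmap_comp:
  assumes f: "f \<in> Hom C X Y" and g: "g \<in> Hom C Y Z"
  shows "rmap (g \<cdot> f) = rmap g \<cdot>\<^bsub>module_cat T CS\<^esub> rmap f"
  unfolding rmap_eq[OF f] rmap_eq[OF g] rmap_eq[OF Comp_in[OF f g]] CS.module_comp[OF rep_natural[OF encoded_axioms f]]
    module_arr_eq_iff
proof (intro ballI)
  fix N x assume "x \<in> carrier (Sect (R X) N)"
  then obtain h where h: "h \<in> Hom C N X" "x = e h" by auto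
  show "e ((g \<cdot> f) \<cdot> d x) = e (g \<cdot> d (e (f \<cdot> d x)))"
    using decode_Hom[OF h(1)] decode_Hom[OF Comp_in[OF h(1) f]] h(2) Comp_assoc[OF h(1) f g] by simp
qed

lemma rmap_ident:
  assumes X: "X \<in> Obj C" shows "rmap (Ident C X) = Ident (module_cat T CS) (R X)"
  unfolding rmap_eq[OF Ident_in[OF X]] module_cat_sel module_arr_eq_iff
proof (intro ballI)
  fix N x assume "x \<in> carrier (Sect (R X) N)"
  then obtain h where h: "h \<in> Hom C N X" "x = e h" by auto
  show "e (Ident C X \<cdot> d x) = x" using h decode_Hom[OF h(1)] Ident_left[OF h(1)] by simp
qed

text \<open>Conjugation by the encoding does not affect bijectivity, so the criterion is the same
  for every encoding.\<close>

lemma rmap_iso_iff: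
  assumes f: "f \<in> Hom C X Y" and S: "S \<subseteq> Obj C"
  shows "is_iso (module_cat T CS) (rmap f) \<longleftrightarrow>
    (\<forall>N \<in> S. bij_betw (\<lambda>h. f \<cdot> h) (Hom C N X) (Hom C N Y))"
proof -
  note o = Hom_objs[OF f]
  have inj: "inj_on e (Hom C N X)" for N X
    by (rule inj_on_inverseI[of _ d]) (rule decode_Hom)
  have "bij_betw (\<lambda>x. e (f \<cdot> d x)) (e ` Hom C N X) (e ` Hom C N Y) \<longleftrightarrow>
      bij_betw (\<lambda>h. f \<cdot> h) (Hom C N X) (Hom C N Y)" for N
  proof -
    have 1: "bij_betw e (Hom C N X) (e ` Hom C N X)" and 2: "bij_betw e (Hom C N Y) (e ` Hom C N Y)"
      using inj by (auto simp: bij_betw_def)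
    have "bij_betw (\<lambda>x. e (f \<cdot> d x)) (e ` Hom C N X) (e ` Hom C N Y) \<longleftrightarrow>
        bij_betw ((\<lambda>x. e (f \<cdot> d x)) \<circ> e) (Hom C N X) (e ` Hom C N Y)"
      by (rule bij_betw_comp_iff[OF 1])
    also have "\<dots> \<longleftrightarrow> bij_betw (e \<circ> (\<lambda>h. f \<cdot> h)) (Hom C N X) (e ` Hom C N Y)"
      by (rule bij_betw_cong) (simp add: decode_Hom)
    also have "\<dots> \<longleftrightarrow> bij_betw (\<lambda>h. f \<cdot> h) (Hom C N X) (Hom C N Y)"
      by (rule bij_betw_comp_iff2[OF 2, symmetric]) (use Comp_in[OF _ f] in auto)
    finally show ?thesis .
  qed
  then show ?thesis
    unfolding rmap_eq[OF f] using CS.module_iso_iff[OF rep_module rep_module rep_natural[OF encoded_axioms f]] o S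
    by (auto simp: Int_absorb1)
qed

end

section \<open>Exact categories\<close>

context exact_category
begin

section \<open>Universal properties of conflations\<close>

lemma conflation_arrs:
  assumes "(i, p) \<in> conflations C"
  shows "i \<in> Arr C" "p \<in> Arr C" "Dom C p = Cod C i" "p \<cdot> i = Zero C (Dom C i) (Cod C p)"
  using conflation_kernel_cokernel[OF assms] by (auto simp: is_kernel_def)

lemma kernel_lift:
  assumes "(i, p) \<in> conflations C" "t \<in> Hom C T (Cod C i)" "p \<cdot> t = Zero C T (Cod C p)"
  shows "\<exists>u \<in> Hom C T (Dom C i). i \<cdot> u = t"
  using conflation_kernel_cokernel[OF assms(1)] assms(2,3) Hom_objs[OF assms(2)]
  unfolding is_kernel_def by metis

lemma kernel_mono:
  assumes c: "(i, p) \<in> conflations C" and u: "u \<in> Hom C T (Dom C i)" and v: "v \<in> Hom C T (Dom C i)"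
    and eq: "i \<cdot> u = i \<cdot> v"
  shows "u = v"
proof -
  note a = conflation_arrs[OF c]
  have T: "T \<in> Obj C" using Hom_objs u by blast
  have t: "i \<cdot> u \<in> Hom C T (Dom C p)" using a u by (simp add: Hom_def)
  have "p \<cdot> (i \<cdot> u) = (p \<cdot> i) \<cdot> u" using a(1-3) u by (simp add: Hom_def comp_assoc)
  also have "\<dots> = Zero C T (Cod C p)" unfolding a(4) using a(1-3) u Cod_in[OF a(2)] by (simp add: Hom_def)
  finally have "\<exists>!w. w \<in> Hom C T (Dom C i) \<and> i \<cdot> w = i \<cdot> u"
    using conflation_kernel_cokernel[OF c] T t unfolding is_kernel_def by blast
  then show ?thesis using u v eq by metis
qed

lemma cokernel_descend:
  assumes "(i, p) \<in> conflations C" "t \<in> Hom C (Cod C i) T" "t \<cdot> i = Zero C (Dom C i) T"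
  shows "\<exists>u \<in> Hom C (Cod C p) T. u \<cdot> p = t"
  using conflation_kernel_cokernel[OF assms(1)] assms(2,3) Hom_objs[OF assms(2)]
  unfolding is_cokernel_def by metis

lemma cokernel_epi:
  assumes c: "(i, p) \<in> conflations C" and u: "u \<in> Hom C (Cod C p) T" and v: "v \<in> Hom C (Cod C p) T"
    and eq: "u \<cdot> p = v \<cdot> p"
  shows "u = v"
proof -
  note a = conflation_arrs[OF c]
  have T: "T \<in> Obj C" using Hom_objs u by blast
  have t: "u \<cdot> p \<in> Hom C (Cod C i) T" using a u by (simp add: Hom_def)
  have "(u \<cdot> p) \<cdot> i = Zero C (Dom C i) T"
    using a u Dom_in[OF a(1)] by (simp add: Hom_def comp_assoc)
  then have "\<exists>!w. w \<in> Hom C (Cod C p) T \<and> w \<cdot> p = u \<cdot> p"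
    using conflation_kernel_cokernel[OF c] T t unfolding is_cokernel_def by blast
  then show ?thesis using u v eq by metis
qed

lemma inflation_arr: "inflation C i \<Longrightarrow> i \<in> Arr C"
  unfolding inflation_def using conflation_arrs by blast

lemma deflation_arr: "deflation C p \<Longrightarrow> p \<in> Arr C"
  unfolding deflation_def using conflation_arrs by blast

section \<open>Inflations and split conflations\<close>

lemma inflation_iso_comp:
  assumes "inflation C i" "is_iso C b" "b \<in> Hom C (Cod C i) Y"
  shows "inflation C (b \<cdot> i)"
proof -
  obtain p where c: "(i, p) \<in> conflations C" using assms(1) by (auto simp: inflation_def)
  note a = conflation_arrs[OF c]
  obtain b' where b': "b' \<in> Hom C Y (Cod C i)" "b' \<cdot> b = Ident C (Cod C i)"
    using iso_inverse assms(2,3) by blast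
  have "(b \<cdot> i, p \<cdot> b') \<in> conflations C"
  proof (rule conflation_iso[OF c iso_Ident assms(2) iso_Ident])
    show "(p \<cdot> b') \<cdot> b = Ident C (Cod C p) \<cdot> p"
      using a(1-3) b' assms(3) by (simp add: Hom_def comp_assoc)
  qed (use a(1-3) b' assms(3) Dom_in Cod_in in \<open>auto simp: Hom_def\<close>)
  then show ?thesis by (auto simp: inflation_def)
qed

text \<open>The axiom provides one pushout that is an inflation; the comparison maps
  \<open>u\<close> and \<open>v\<close> make any other pushout isomorphic to it.\<close>

lemma pushout_inflation:
  assumes i: "inflation C i" and po: "is_pushout C i f f' i'"
  shows "inflation C i'"
proof -
  have f: "f \<in> Arr C" "Dom C f = Dom C i" using po by (auto simp: is_pushout_def)
  obtain g j where po': "is_pushout C i f g j" and j: "inflation C j"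
    using inflation_pushout[OF i f] by blast
  define P P' where "P = Cod C i'" and "P' = Cod C j"
  have a: "f' \<in> Hom C (Cod C i) P" "i' \<in> Hom C (Cod C f) P" "f' \<cdot> i = i' \<cdot> f" "P \<in> Obj C"
    and a': "g \<in> Hom C (Cod C i) P'" "j \<in> Hom C (Cod C f) P'" "g \<cdot> i = j \<cdot> f" "P' \<in> Obj C"
    using po po' Cod_in by (auto simp: is_pushout_def Hom_def P_def P'_def)
  have U: "\<exists>!u. u \<in> Hom C P T \<and> u \<cdot> f' = s \<and> u \<cdot> i' = t"
    if "s \<in> Hom C (Cod C i) T" "t \<in> Hom C (Cod C f) T" "s \<cdot> i = t \<cdot> f" for s t T
    using po Hom_objs[OF that(1)] that unfolding is_pushout_def P_def by blast
  have U': "\<exists>!u. u \<in> Hom C P' T \<and> u \<cdot> g = s \<and> u \<cdot> j = t"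
    if "s \<in> Hom C (Cod C i) T" "t \<in> Hom C (Cod C f) T" "s \<cdot> i = t \<cdot> f" for s t T
    using po' Hom_objs[OF that(1)] that unfolding is_pushout_def P'_def by blast
  obtain u where u: "u \<in> Hom C P P'" "u \<cdot> f' = g" "u \<cdot> i' = j" using U[OF a'(1-3)] by blast
  obtain v where v: "v \<in> Hom C P' P" "v \<cdot> g = f'" "v \<cdot> j = i'" using U'[OF a(1-3)] by blast
  have "(v \<cdot> u) \<cdot> f' = f'" "(v \<cdot> u) \<cdot> i' = i'" "Ident C P \<cdot> f' = f'" "Ident C P \<cdot> i' = i'"
    using u v a by (auto simp: Hom_def comp_assoc)
  then have vu: "v \<cdot> u = Ident C P"
    using U[OF a(1-3)] Comp_in[OF u(1) v(1)] Ident_in[OF a(4)] by blast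
  have "(u \<cdot> v) \<cdot> g = g" "(u \<cdot> v) \<cdot> j = j" "Ident C P' \<cdot> g = g" "Ident C P' \<cdot> j = j"
    using u v a' by (auto simp: Hom_def comp_assoc)
  then have uv: "u \<cdot> v = Ident C P'"
    using U'[OF a'(1-3)] Comp_in[OF v(1) u(1)] Ident_in[OF a'(4)] by blast
  have "is_iso C v" by (rule is_isoI[OF v(1) u(1) uv vu])
  then show ?thesis using inflation_iso_comp[OF j, of v P] v P'_def by simp
qed

text \<open>The kernel of the identity of \<open>A\<close> is both zero and monic, so its domain is
  a zero object. This makes the map from zero to \<open>A\<close> an inflation.\<close>

lemma zero_inflation:
  assumes A: "A \<in> Obj C"
  shows "\<exists>z. inflation C z \<and> Cod C z = A \<and> Ident C (Dom C z) = Zero C (Dom C z) (Dom C z)"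
proof -
  obtain z where c: "(z, Ident C A) \<in> conflations C"
    using deflation_Ident[OF A] by (auto simp: deflation_def)
  note a = conflation_arrs[OF c]
  have z: "z \<in> Arr C" "Cod C z = A" "Dom C z \<in> Obj C" using a A Dom_in by auto
  have "z = Zero C (Dom C z) A" using a(4) z A by simp
  then have "z \<cdot> Ident C (Dom C z) = z \<cdot> Zero C (Dom C z) (Dom C z)" using z by simp
  then have "Ident C (Dom C z) = Zero C (Dom C z) (Dom C z)"
    using kernel_mono[OF c Ident_in zero_Hom] z by blast
  then show ?thesis using c z by (auto simp: inflation_def)
qed

text \<open>The inclusion into a direct sum is a pushout of \<open>0 \<rightarrow> Y\<close>.\<close>

lemma inflation_inclusion:
  assumes bp: "is_biproduct C X Y B i1 i2 p1 p2"
  shows "inflation C i1"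
proof -
  note a = biproduct_arrs[OF bp]
  obtain z where z: "inflation C z" "Cod C z = Y" "Ident C (Dom C z) = Zero C (Dom C z) (Dom C z)"
    using zero_inflation a by blast
  have za: "z \<in> Arr C" "Dom C z \<in> Obj C" using inflation_arr[OF z(1)] Dom_in by auto
  have "z = z \<cdot> Ident C (Dom C z)" using za by simp
  then have z0: "z = Zero C (Dom C z) Y" unfolding z(3) using za z(2) by simp
  have "is_pushout C z (Zero C (Dom C z) X) i2 i1"
    unfolding is_pushout_def
  proof (intro conjI ballI impI)
    show "i2 \<cdot> z = i1 \<cdot> Zero C (Dom C z) X" by (subst z0) (use a za in simp)
  next
    fix T s t assume T: "T \<in> Obj C" and s: "s \<in> Hom C (Cod C z) T"
      and "t \<in> Hom C (Cod C (Zero C (Dom C z) X)) T"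
    then have t: "t \<in> Hom C X T" using a za by simp
    have st: "s \<in> Arr C" "Dom C s = Y" "Cod C s = T" "t \<in> Arr C" "Dom C t = X" "Cod C t = T"
      using s t z(2) by (auto simp: Hom_def)
    show "\<exists>!u. u \<in> Hom C (Cod C i1) T \<and> u \<cdot> i2 = s \<and> u \<cdot> i1 = t"
    proof (rule ex1I[of _ "t \<cdot> p1 \<boxplus> s \<cdot> p2"])
      show "t \<cdot> p1 \<boxplus> s \<cdot> p2 \<in> Hom C (Cod C i1) T \<and> (t \<cdot> p1 \<boxplus> s \<cdot> p2) \<cdot> i2 = s \<and>
          (t \<cdot> p1 \<boxplus> s \<cdot> p2) \<cdot> i1 = t"
        using a st T by (simp add: Hom_def comp_assoc biproduct_comp[OF bp])
    next
      fix u assume u: "u \<in> Hom C (Cod C i1) T \<and> u \<cdot> i2 = s \<and> u \<cdot> i1 = t"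
      then show "u = t \<cdot> p1 \<boxplus> s \<cdot> p2"
        using biproduct_decomp(2)[OF bp, of u] a by (simp add: Hom_def)
    qed
  qed (use a z za in auto)
  then show ?thesis by (rule pushout_inflation[OF z(1)])
qed

text \<open>With \<open>B \<oplus> A\<close> an auxiliary direct sum, the map is the composite
  \<open>(j \<oplus> 1) \<cdot> (1, \<beta>)\<close>, where \<open>j \<oplus> 1\<close> is a pushout of \<open>j\<close> and \<open>(1, \<beta>)\<close> is the inclusion of \<open>B\<close>
  followed by a shear.\<close>

lemma inflation_graph:
  assumes j: "inflation C j" and \<beta>: "\<beta> \<in> Hom C (Dom C j) A"
    and bp: "is_biproduct C (Cod C j) A Q k1 k2 r1 r2"
  shows "inflation C (k1 \<cdot> j \<boxplus> k2 \<cdot> \<beta>)"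
proof -
  define B where "B = Dom C j"
  have ja: "j \<in> Arr C" "Dom C j = B" using inflation_arr[OF j] by (auto simp: B_def)
  note a = biproduct_arrs[OF bp]
  have B: "B \<in> Obj C" using ja Dom_in by auto
  have \<beta>a: "\<beta> \<in> Arr C" "Dom C \<beta> = B" "Cod C \<beta> = A" using \<beta> ja by (auto simp: Hom_def)
  obtain P i1 i2 p1 p2 where bp': "is_biproduct C B A P i1 i2 p1 p2"
    using biproduct_exists[OF B a(3)] by blast
  note a' = biproduct_arrs[OF bp']
  \<comment> \<open>\<open>\<sigma>\<close> is the shear (x, y) -> (x, y + \<beta> x) of B \<oplus>
    A, and \<open>\<tau>\<close> is its inverse.\<close>
  define \<sigma> where "\<sigma> = Ident C P \<boxplus> i2 \<cdot> (\<beta> \<cdot> p1)"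
  define \<tau> where "\<tau> = Ident C P \<boxplus> neg (i2 \<cdot> (\<beta> \<cdot> p1))"
  have \<sigma>: "\<sigma> \<in> Hom C P P" and \<tau>: "\<tau> \<in> Hom C P P"
    using a' \<beta>a by (auto simp: \<sigma>_def \<tau>_def Hom_def)
  note sim = a' \<beta>a comp_assoc biproduct_comp[OF bp'] Hom_def add_assoc
  have "\<tau> \<cdot> \<sigma> = Ident C P" "\<sigma> \<cdot> \<tau> = Ident C P" unfolding \<sigma>_def \<tau>_def by (simp_all add: sim)
  from is_isoI[OF \<sigma> \<tau> this] have \<sigma>iso: "is_iso C \<sigma>" .
  have "inflation C (\<sigma> \<cdot> i1)"
    by (rule inflation_iso_comp[OF inflation_inclusion[OF bp'] \<sigma>iso, of P]) (use \<sigma> a' in simp)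
  then have \<theta>: "inflation C (i1 \<boxplus> i2 \<cdot> \<beta>)" unfolding \<sigma>_def by (simp add: sim)
  define m where "m = k1 \<cdot> (j \<cdot> p1) \<boxplus> k2 \<cdot> p2"
  have ma: "m \<in> Arr C" "Dom C m = P" "Cod C m = Q" using a a' ja by (auto simp: m_def)
  have mi: "m \<cdot> i1 = k1 \<cdot> j" "m \<cdot> i2 = k2" "m \<cdot> (i1 \<boxplus> i2 \<cdot> \<beta>) = k1 \<cdot> j \<boxplus> k2 \<cdot> \<beta>"
    unfolding m_def using a a' ja \<beta>a by (simp_all add: comp_assoc biproduct_comp[OF bp'])
  have "is_pushout C j i1 k1 m"
    unfolding is_pushout_def
  proof (intro conjI ballI impI)
    fix T s t assume T: "T \<in> Obj C" and s: "s \<in> Hom C (Cod C j) T" and "t \<in> Hom C (Cod C i1) T"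
      and eq: "s \<cdot> j = t \<cdot> i1"
    then have t: "t \<in> Hom C P T" using a' by simp
    have st: "s \<in> Arr C" "Dom C s = Cod C j" "Cod C s = T" "t \<in> Arr C" "Dom C t = P" "Cod C t = T"
      using s t by (auto simp: Hom_def)
    show "\<exists>!u. u \<in> Hom C (Cod C m) T \<and> u \<cdot> k1 = s \<and> u \<cdot> m = t"
    proof (rule ex1I[of _ "s \<cdot> r1 \<boxplus> (t \<cdot> i2) \<cdot> r2"])
      let ?u = "s \<cdot> r1 \<boxplus> (t \<cdot> i2) \<cdot> r2"
      have "?u \<cdot> m = (s \<cdot> j) \<cdot> p1 \<boxplus> (t \<cdot> i2) \<cdot> p2"
        unfolding m_def using a a' ja st T by (simp add: comp_assoc biproduct_comp[OF bp])
      also have "\<dots> = t" unfolding eq by (rule biproduct_decomp(2)[OF bp']) (use st in auto)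
      finally show "?u \<in> Hom C (Cod C m) T \<and> ?u \<cdot> k1 = s \<and> ?u \<cdot> m = t"
        using a a' st T ma by (simp add: Hom_def comp_assoc biproduct_comp[OF bp])
    next
      fix u assume u: "u \<in> Hom C (Cod C m) T \<and> u \<cdot> k1 = s \<and> u \<cdot> m = t"
      then have ua: "u \<in> Arr C" "Dom C u = Q" using ma by (auto simp: Hom_def)
      have "u \<cdot> k2 = t \<cdot> i2" using comp_assoc[of i2 m u] mi(2) u ua ma a' by auto
      then show "u = s \<cdot> r1 \<boxplus> (t \<cdot> i2) \<cdot> r2"
        using biproduct_decomp(2)[OF bp, of u] ua u by simp
    qed
  qed (use a a' ja ma mi in auto)
  then have "inflation C m" by (rule pushout_inflation[OF j])
  then have "inflation C (m \<cdot> (i1 \<boxplus> i2 \<cdot> \<beta>))"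
    by (rule inflation_Comp[OF \<theta>]) (use a' \<beta>a ma in simp)
  then show ?thesis using mi by simp
qed

text \<open>The inflation \<open>i1\<close> has some cokernel \<open>c\<close> forming a conflation
  with it; \<open>p2\<close> is a cokernel of \<open>i1\<close> too, so the two differ by an
  isomorphism \<open>w\<close>, with inverse \<open>c \<cdot> i2\<close>.\<close>

lemma split_conflation:
  assumes bp: "is_biproduct C X Y B i1 i2 p1 p2"
  shows "(i1, p2) \<in> conflations C"
proof -
  note a = biproduct_arrs[OF bp]
  obtain c where cf: "(i1, c) \<in> conflations C"
    using inflation_inclusion[OF bp] by (auto simp: inflation_def)
  note ca = conflation_arrs[OF cf]
  have c: "c \<in> Arr C" "Dom C c = B" "Cod C c \<in> Obj C" using ca a Cod_in by auto
  obtain w where w: "w \<in> Hom C (Cod C c) Y" "w \<cdot> c = p2"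
    using cokernel_descend[OF cf, of p2 Y] a biproduct_comp[OF bp] by (auto simp: Hom_def)
  have ci2: "c \<cdot> i2 \<in> Hom C Y (Cod C c)" using c a by (simp add: Hom_def)
  have 1: "w \<cdot> (c \<cdot> i2) = Ident C Y"
    using comp_assoc[of i2 c w] w c a biproduct_comp[OF bp] by (auto simp: Hom_def)
  have "((c \<cdot> i2) \<cdot> w) \<cdot> c = (c \<cdot> i1) \<cdot> p1 \<boxplus> (c \<cdot> i2) \<cdot> p2"
    using w c a ca(4) by (auto simp: Hom_def comp_assoc)
  also have "\<dots> = Ident C (Cod C c) \<cdot> c" using biproduct_decomp(2)[OF bp, of c] c by simp
  finally have 2: "(c \<cdot> i2) \<cdot> w = Ident C (Cod C c)"
    by (rule cokernel_epi[OF cf Comp_in[OF w(1) ci2] Ident_in[OF c(3)]])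
  have wiso: "is_iso C w" by (rule is_isoI[OF w(1) ci2 2 1])
  show ?thesis
    by (rule conflation_iso[OF cf iso_Ident[OF a(2)] iso_Ident[OF a(1)] wiso])
      (use a c w in \<open>auto simp: Hom_def\<close>)
qed

text \<open>The pullback of \<open>(i, p)\<close> along \<open>h\<close> is an extension of \<open>A\<close> by \<open>B\<close>, hence split.\<close>

lemma lift_of_Ext1_trivial:
  assumes Ext: "is_singleton (Ext1 C A (Dom C i))" and c: "(i, p) \<in> conflations C"
    and h: "h \<in> Hom C A (Cod C p)"
  shows "\<exists>l \<in> Hom C A (Dom C p). p \<cdot> l = h"
proof -
  define B where "B = Dom C i"
  note ca = conflation_arrs[OF c]
  have B: "B \<in> Obj C" "i \<in> Arr C" "Dom C i = B" using ca Dom_in by (auto simp: B_def)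
  have ha: "h \<in> Arr C" "Dom C h = A" "Cod C h = Cod C p" "A \<in> Obj C"
    using h Hom_objs[OF h] by (auto simp: Hom_def)
  have "deflation C p" using c by (auto simp: deflation_def)
  then obtain f' p' where pb: "is_pullback C p h f' p'" and p'd: "deflation C p'"
    using deflation_pullback[of p h] ha by blast
  define P where "P = Dom C p'"
  have f'a: "f' \<in> Hom C P (Cod C i)" and p'a: "p' \<in> Hom C P A" and sq: "p \<cdot> f' = h \<cdot> p'"
    and P: "P \<in> Obj C"
    using pb ha ca Dom_in by (auto simp: is_pullback_def Hom_def P_def)
  have U: "\<exists>!u. u \<in> Hom C T P \<and> f' \<cdot> u = s \<and> p' \<cdot> u = t"
    if "s \<in> Hom C T (Cod C i)" "t \<in> Hom C T A" "p \<cdot> s = h \<cdot> t" for s t T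
    using pb Hom_objs[OF that(1)] that ha ca unfolding is_pullback_def P_def by auto
  have z: "Zero C B A \<in> Hom C B A" by (rule zero_Hom[OF B(1) ha(4)])
  have "p \<cdot> i = h \<cdot> Zero C B A" using ca(4) B ha by simp
  then obtain i0 where i0: "i0 \<in> Hom C B P" "f' \<cdot> i0 = i" "p' \<cdot> i0 = Zero C B A"
    using U[of i B "Zero C B A"] z B by (auto simp: Hom_def)
  \<comment> \<open>The pullback axiom gives only some kernel \<open>k\<close> of \<open>p'\<close>.
    The maps \<open>u\<close> and \<open>v\<close> identify \<open>K\<close> with \<open>B\<close>,
    so that \<open>i0\<close> can serve as the kernel.\<close>
  obtain k where ck: "(k, p') \<in> conflations C" using p'd by (auto simp: deflation_def)
  note ka = conflation_arrs[OF ck]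
  define K where "K = Dom C k"
  have k: "k \<in> Hom C K P" "p' \<cdot> k = Zero C K A" "K \<in> Obj C"
    using ka p'a Dom_in by (auto simp: K_def Hom_def)
  obtain u where u: "u \<in> Hom C B K" "k \<cdot> u = i0"
    using kernel_lift[OF ck, of i0 B] i0 k p'a by (auto simp: Hom_def K_def)
  have f'k: "f' \<cdot> k \<in> Hom C K (Cod C i)" by (rule Comp_in[OF k(1) f'a])
  have "p \<cdot> (f' \<cdot> k) = (p \<cdot> f') \<cdot> k"
    using ca(1-3) f'a k(1) by (auto simp: Hom_def comp_assoc)
  also have "\<dots> = h \<cdot> (p' \<cdot> k)" unfolding sq using ha p'a k(1) by (auto simp: Hom_def comp_assoc)
  also have "\<dots> = Zero C K (Cod C p)" unfolding k(2) using ha k(3) by simp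
  finally obtain v where v: "v \<in> Hom C K B" "i \<cdot> v = f' \<cdot> k"
    using kernel_lift[OF c f'k] B(3) by auto
  have "i \<cdot> (v \<cdot> u) = (f' \<cdot> k) \<cdot> u"
    unfolding v(2)[symmetric] using v(1) u(1) B by (auto simp: Hom_def comp_assoc)
  also have "\<dots> = i \<cdot> Ident C B"
    using Comp_assoc[OF u(1) k(1) f'a] u(2) i0(2) B by simp
  finally have vu: "v \<cdot> u = Ident C B"
    using kernel_mono[OF c] Comp_in[OF u(1) v(1)] Ident_in[OF B(1)] B(3) by auto
  have i0v: "i0 \<cdot> v = k"
  proof -
    have "f' \<cdot> (i0 \<cdot> v) = f' \<cdot> k" using Comp_assoc[OF v(1) i0(1) f'a] i0(2) v(2) by simp
    moreover have "p' \<cdot> (i0 \<cdot> v) = p' \<cdot> k"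
      unfolding Comp_assoc[OF v(1) i0(1) p'a, symmetric] i0(3) k(2)
      using v(1) ha(4) by (auto simp: Hom_def)
    moreover have "p \<cdot> (f' \<cdot> k) = h \<cdot> (p' \<cdot> k)"
      using Comp_assoc[OF k(1) f'a, of p "Cod C p"] Comp_assoc[OF k(1) p'a h] sq ca(1-3)
      by (auto simp: Hom_def)
    ultimately show ?thesis
      using U[OF f'k Comp_in[OF k(1) p'a]] Comp_in[OF v(1) i0(1)] k(1) by blast
  qed
  have "k \<cdot> (u \<cdot> v) = k \<cdot> Ident C K"
    using Comp_assoc[OF v(1) u(1) k(1)] u(2) i0v Ident_right[OF k(1)] by simp
  then have uv: "u \<cdot> v = Ident C K"
    using kernel_mono[OF ck, folded K_def] Comp_in[OF v(1) u(1)] Ident_in[OF k(3)] by blast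
  have "is_iso C v" by (rule is_isoI[OF v(1) u(1) uv vu])
  then have c0: "(i0, p') \<in> conflations C"
  proof (rule conflation_iso[OF ck _ iso_Ident[OF P] iso_Ident[OF ha(4)]])
    show "i0 \<cdot> v = Ident C P \<cdot> k" using i0v Ident_left[OF k(1)] by simp
    show "p' \<cdot> Ident C P = Ident C A \<cdot> p'" using Ident_left[OF p'a] Ident_right[OF p'a] by simp
  qed (use v i0 p'a k P ha(4) K_def in \<open>auto simp: Hom_def\<close>)
  \<comment> \<open>As \<open>Ext1\<close> has one element, this extension is equivalent to the
    split one, and \<open>i2\<close> transports to a section of \<open>p'\<close>.\<close>
  obtain S i1 i2 p1 p2 where bp: "is_biproduct C B A S i1 i2 p1 p2"
    using biproduct_exists[OF B(1) ha(4)] by blast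
  note a = biproduct_arrs[OF bp]
  have e0: "(i0, p') \<in> extensions C A B" using c0 i0(1) p'a by (simp add: extensions_def Hom_def)
  have e1: "(i1, p2) \<in> extensions C A B" using split_conflation[OF bp] a by (simp add: extensions_def)
  let ?r = "extension_equiv C A B"
  have "?r `` {(i0, p')} = ?r `` {(i1, p2)}"
    using Ext e0 e1 unfolding B_def[symmetric] Ext1_def is_singleton_def
    by (metis quotientI singletonD)
  moreover have "((i1, p2), (i1, p2)) \<in> ?r"
    unfolding extension_equiv_def using e1 a iso_Ident[OF a(1)] Ident_in[OF a(1)] by auto
  ultimately have "((i0, p'), (i1, p2)) \<in> ?r" by blast
  then obtain g where g: "g \<in> Hom C P S" "is_iso C g" "p2 \<cdot> g = p'"
    using i0(1) a by (auto simp: extension_equiv_def Hom_def)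
  obtain g' where g': "g' \<in> Hom C S P" "g \<cdot> g' = Ident C S" using iso_inverse[OF g(2,1)] by blast
  have i2: "i2 \<in> Hom C A S" and p2: "p2 \<in> Hom C S A" using a by (auto simp: Hom_def)
  have s: "g' \<cdot> i2 \<in> Hom C A P" by (rule Comp_in[OF i2 g'(1)])
  have "p' \<cdot> (g' \<cdot> i2) = p2 \<cdot> ((g \<cdot> g') \<cdot> i2)"
    unfolding g(3)[symmetric] using g(1) g'(1) a by (auto simp: Hom_def comp_assoc)
  also have "\<dots> = Ident C A" unfolding g'(2) using a biproduct_comp[OF bp] by simp
  finally have s1: "p' \<cdot> (g' \<cdot> i2) = Ident C A" .
  have pa: "p \<in> Hom C (Cod C i) (Cod C p)" using ca by (simp add: Hom_def)
  \<comment> \<open>The section of \<open>p'\<close> followed by \<open>f'\<close> is the lift of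
    \<open>h\<close>.\<close>
  have "p \<cdot> (f' \<cdot> (g' \<cdot> i2)) = h \<cdot> (p' \<cdot> (g' \<cdot> i2))"
    unfolding Comp_assoc[OF s f'a pa, symmetric] sq Comp_assoc[OF s p'a h] ..
  also have "\<dots> = h" unfolding s1 using Ident_right[OF h] .
  finally show ?thesis using Comp_in[OF s f'a] ca(3) by auto
qed

end

section \<open>Presentations and cones\<close>

text \<open>For modules over the full subcategory \<open>S\<close>, \<open>presents B A \<beta> D t\<close> says that
  \<open>C(-,B) \<rightarrow> C(-,A) \<rightarrow> C(-,D) \<rightarrow> 0\<close> is exact on \<open>S\<close>.  In the stable category of a Frobenius category
  the triangle on \<open>\<beta>\<close> yields such a presentation in which \<open>t\<close> is moreover a weak cokernel.\<close>

locale encoded_sub = encoded C S e d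
  for C :: "('o, 'm, 'x) precat_scheme" (structure) and S :: "'o set"
    and e :: "'m \<Rightarrow> 'g" and d :: "'g \<Rightarrow> 'm" +
  assumes S_sub: "S \<subseteq> Obj C"
begin

definition presents :: "'o \<Rightarrow> 'o \<Rightarrow> 'm \<Rightarrow> 'o \<Rightarrow> 'm \<Rightarrow> bool" where
  "presents B A \<beta> D t \<longleftrightarrow> B \<in> S \<and> A \<in> S \<and> \<beta> \<in> Hom C B A \<and> t \<in> Hom C A D \<and>
     t \<cdot> \<beta> = Zero C B D \<and>
     (\<forall>N \<in> S. \<forall>h \<in> Hom C N D. \<exists>h' \<in> Hom C N A. t \<cdot> h' = h) \<and>
     (\<forall>N \<in> S. \<forall>h \<in> Hom C N A. t \<cdot> h = Zero C N D \<longrightarrow> (\<exists>v \<in> Hom C N B. \<beta> \<cdot> v = h))"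

text \<open>As for triangles, the factorization through \<open>t\<close> need not be unique; two of
  them differ by a \<open>ghost\<close>, by \<open>ghost_of_presentation\<close>.\<close>

definition cone :: "'o \<Rightarrow> 'o \<Rightarrow> 'm \<Rightarrow> 'o \<Rightarrow> 'm \<Rightarrow> bool" where
  "cone B A \<beta> D t \<longleftrightarrow> presents B A \<beta> D t \<and>
     (\<forall>Y. \<forall>a \<in> Hom C A Y. a \<cdot> \<beta> = Zero C B Y \<longrightarrow> (\<exists>c \<in> Hom C D Y. c \<cdot> t = a))"

text \<open>A morphism invisible from \<open>S\<close>. In the stable category, with
  \<open>M\<close> for \<open>S\<close>, these are the morphisms killed by \<open>G\<close>.\<close>

definition ghost :: "'m \<Rightarrow> bool" where
  "ghost f \<longleftrightarrow> (\<forall>N \<in> S. \<forall>h \<in> Hom C N (Dom C f). f \<cdot> h = Zero C N (Cod C f))"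

text \<open>In the stable category, with \<open>M\<close> for \<open>S\<close>, this is membership
  in the class of weak equivalences; see \<open>weq_iff\<close>.\<close>

definition S_equiv :: "'m \<Rightarrow> bool" where
  "S_equiv w \<longleftrightarrow> (\<forall>N \<in> S. bij_betw (\<lambda>h. w \<cdot> h) (Hom C N (Dom C w)) (Hom C N (Cod C w)))"

lemma presents_D:
  assumes "presents B A \<beta> D t"
  shows "B \<in> S" "A \<in> S" "\<beta> \<in> Hom C B A" "t \<in> Hom C A D" "t \<cdot> \<beta> = Zero C B D"
    "B \<in> Obj C" "A \<in> Obj C" "D \<in> Obj C"
    "\<And>N h. N \<in> S \<Longrightarrow> h \<in> Hom C N D \<Longrightarrow> \<exists>h' \<in> Hom C N A. t \<cdot> h' = h"
    "\<And>N h. N \<in> S \<Longrightarrow> h \<in> Hom C N A \<Longrightarrow> t \<cdot> h = Zero C N D \<Longrightarrow> \<exists>v \<in> Hom C N B. \<beta> \<cdot> v = h"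
  using assms S_sub Hom_objs[of t A D] unfolding presents_def by blast+

lemma cone_D:
  assumes "cone B A \<beta> D t"
  shows "presents B A \<beta> D t"
    "\<And>Y a. a \<in> Hom C A Y \<Longrightarrow> a \<cdot> \<beta> = Zero C B Y \<Longrightarrow> \<exists>c \<in> Hom C D Y. c \<cdot> t = a"
  using assms unfolding cone_def by blast+

lemma ghost_comp: "ghost f \<Longrightarrow> f \<in> Hom C X Y \<Longrightarrow> N \<in> S \<Longrightarrow> h \<in> Hom C N X \<Longrightarrow> f \<cdot> h = Zero C N Y"
  by (simp add: ghost_def Hom_D)

lemma ghostI:
  "f \<in> Hom C X Y \<Longrightarrow> (\<And>N h. N \<in> S \<Longrightarrow> h \<in> Hom C N X \<Longrightarrow> f \<cdot> h = Zero C N Y) \<Longrightarrow> ghost f"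
  by (simp add: ghost_def Hom_D)

lemma ghost_diff_iff:
  assumes "f \<in> Hom C X Y" "g \<in> Hom C X Y"
  shows "ghost (f \<boxplus> neg g) \<longleftrightarrow> (\<forall>N \<in> S. \<forall>h \<in> Hom C N X. f \<cdot> h = g \<cdot> h)"
proof -
  have "(f \<boxplus> neg g) \<cdot> h = Zero C N Y \<longleftrightarrow> f \<cdot> h = g \<cdot> h" if "h \<in> Hom C N X" for N h
    using diff_zero_iff[of "f \<cdot> h" "g \<cdot> h"] assms that by (auto simp: Hom_def)
  then show ?thesis unfolding ghost_def using assms by (auto simp: Hom_D)
qed

lemma S_equiv_D:
  assumes w: "S_equiv w" "w \<in> Hom C X Y" and N: "N \<in> S"
  shows "h \<in> Hom C N Y \<Longrightarrow> \<exists>h' \<in> Hom C N X. w \<cdot> h' = h"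
    "h \<in> Hom C N X \<Longrightarrow> w \<cdot> h = Zero C N Y \<Longrightarrow> h = Zero C N X"
proof -
  have bij: "bij_betw (\<lambda>h. w \<cdot> h) (Hom C N X) (Hom C N Y)"
    using w N Hom_D[OF w(2)] unfolding S_equiv_def by auto
  show "h \<in> Hom C N Y \<Longrightarrow> \<exists>h' \<in> Hom C N X. w \<cdot> h' = h"
    using bij unfolding bij_betw_def by (metis imageE)
  assume h: "h \<in> Hom C N X" and "w \<cdot> h = Zero C N Y"
  moreover have "w \<cdot> Zero C N X = Zero C N Y"
    using w(2) Hom_objs[OF h] by (simp add: Hom_D)
  ultimately show "h = Zero C N X"
    using bij zero_Hom[of N X] Hom_objs[OF h] unfolding bij_betw_def inj_on_def by auto
qed

text \<open>Composition with \<open>w\<close> is additive, so injectivity can be tested at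
  zero.\<close>

lemma S_equivI:
  assumes w: "w \<in> Hom C X Y"
    and surj: "\<And>N h. N \<in> S \<Longrightarrow> h \<in> Hom C N Y \<Longrightarrow> \<exists>h' \<in> Hom C N X. w \<cdot> h' = h"
    and inj: "\<And>N h. N \<in> S \<Longrightarrow> h \<in> Hom C N X \<Longrightarrow> w \<cdot> h = Zero C N Y \<Longrightarrow> h = Zero C N X"
  shows "S_equiv w"
  unfolding S_equiv_def
proof
  fix N assume N: "N \<in> S"
  have "inj_on (\<lambda>h. w \<cdot> h) (Hom C N X)"
  proof (rule inj_onI)
    fix h h' assume h: "h \<in> Hom C N X" and h': "h' \<in> Hom C N X" and eq: "w \<cdot> h = w \<cdot> h'"
    have "w \<cdot> (h \<boxplus> neg h') = Zero C N Y"
      using w h h' eq diff_zero_iff[of "w \<cdot> h" "w \<cdot> h'"] by (simp add: Hom_D)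
    then have "h \<boxplus> neg h' = Zero C N X" by (rule inj[OF N add_Hom[OF h neg_Hom[OF h']]])
    then show "h = h'" using diff_zero_iff[of h h'] h h' by (simp add: Hom_D)
  qed
  moreover have "(\<lambda>h. w \<cdot> h) ` Hom C N X = Hom C N Y"
    using surj[OF N] Comp_in[OF _ w] by blast
  ultimately show "bij_betw (\<lambda>h. w \<cdot> h) (Hom C N (Dom C w)) (Hom C N (Cod C w))"
    using Hom_D[OF w] by (simp add: bij_betw_def)
qed

text \<open>Every morphism from \<open>S\<close> to \<open>D\<close> factors through
  \<open>t\<close>, so a morphism vanishing on \<open>t\<close> vanishes on all of them.\<close>

lemma ghost_of_presentation:
  assumes p: "presents B A \<beta> D t" and f: "f \<in> Hom C D Y" and ft: "f \<cdot> t = Zero C A Y"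
  shows "ghost f"
proof (rule ghostI[OF f])
  fix N h assume N: "N \<in> S" and h: "h \<in> Hom C N D"
  note pD = presents_D[OF p]
  obtain h' where h': "h' \<in> Hom C N A" "t \<cdot> h' = h" using pD(9)[OF N h] by blast
  have "f \<cdot> h = (f \<cdot> t) \<cdot> h'" unfolding h'(2)[symmetric] using Comp_assoc[OF h'(1) pD(4) f] by simp
  then show "f \<cdot> h = Zero C N Y" unfolding ft using h'(1) Hom_objs[OF f] by (simp add: Hom_D)
qed

text \<open>Since \<open>A\<close> lies in \<open>S\<close>, \<open>f \<cdot> t\<close> lifts along
  \<open>w\<close> to some \<open>g\<close>. Since \<open>B\<close> lies in \<open>S\<close>,
  \<open>g \<cdot> \<beta>\<close> vanishes as soon as its composite with \<open>w\<close> does. So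
  \<open>g\<close> extends over the weak cokernel; agreement is exact on \<open>t\<close> and leaves
  a ghost on \<open>D\<close>.\<close>

lemma lift_S_equiv:
  assumes c: "cone B A \<beta> D t" and w: "S_equiv w" "w \<in> Hom C Y Z" and f: "f \<in> Hom C D Z"
  shows "\<exists>f' \<in> Hom C D Y. ghost (f \<boxplus> neg (w \<cdot> f'))"
proof -
  note pD = presents_D[OF cone_D(1)[OF c]]
  have ft: "f \<cdot> t \<in> Hom C A Z" by (rule Comp_in[OF pD(4) f])
  obtain g where g: "g \<in> Hom C A Y" "w \<cdot> g = f \<cdot> t" using S_equiv_D(1)[OF w pD(2) ft] by blast
  have gb: "g \<cdot> \<beta> \<in> Hom C B Y" by (rule Comp_in[OF pD(3) g(1)])
  have "w \<cdot> (g \<cdot> \<beta>) = f \<cdot> (t \<cdot> \<beta>)"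
    using Comp_assoc[OF pD(3) g(1) w(2)] Comp_assoc[OF pD(3,4) f] g(2) by simp
  also have "\<dots> = Zero C B Z" unfolding pD(5) using f pD(6) by (simp add: Hom_D)
  finally have "g \<cdot> \<beta> = Zero C B Y" by (rule S_equiv_D(2)[OF w pD(1) gb])
  then obtain f' where f': "f' \<in> Hom C D Y" "f' \<cdot> t = g" using cone_D(2)[OF c g(1)] by blast
  have wf': "w \<cdot> f' \<in> Hom C D Z" by (rule Comp_in[OF f'(1) w(2)])
  have "(f \<boxplus> neg (w \<cdot> f')) \<cdot> t = f \<cdot> t \<boxplus> neg (w \<cdot> g)"
    unfolding f'(2)[symmetric] using f pD(4) w(2) f'(1) by (simp add: Hom_D comp_assoc)
  also have "\<dots> = Zero C A Z" unfolding g(2) using ft by (simp add: Hom_D)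
  finally have "ghost (f \<boxplus> neg (w \<cdot> f'))"
    by (rule ghost_of_presentation[OF cone_D(1)[OF c] add_Hom[OF f neg_Hom[OF wf']]])
  then show ?thesis using f' by blast
qed

text \<open>\<open>D\<close> and \<open>X\<close> represent cokernels of the same
  \<open>\<beta>\<close> on \<open>S\<close>. The comparison \<open>w\<close> induced by the weak
  cokernel respects both presentations and is therefore bijective on \<open>S\<close>.\<close>

lemma cone_approximates:
  assumes c: "cone B A \<beta> D t" and p: "presents B A \<beta> X a"
  shows "\<exists>c \<in> Hom C D X. S_equiv c"
proof -
  note tD = presents_D[OF cone_D(1)[OF c]]
  note aD = presents_D[OF p]
  obtain w where w: "w \<in> Hom C D X" "w \<cdot> t = a" using cone_D(2)[OF c aD(4,5)] by blast
  have "S_equiv w"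
  proof (rule S_equivI[OF w(1)])
    fix N h assume N: "N \<in> S" and h: "h \<in> Hom C N X"
    obtain h' where h': "h' \<in> Hom C N A" "a \<cdot> h' = h" using aD(9)[OF N h] by blast
    have "w \<cdot> (t \<cdot> h') = h" using Comp_assoc[OF h'(1) tD(4) w(1)] w(2) h'(2) by simp
    then show "\<exists>h' \<in> Hom C N D. w \<cdot> h' = h" using Comp_in[OF h'(1) tD(4)] by blast
  next
    fix N h assume N: "N \<in> S" and h: "h \<in> Hom C N D" and wh: "w \<cdot> h = Zero C N X"
    obtain h' where h': "h' \<in> Hom C N A" "t \<cdot> h' = h" using tD(9)[OF N h] by blast
    have "a \<cdot> h' = Zero C N X" using Comp_assoc[OF h'(1) tD(4) w(1)] w(2) h'(2) wh by simp
    then obtain v where v: "v \<in> Hom C N B" "\<beta> \<cdot> v = h'" using aD(10)[OF N h'(1)] by blast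
    have "h = (t \<cdot> \<beta>) \<cdot> v" using Comp_assoc[OF v(1) tD(3,4)] v(2) h'(2) by simp
    then show "h = Zero C N D" unfolding tD(5) using v(1) tD(8) by (simp add: Hom_D)
  qed
  then show ?thesis using w by blast
qed

text \<open>The Yoneda argument: a natural map is determined by the image \<open>g\<close> of the generator \<open>t\<close>,
  and \<open>g\<close> factors through \<open>t\<close> because naturality at \<open>\<beta>\<close> forces \<open>g \<cdot> \<beta> = 0\<close>.\<close>

lemma natural_map_of_cone:
  assumes c: "cone B A \<beta> D t" and \<eta>: "natural_map CS (R D) (R Y) \<eta>" and Y: "Y \<in> Obj C"
  shows "\<exists>f \<in> Hom C D Y. module_arr CS (R D) \<eta> (R Y) = rmap f"
proof -
  note pD = presents_D[OF cone_D(1)[OF c]]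
  have ob: "A \<in> Obj CS" "B \<in> Obj CS" using pD by auto
  have et: "e t \<in> carrier (Sect (R D) A)" using pD(4) by simp
  obtain g where g: "g \<in> Hom C A Y" "\<eta> A (e t) = e g"
    using natural_map_closed[OF \<eta> ob(1) et] by auto
  have nat: "\<eta> N (e (t \<cdot> h)) = e (g \<cdot> h)" if h: "h \<in> Hom C N A" and N: "N \<in> S" for N h
  proof -
    have "h \<in> Hom CS N A" using h N pD(2) by (simp add: CS_Hom)
    from CS.natural_map_act[OF \<eta> this et]
    show ?thesis using g decode_Hom[OF pD(4)] decode_Hom[OF g(1)] by simp
  qed
  have gb: "g \<cdot> \<beta> \<in> Hom C B Y" by (rule Comp_in[OF pD(3) g(1)])
  have "e (g \<cdot> \<beta>) = \<eta> B (e (Zero C B D))" using nat[OF pD(3,1)] pD(5) by simp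
  also have "\<dots> = e (Zero C B Y)"
    using natural_map_one[OF rep_module[OF pD(8)] rep_module[OF Y] \<eta> ob(2)] by simp
  finally have "g \<cdot> \<beta> = Zero C B Y" using encode_eq[OF gb zero_Hom[OF pD(6) Y]] by simp
  then obtain f where f: "f \<in> Hom C D Y" "f \<cdot> t = g" using cone_D(2)[OF c g(1)] by blast
  have "module_arr CS (R D) \<eta> (R Y) = rmap f"
    unfolding rmap_eq[OF f(1)] module_arr_eq_iff
  proof (intro ballI)
    fix N x assume N: "N \<in> Obj CS" and "x \<in> carrier (Sect (R D) N)"
    then obtain h where h: "h \<in> Hom C N D" "x = e h" by auto
    obtain h' where h': "h' \<in> Hom C N A" "t \<cdot> h' = h" using pD(9)[OF _ h(1)] N by auto
    show "\<eta> N x = e (f \<cdot> d x)"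
      using nat[OF h'(1)] N h h'(2) Comp_assoc[OF h'(1) pD(4) f(1)] f(2) decode_Hom[OF h(1)] by simp
  qed
  then show ?thesis using f by blast
qed

text \<open>\<open>finitely_presented\<close> speaks of representables of the full subcategory,
  \<open>rep\<close> of those of \<open>C\<close>. As records they may differ at objects outside
  \<open>S\<close>, which natural maps do not see.\<close>

lemma natural_map_representable:
  assumes "X \<in> S"
  shows "natural_map CS (representable CS X) F \<eta> \<longleftrightarrow> natural_map CS (rep C id id X) F \<eta>"
    "natural_map CS F' (representable CS X) \<theta> \<longleftrightarrow> natural_map CS F' (rep C id id X) \<theta>"
  using assms unfolding rep_id by (simp_all add: natural_map_def representable_def homgrp_full_sub)

text \<open>The presentation is composition with \<open>\<beta>\<close> and \<open>t\<close>; the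
  representables keep the identity encoding while \<open>R D\<close> is carried by 'g.\<close>

lemma fp_of_presentation:
  assumes p: "presents B A \<beta> D t"
  shows "finitely_presented CS (R D)"
proof -
  interpret I: encoded C S id id by unfold_locales simp
  note pD = presents_D[OF p]
  have \<alpha>: "natural_map CS (rep C id id B) (rep C id id A) (\<lambda>N h. \<beta> \<cdot> h)"
    using I.rep_natural[OF I.encoded_axioms pD(3)] by simp
  have \<tau>: "natural_map CS (rep C id id A) (R D) (\<lambda>N h. e (t \<cdot> h))"
    using rep_natural[OF I.encoded_axioms pD(4)] by simp
  have "(\<lambda>h. e (t \<cdot> h)) ` Hom CS N A = carrier (Sect (R D) N) \<and>
      {h \<in> Hom CS N A. e (t \<cdot> h) = \<one>\<^bsub>Sect (R D) N\<^esub>} = (\<lambda>h. \<beta> \<cdot> h) ` Hom CS N B"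
    if N: "N \<in> Obj CS" for N
  proof
    have N: "N \<in> S" "N \<in> Obj C" using N by auto
    have H: "Hom CS N A = Hom C N A" "Hom CS N B = Hom C N B" using N pD by (auto simp: CS_Hom)
    have "(\<lambda>h. t \<cdot> h) ` Hom C N A = Hom C N D" using pD(9)[OF N(1)] Comp_in[OF _ pD(4)] by blast
    then show "(\<lambda>h. e (t \<cdot> h)) ` Hom CS N A = carrier (Sect (R D) N)"
      unfolding H by (metis image_image rep_sel(1))
    have "e (t \<cdot> h) = e (Zero C N D) \<longleftrightarrow> h \<in> (\<lambda>h. \<beta> \<cdot> h) ` Hom C N B" if h: "h \<in> Hom C N A" for h
    proof
      assume "e (t \<cdot> h) = e (Zero C N D)"
      then have "t \<cdot> h = Zero C N D"
        using encode_eq[OF Comp_in[OF h pD(4)] zero_Hom[OF N(2) pD(8)]] by simp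
      then show "h \<in> (\<lambda>h. \<beta> \<cdot> h) ` Hom C N B" using pD(10)[OF N(1) h] by blast
    next
      assume "h \<in> (\<lambda>h. \<beta> \<cdot> h) ` Hom C N B"
      then obtain v where v: "v \<in> Hom C N B" "h = \<beta> \<cdot> v" by blast
      have "t \<cdot> h = (t \<cdot> \<beta>) \<cdot> v" using Comp_assoc[OF v(1) pD(3,4)] v(2) by simp
      then show "e (t \<cdot> h) = e (Zero C N D)" unfolding pD(5) using v(1) pD(8) by (simp add: Hom_D)
    qed
    then show "{h \<in> Hom CS N A. e (t \<cdot> h) = \<one>\<^bsub>Sect (R D) N\<^esub>} = (\<lambda>h. \<beta> \<cdot> h) ` Hom CS N B"
      unfolding H using Comp_in[OF _ pD(3)] by auto
  qed
  then show ?thesis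
    unfolding finitely_presented_def using rep_module[OF pD(8)] \<alpha> \<tau> pD(1,2,6,7)
    unfolding natural_map_representable(1)[OF pD(1), symmetric]
      natural_map_representable(2)[OF pD(2), symmetric]
      natural_map_representable(1)[OF pD(2), symmetric]
    by (intro conjI bexI[of _ B] bexI[of _ A] exI[of _ "\<lambda>N h. \<beta> \<cdot> h"] exI[of _ "\<lambda>N h. e (t \<cdot> h)"]) auto
qed

text \<open>By Yoneda \<open>\<alpha>\<close> is composition with the morphism
  \<open>\<beta>\<close> that it assigns to the identity of \<open>B\<close>. For any
  \<open>D\<close> presented by \<open>\<beta>\<close>, \<open>R D\<close> and \<open>F\<close> are
  quotients of one representable by one kernel.\<close>

lemma fp_iso_rep:
  assumes fp: "finitely_presented CS F"
    and cones: "\<And>A B \<beta>. \<lbrakk>A \<in> S; B \<in> S; \<beta> \<in> Hom C B A\<rbrakk> \<Longrightarrow> \<exists>D \<in> P. \<exists>t. presents B A \<beta> D t"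
  shows "\<exists>D \<in> P. \<exists>c \<in> Hom (module_cat T CS) (R D) F. is_iso (module_cat T CS) c"
proof -
  interpret I: encoded C S id id by unfold_locales simp
  have S: "Obj CS = S" using S_sub by auto
  have F: "is_module CS F" using fp by (simp add: finitely_presented_def)
  obtain B A \<alpha> \<tau> where BA: "B \<in> S" "A \<in> S"
    and \<alpha>: "natural_map CS (representable CS B) (representable CS A) \<alpha>"
    and \<tau>: "natural_map CS (representable CS A) F \<tau>"
    and ex: "\<forall>N \<in> S. \<tau> N ` Hom CS N A = carrier (Sect F N) \<and>
      {h \<in> Hom CS N A. \<tau> N h = \<one>\<^bsub>Sect F N\<^esub>} = \<alpha> N ` Hom CS N B"
    using fp unfolding finitely_presented_def S by (elim conjE bexE exE)
  have H: "Hom CS N A = Hom C N A" "Hom CS N B = Hom C N B" if "N \<in> S" for N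
    using that BA by (auto simp: CS_Hom)
  have \<alpha>: "natural_map CS (rep C id id B) (rep C id id A) \<alpha>" and \<tau>: "natural_map CS (rep C id id A) F \<tau>"
    using \<alpha>[unfolded natural_map_representable(1)[OF BA(1)] natural_map_representable(2)[OF BA(2)]]
      \<tau>[unfolded natural_map_representable(1)[OF BA(2)]] by auto
  have BAo: "B \<in> Obj C" "A \<in> Obj C" "B \<in> Obj CS" using BA S_sub by auto
  define \<beta> where "\<beta> = \<alpha> B (Ident C B)"
  have id: "Ident C B \<in> carrier (Sect (rep C id id B) B)" using Ident_in[OF BAo(1)] by simp
  have \<beta>: "\<beta> \<in> Hom C B A" using natural_map_closed[OF \<alpha> BAo(3) id] by (simp add: \<beta>_def)
  have \<alpha>\<beta>: "\<alpha> N h = \<beta> \<cdot> h" if h: "h \<in> Hom C N B" and N: "N \<in> S" for N h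
  proof -
    have "h \<in> Hom CS N B" using h N H by simp
    from CS.natural_map_act[OF \<alpha> this id] show ?thesis
      using h by (simp add: \<beta>_def Hom_D)
  qed
  obtain D t where D: "D \<in> P" and p: "presents B A \<beta> D t" using cones[OF BA(2,1) \<beta>] by blast
  note pD = presents_D[OF p]
  have u: "natural_map CS (rep C id id A) (R D) (\<lambda>N h. e (t \<cdot> h))"
    using rep_natural[OF I.encoded_axioms pD(4)] by simp
  have "\<exists>c \<in> Hom (module_cat T CS) (R D) F. is_iso (module_cat T CS) c"
  proof (rule CS.quotients_iso[OF I.rep_module[OF BAo(2)] rep_module[OF pD(8)] F u \<tau>])
    fix N assume "N \<in> Obj CS"
    then have N: "N \<in> S" "N \<in> Obj C" by auto
    have "(\<lambda>h. t \<cdot> h) ` Hom C N A = Hom C N D" using pD(9)[OF N(1)] Comp_in[OF _ pD(4)] by blast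
    then show "(\<lambda>h. e (t \<cdot> h)) ` carrier (Sect (rep C id id A) N) = carrier (Sect (R D) N)"
      by (metis image_image rep_sel(1) image_id id_apply)
    show "\<tau> N ` carrier (Sect (rep C id id A) N) = carrier (Sect F N)"
      using bspec[OF ex N(1)] H[OF N(1)] by simp
    fix h assume "h \<in> carrier (Sect (rep C id id A) N)"
    then have h: "h \<in> Hom C N A" by simp
    have "e (t \<cdot> h) = \<one>\<^bsub>Sect (R D) N\<^esub> \<longleftrightarrow> t \<cdot> h = Zero C N D"
      using encode_eq[OF Comp_in[OF h pD(4)] zero_Hom[OF N(2) pD(8)]] by simp
    also have "\<dots> \<longleftrightarrow> (\<exists>v \<in> Hom C N B. \<beta> \<cdot> v = h)"
    proof
      assume "\<exists>v \<in> Hom C N B. \<beta> \<cdot> v = h"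
      then obtain v where v: "v \<in> Hom C N B" "\<beta> \<cdot> v = h" by blast
      have "t \<cdot> h = (t \<cdot> \<beta>) \<cdot> v" using Comp_assoc[OF v(1) pD(3,4)] v(2) by simp
      then show "t \<cdot> h = Zero C N D" unfolding pD(5) using v(1) pD(8) by (simp add: Hom_D)
    qed (rule pD(10)[OF N(1) h])
    also have "\<dots> \<longleftrightarrow> h \<in> \<alpha> N ` Hom C N B" using \<alpha>\<beta>[OF _ N(1)] by (auto simp: image_iff)
    also have "\<dots> \<longleftrightarrow> \<tau> N h = \<one>\<^bsub>Sect F N\<^esub>" using bspec[OF ex N(1)] H[OF N(1)] h by blast
    finally show "e (t \<cdot> h) = \<one>\<^bsub>Sect (R D) N\<^esub> \<longleftrightarrow> \<tau> N h = \<one>\<^bsub>Sect F N\<^esub>" .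
  qed
  then show ?thesis using D by blast
qed

end

section \<open>Rigid subcategories of Frobenius categories\<close>

lemma factoring_E:
  assumes "f \<in> factoring C S" "f \<in> Hom C X Y"
  obtains U a b where "U \<in> S" "a \<in> Hom C X U" "b \<in> Hom C U Y" "f = b \<cdot>\<^bsub>C\<^esub> a"
proof -
  have "Dom C f = X" "Cod C f = Y" using assms(2) by (auto simp: Hom_def)
  then show ?thesis using assms(1) that unfolding factoring_def by blast
qed

locale rigid_subcategory = frobenius_category C
  for C :: "('o, 'm, 'x) excat_scheme" (structure) +
  fixes M :: "'o set"
  assumes M_sub: "M \<subseteq> Obj C"
    and M_additive: "additive_category (full_sub C M)"
    and M_rigid: "rigid C M"
    and M_cfinite: "contravariantly_finite C M"
    and injectives_M: "injectives C \<subseteq> M"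
begin

section \<open>The ideal of morphisms factoring through injectives\<close>

abbreviation J :: "'m set" where "J \<equiv> factoring C (injectives C)"

lemma embed_injective:
  assumes "X \<in> Obj C"
  obtains k where "inflation C k" "k \<in> Hom C X (Cod C k)" "Cod C k \<in> injectives C"
  using enough_injectives[OF assms] inflation_arr by (auto simp: Hom_def)

lemma J_I: "a \<in> Hom C X I \<Longrightarrow> I \<in> injectives C \<Longrightarrow> b \<in> Hom C I Y \<Longrightarrow> b \<cdot> a \<in> J"
  using Comp_in[of a X I b Y] by (auto simp: factoring_def Hom_def injectives_def)

lemma J_factor:
  assumes f: "f \<in> J" "f \<in> Hom C X Y" and k: "inflation C k" "k \<in> Hom C X K"
  shows "\<exists>b \<in> Hom C K Y. f = b \<cdot> k"
proof -
  obtain U a b where U: "U \<in> injectives C" and a: "a \<in> Hom C X U" and b: "b \<in> Hom C U Y"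
    and fba: "f = b \<cdot> a"
    using f by (rule factoring_E)
  have ka: "Dom C k = X" "Cod C k = K" using k(2) by (auto simp: Hom_def)
  obtain g where g: "g \<in> Hom C K U" "g \<cdot> k = a"
    using U k(1) a unfolding injectives_def ka[symmetric] by blast
  have "f = (b \<cdot> g) \<cdot> k" using Comp_assoc[OF k(2) g(1) b] g(2) fba by simp
  then show ?thesis using Comp_in[OF g(1) b] by blast
qed

sublocale J: ideal C J
proof
  fix X Y assume XY: "X \<in> Obj C" "Y \<in> Obj C"
  obtain k where k: "inflation C k" "k \<in> Hom C X (Cod C k)" "Cod C k \<in> injectives C"
    using XY(1) by (rule embed_injective)
  have o: "Cod C k \<in> Obj C" using Hom_objs[OF k(2)] by simp
  have "Zero C (Cod C k) Y \<cdot> k = Zero C X Y" using k(2) XY o by (simp add: Hom_def)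
  then show "Zero C X Y \<in> J" using J_I[OF k(2,3) zero_Hom[OF o XY(2)]] by simp
next
  fix X Y f g assume f: "f \<in> Hom C X Y" "f \<in> J" and g: "g \<in> Hom C X Y" "g \<in> J"
  obtain k where k: "inflation C k" "k \<in> Hom C X (Cod C k)" "Cod C k \<in> injectives C"
    using Hom_objs[OF f(1)] embed_injective by blast
  obtain b c where b: "b \<in> Hom C (Cod C k) Y" "f = b \<cdot> k" and c: "c \<in> Hom C (Cod C k) Y" "g = c \<cdot> k"
    using J_factor[OF f(2,1) k(1,2)] J_factor[OF g(2,1) k(1,2)] by blast
  have "f \<boxplus> neg g = (b \<boxplus> neg c) \<cdot> k" unfolding b(2) c(2) using b(1) c(1) k(2) by (simp add: Hom_def)
  then show "f \<boxplus> neg g \<in> J" using J_I[OF k(2,3) add_Hom[OF b(1) neg_Hom[OF c(1)]]] by simp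
next
  fix X Y Z f g assume f: "f \<in> Hom C X Y" and g: "g \<in> Hom C Y Z"
  show "g \<cdot> f \<in> J" if J: "f \<in> J"
  proof -
    obtain U a b where U: "U \<in> injectives C" and a: "a \<in> Hom C X U" and b: "b \<in> Hom C U Y"
      and fba: "f = b \<cdot> a"
      using J f by (rule factoring_E)
    show ?thesis using J_I[OF a U Comp_in[OF b g]] Comp_assoc[OF a b g] fba by simp
  qed
  show "g \<cdot> f \<in> J" if J: "g \<in> J"
  proof -
    obtain U a b where U: "U \<in> injectives C" and a: "a \<in> Hom C Y U" and b: "b \<in> Hom C U Z"
      and fba: "g = b \<cdot> a"
      using J g by (rule factoring_E)
    show ?thesis using J_I[OF Comp_in[OF f a] U b] Comp_assoc[OF f a b] fba by simp
  qed
qed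

text \<open>With the identity encoding the modules are those of \<open>G_functor\<close>, by which
  the weak equivalences are defined.\<close>

sublocale S: encoded_sub J.Q M id id
  by (simp add: encoded_sub_def encoded_sub_axioms_def encoded_def encoded_axioms_def
    J.preadditive_Q M_sub)

abbreviation scomp (infixl "\<odot>" 70) where "g \<odot> f \<equiv> g \<cdot>\<^bsub>J.Q\<^esub> f"

lemma q_zero_iff: "f \<in> Hom C X Y \<Longrightarrow> J.q f = Zero J.Q X Y \<longleftrightarrow> f \<in> J"
  using J.coset_eq_iff[of f X Y "Zero C X Y"] zero_Hom[of X Y] Hom_objs[of f X Y]
  by (simp add: Hom_def)

lemma q_comp_zero_iff:
  "f \<in> Hom C X Y \<Longrightarrow> g \<in> Hom C Y Z \<Longrightarrow> J.q g \<odot> J.q f = Zero J.Q X Z \<longleftrightarrow> g \<cdot> f \<in> J"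
  using J.Q_comp q_zero_iff[OF Comp_in] by metis

text \<open>This is how rigidity acts: \<open>Ext1\<close> of \<open>N\<close> by the kernel
  vanishes, as both lie in \<open>M\<close>.\<close>

lemma conflation_lift:
  assumes c: "(i, p) \<in> conflations C" and i: "Dom C i \<in> M" and N: "N \<in> M"
    and h: "h \<in> Hom C N (Cod C p)"
  shows "\<exists>l \<in> Hom C N (Dom C p). p \<cdot> l = h"
  by (rule lift_of_Ext1_trivial[OF _ c h]) (use M_rigid i N in \<open>simp add: rigid_def\<close>)

text \<open>The injective through which \<open>f\<close> passes is projective too, so
  \<open>b\<close> lifts along \<open>p\<close>, and the lift of \<open>f\<close> still passes
  through that object.\<close>

lemma J_lift:
  assumes p: "deflation C p" and f: "f \<in> J" "f \<in> Hom C X (Cod C p)"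
  shows "\<exists>l \<in> Hom C X (Dom C p). l \<in> J \<and> p \<cdot> l = f"
proof -
  obtain U a b where U: "U \<in> injectives C" and a: "a \<in> Hom C X U" and b: "b \<in> Hom C U (Cod C p)"
    and fba: "f = b \<cdot> a"
    using f by (rule factoring_E)
  obtain l where l: "l \<in> Hom C U (Dom C p)" "p \<cdot> l = b"
    using U p b unfolding projectives_eq_injectives[symmetric] projectives_def by blast
  have pa: "p \<in> Hom C (Dom C p) (Cod C p)" using deflation_arr[OF p] by (rule Hom_I)
  show ?thesis
    using J_I[OF a U l(1)] Comp_in[OF a l(1)] Comp_assoc[OF a l(1) pa] l(2) fba by auto
qed

text \<open>Additivity of \<open>M\<close> keeps direct sums inside \<open>M\<close>; biproduct data
  of the full subcategory are biproduct data of \<open>C\<close>.\<close>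

lemma biproduct_in_M:
  assumes "A \<in> M" "B \<in> M"
  obtains P i1 i2 p1 p2 where "P \<in> M" "is_biproduct C A B P i1 i2 p1 p2"
proof -
  interpret F: additive_category "full_sub C M" by (rule M_additive)
  obtain P i1 i2 p1 p2 where "is_biproduct (full_sub C M) A B P i1 i2 p1 p2"
    using F.biproduct_exists[of A B] assms M_sub by (auto simp: subset_iff)
  then have "P \<in> M" "is_biproduct C A B P i1 i2 p1 p2"
    using assms by (auto simp: is_biproduct_def Hom_full_sub)
  then show ?thesis using that by blast
qed

text \<open>Lifting along \<open>p\<close> is rigidity. The other two exactness properties hold up
  to members of \<open>J\<close>, which are removed by changing the representative before the kernel
  or cokernel property is applied.\<close>

lemma cone_of_conflation:
  assumes c: "(i, p) \<in> conflations C" and iM: "Dom C i \<in> M" "Cod C i \<in> M"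
  shows "S.cone (Dom C i) (Cod C i) (J.q i) (Cod C p) (J.q p)"
  unfolding S.cone_def S.presents_def
proof (intro conjI ballI allI impI)
  note ca = conflation_arrs[OF c]
  define B A D where "B = Dom C i" and "A = Cod C i" and "D = Cod C p"
  have i: "i \<in> Hom C B A" and p: "p \<in> Hom C A D" using ca by (auto simp: Hom_def B_def A_def D_def)
  have M: "A \<in> M" "B \<in> M" and o: "A \<in> Obj C" "B \<in> Obj C" "D \<in> Obj C"
    using iM Hom_objs[OF i] Hom_objs[OF p] by (auto simp: A_def B_def)
  have pi: "p \<cdot> i = Zero C B D" using ca(4) by (simp add: B_def D_def)
  have defl: "deflation C p" using c by (auto simp: deflation_def)
  show "Dom C i \<in> M" "Cod C i \<in> M" by fact+
  show "J.q i \<in> Hom J.Q (Dom C i) (Cod C i)" "J.q p \<in> Hom J.Q (Cod C i) (Cod C p)"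
    using J.Q_arr i p by (auto simp: A_def B_def D_def)
  show "J.q p \<odot> J.q i = Zero J.Q (Dom C i) (Cod C p)"
    using J.Q_comp[OF i p] pi by (simp add: B_def D_def)
  fix N assume N: "N \<in> M"
  show "\<exists>h' \<in> Hom J.Q N (Cod C i). J.q p \<odot> h' = h" if "h \<in> Hom J.Q N (Cod C p)" for h
  proof -
    obtain h0 where h0: "h0 \<in> Hom C N (Cod C p)" "h = J.q h0" using \<open>h \<in> _\<close> by (rule J.Q_Hom_E)
    obtain l where l: "l \<in> Hom C N A" "p \<cdot> l = h0"
      using conflation_lift[OF c iM(1) N h0(1)] ca A_def by auto
    then show ?thesis using J.Q_comp[OF l(1) p] J.Q_arr[OF l(1)] h0(2) A_def by auto
  qed
  show "\<exists>v \<in> Hom J.Q N (Dom C i). J.q i \<odot> v = h"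
    if "h \<in> Hom J.Q N (Cod C i)" "J.q p \<odot> h = Zero J.Q N (Cod C p)" for h
  proof -
    obtain h0 where h0: "h0 \<in> Hom C N A" "h = J.q h0" using \<open>h \<in> _\<close> A_def by (auto elim: J.Q_Hom_E)
    \<comment> \<open>Subtracting a lift \<open>l\<close> of \<open>p \<cdot> h0\<close> that itself
      lies in \<open>J\<close> keeps the stable class of \<open>h0\<close> and makes its composite
      with \<open>p\<close> zero.\<close>
    have "p \<cdot> h0 \<in> J" using that(2) q_comp_zero_iff[OF h0(1) p] h0(2) D_def by simp
    then obtain l where l: "l \<in> Hom C N A" "l \<in> J" "p \<cdot> l = p \<cdot> h0"
      using J_lift[OF defl _ Comp_in[OF h0(1) p, unfolded D_def]] ca A_def by auto
    have hl: "h0 \<boxplus> neg l \<in> Hom C N A" using h0(1) l(1) add_Hom neg_Hom by auto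
    have "p \<cdot> (h0 \<boxplus> neg l) = p \<cdot> h0 \<boxplus> neg (p \<cdot> l)" using h0(1) l(1) p by (simp add: Hom_def)
    also have "\<dots> = Zero C N D" unfolding l(3) using h0(1) p by (simp add: Hom_def)
    finally obtain v where v: "v \<in> Hom C N B" "i \<cdot> v = h0 \<boxplus> neg l"
      using kernel_lift[OF c, of "h0 \<boxplus> neg l" N] hl by (auto simp: A_def B_def D_def)
    have "h0 \<boxplus> neg (i \<cdot> v) = l"
      unfolding v(2) using h0(1) l(1) by (simp add: Hom_def Dom_in Cod_in)
    then have "J.q h0 = J.q (i \<cdot> v)"
      using J.coset_eq_iff[OF h0(1) Comp_in[OF v(1) i]] l(2) by simp
    then show ?thesis using J.Q_comp[OF v(1) i] J.Q_arr[OF v(1)] h0(2) B_def by auto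
  qed
next
  fix Y a assume "a \<in> Hom J.Q (Cod C i) Y" and aq: "a \<odot> J.q i = Zero J.Q (Dom C i) Y"
  note ca = conflation_arrs[OF c]
  obtain a0 where a0: "a0 \<in> Hom C (Cod C i) Y" "a = J.q a0" using \<open>a \<in> _\<close> by (rule J.Q_Hom_E)
  have i: "i \<in> Hom C (Dom C i) (Cod C i)" and p: "p \<in> Hom C (Cod C i) (Cod C p)"
    using ca by (auto simp: Hom_def)
  \<comment> \<open>As \<open>k \<cdot> i\<close> is an inflation, \<open>a0 \<cdot> i\<close>
    extends along it to \<open>b\<close>. Subtracting the stably zero \<open>b \<cdot> k\<close>
    from \<open>a0\<close> gives a morphism that vanishes on \<open>i\<close> and so descends along
    \<open>p\<close>.\<close>
  have "a0 \<cdot> i \<in> J" using aq q_comp_zero_iff[OF i a0(1)] a0(2) by simp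
  moreover obtain k where k: "inflation C k" "k \<in> Hom C (Cod C i) (Cod C k)" "Cod C k \<in> injectives C"
    using Hom_objs[OF i] embed_injective by blast
  moreover have "inflation C (k \<cdot> i)"
    by (rule inflation_Comp[OF _ k(1)]) (use c k(2) in \<open>auto simp: inflation_def Hom_def\<close>)
  ultimately obtain b where b: "b \<in> Hom C (Cod C k) Y" "a0 \<cdot> i = b \<cdot> (k \<cdot> i)"
    using J_factor[OF _ Comp_in[OF i a0(1)] _ Comp_in[OF i k(2)]] by blast
  have bk: "b \<cdot> k \<in> Hom C (Cod C i) Y" by (rule Comp_in[OF k(2) b(1)])
  have ab: "a0 \<boxplus> neg (b \<cdot> k) \<in> Hom C (Cod C i) Y" using a0(1) bk add_Hom neg_Hom by auto
  have "(a0 \<boxplus> neg (b \<cdot> k)) \<cdot> i = a0 \<cdot> i \<boxplus> neg (b \<cdot> (k \<cdot> i))"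
    using a0(1) b(1) k(2) i by (simp add: Hom_def comp_assoc)
  also have "\<dots> = Zero C (Dom C i) Y" unfolding b(2) using b(1) k(2) i by (simp add: Hom_def)
  finally obtain f where f: "f \<in> Hom C (Cod C p) Y" "f \<cdot> p = a0 \<boxplus> neg (b \<cdot> k)"
    using cokernel_descend[OF c ab] by blast
  have "a0 \<boxplus> neg (f \<cdot> p) = b \<cdot> k"
    unfolding f(2) using a0(1) bk by (simp add: Hom_def Dom_in Cod_in)
  then have "J.q a0 = J.q (f \<cdot> p)"
    using J.coset_eq_iff[OF a0(1) Comp_in[OF p f(1)]] J_I[OF k(2,3) b(1)] by simp
  then show "\<exists>c \<in> Hom J.Q (Cod C p) Y. c \<odot> J.q p = a"
    using J.Q_comp[OF p f(1)] J.Q_arr[OF f(1)] a0(2) by auto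
qed

lemma pr_Obj: "X \<in> pr C M \<Longrightarrow> X \<in> Obj C"
  using conflation_arrs(2) Cod_in by (auto simp: pr_def)

lemma pr_cone: "X \<in> pr C M \<Longrightarrow> \<exists>B A \<beta> t. S.cone B A \<beta> X t"
  using cone_of_conflation by (fastforce simp: pr_def)

text \<open>\<open>D\<close> is the cokernel of \<open>(j, \<beta>) : B \<rightarrow> I \<oplus> A\<close> for an inflation \<open>j\<close> into an injective \<open>I\<close>; the conflation
  yields the cone up to the summand \<open>I\<close>, which is zero in the stable category.\<close>

lemma cone_exists:
  assumes AB: "A \<in> M" "B \<in> M" and \<beta>: "\<beta> \<in> Hom J.Q B A"
  shows "\<exists>D \<in> pr C M. \<exists>t. S.cone B A \<beta> D t"
proof -
  obtain b where b: "b \<in> Hom C B A" "\<beta> = J.q b" using \<beta> by (rule J.Q_Hom_E)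
  obtain j where j: "inflation C j" "j \<in> Hom C B (Cod C j)" "Cod C j \<in> injectives C"
    using Hom_objs[OF b(1)] embed_injective by blast
  define I where "I = Cod C j"
  have jI: "j \<in> Hom C B I" "I \<in> injectives C" "I \<in> M" using j injectives_M by (auto simp: I_def)
  obtain P k1 k2 r1 r2 where PM: "P \<in> M" and bp: "is_biproduct C I A P k1 k2 r1 r2"
    using biproduct_in_M[OF jI(3) AB(1)] by blast
  note a = biproduct_arrs[OF bp]
  define i where "i = k1 \<cdot> j \<boxplus> k2 \<cdot> b"
  have ba: "b \<in> Arr C" "Dom C b = B" "Cod C b = A" and ja: "j \<in> Arr C" "Dom C j = B" "Cod C j = I"
    using b(1) jI(1) by (auto simp: Hom_def)
  have "inflation C i"
    unfolding i_def by (rule inflation_graph[OF j(1) _ bp[unfolded I_def]]) (use b ja in simp)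
  then obtain p where c: "(i, p) \<in> conflations C" by (auto simp: inflation_def)
  note ca = conflation_arrs[OF c]
  define D where "D = Cod C p"
  have ia: "i \<in> Arr C" "Dom C i = B" "Cod C i = P" using a ba ja by (auto simp: i_def)
  have pa: "p \<in> Arr C" "Dom C p = P" "Cod C p = D" "D \<in> Obj C" "p \<cdot> i = Zero C B D"
    using ca ia Cod_in by (auto simp: D_def)
  have D: "D \<in> pr C M" using c ia pa PM AB by (auto simp: pr_def)
  have cone: "S.cone B P (J.q i) D (J.q p)" using cone_of_conflation[OF c] ia pa PM AB by simp
  note pD = S.presents_D[OF S.cone_D(1)[OF cone]]
  have H: "i \<in> Hom C B P" "p \<in> Hom C P D" "k1 \<in> Hom C I P" "k2 \<in> Hom C A P" "r1 \<in> Hom C P I" "r2 \<in> Hom C P A"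
    using a ia pa by (auto simp: Hom_def)
  have I: "I \<in> Obj C" "A \<in> Obj C" "B \<in> Obj C" using a ba Dom_in by auto
  define t where "t = p \<cdot> k2"
  have t: "t \<in> Hom C A D" unfolding t_def by (rule Comp_in[OF H(4,2)])
  \<comment> \<open>Because \<open>p \<cdot> i\<close> is zero, \<open>t \<cdot> b\<close> is the
    negative of a morphism through \<open>I\<close>, hence stably zero.\<close>
  have "t \<cdot> b \<boxplus> (p \<cdot> k1) \<cdot> j = p \<cdot> i"
    unfolding i_def t_def using a ba ja pa by (simp add: comp_assoc add_commute)
  then have tb0: "t \<cdot> b \<boxplus> (p \<cdot> k1) \<cdot> j = Zero C B D" using pa by simp
  have pkj: "(p \<cdot> k1) \<cdot> j \<in> J" "(p \<cdot> k1) \<cdot> j \<in> Hom C B D"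
    using J_I[OF jI(1,2) Comp_in[OF H(3,2)]] Comp_in[OF jI(1) Comp_in[OF H(3,2)]] by auto
  have "t \<cdot> b = neg ((p \<cdot> k1) \<cdot> j)"
    by (rule neg_unique) (use tb0 t b(1) pkj(2) in \<open>auto simp: Hom_def add_commute\<close>)
  then have tb: "t \<cdot> b \<in> J" using J.neg_J[of "(p \<cdot> k1) \<cdot> j"] pkj by (simp add: Hom_def)
  have r2i: "r2 \<cdot> i = b" "r2 \<cdot> k2 = Ident C A"
    unfolding i_def using a ba ja biproduct_comp[OF bp] I by simp_all
  have "S.cone B A (J.q b) D (J.q t)"
    unfolding S.cone_def S.presents_def
  proof (intro conjI ballI allI impI)
    show "B \<in> M" "A \<in> M" by fact+
    show "J.q b \<in> Hom J.Q B A" "J.q t \<in> Hom J.Q A D" using J.Q_arr b t by auto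
    show "J.q t \<odot> J.q b = Zero J.Q B D" using q_comp_zero_iff[OF b(1) t] tb by simp
    fix N assume N: "N \<in> M"
    then have No: "N \<in> Obj C" using M_sub by auto
    show "\<exists>h' \<in> Hom J.Q N A. J.q t \<odot> h' = h" if hh: "h \<in> Hom J.Q N D" for h
    proof -
      obtain m' where m': "m' \<in> Hom J.Q N P" "J.q p \<odot> m' = h" using pD(9)[OF N hh] by blast
      obtain m where m: "m \<in> Hom C N P" "m' = J.q m" using m'(1) by (rule J.Q_Hom_E)
      have ma: "m \<in> Arr C" "Dom C m = N" "Cod C m = P" using m by (auto simp: Hom_def)
      have r2m: "r2 \<cdot> m \<in> Hom C N A" by (rule Comp_in[OF m(1) H(6)])
      \<comment> \<open>Splitting \<open>m\<close> along the biproduct, the component through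
        \<open>I\<close> is stably zero, so \<open>r2 \<cdot> m\<close> is already a lift along
        \<open>t\<close>.\<close>
      have "p \<cdot> m = p \<cdot> (k1 \<cdot> (r1 \<cdot> m) \<boxplus> k2 \<cdot> (r2 \<cdot> m))"
        using biproduct_decomp(1)[OF bp ma(1,3)] by simp
      also have "\<dots> = (p \<cdot> k1) \<cdot> (r1 \<cdot> m) \<boxplus> t \<cdot> (r2 \<cdot> m)"
        unfolding t_def using a ma pa by (simp add: comp_assoc)
      finally have "p \<cdot> m \<boxplus> neg (t \<cdot> (r2 \<cdot> m)) = (p \<cdot> k1) \<cdot> (r1 \<cdot> m)"
        using a ma pa t by (simp add: Hom_def add_assoc No)
      moreover have "(p \<cdot> k1) \<cdot> (r1 \<cdot> m) \<in> J"
        by (rule J_I[OF Comp_in[OF m(1) H(5)] jI(2) Comp_in[OF H(3,2)]])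
      ultimately have "J.q (p \<cdot> m) = J.q (t \<cdot> (r2 \<cdot> m))"
        using J.coset_eq_iff[OF Comp_in[OF m(1) H(2)] Comp_in[OF r2m t]] by simp
      then have "J.q t \<odot> J.q (r2 \<cdot> m) = h"
        using J.Q_comp[OF r2m t] J.Q_comp[OF m(1) H(2)] m m' by simp
      then show ?thesis using J.Q_arr[OF r2m] by blast
    qed
    show "\<exists>v \<in> Hom J.Q N B. J.q b \<odot> v = h" if hh: "h \<in> Hom J.Q N A" "J.q t \<odot> h = Zero J.Q N D" for h
    proof -
      obtain h0 where h0: "h0 \<in> Hom C N A" "h = J.q h0" using hh(1) by (rule J.Q_Hom_E)
      have kh: "k2 \<cdot> h0 \<in> Hom C N P" by (rule Comp_in[OF h0(1) H(4)])
      have "J.q p \<odot> J.q (k2 \<cdot> h0) = J.q t \<odot> h"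
        using J.Q_comp[OF kh H(2)] J.Q_comp[OF h0(1) t] Comp_assoc[OF h0(1) H(4,2)]
        by (simp add: h0(2) t_def)
      then obtain v' where v': "v' \<in> Hom J.Q N B" "J.q i \<odot> v' = J.q (k2 \<cdot> h0)"
        using pD(10)[OF N J.Q_arr[OF kh]] hh(2) by auto
      \<comment> \<open>Since \<open>r2 \<cdot> i\<close> is \<open>b\<close>, a lift of
        \<open>k2 \<cdot> h0\<close> along \<open>i\<close> is also a lift of \<open>h0\<close>
        along \<open>b\<close>.\<close>
      have "J.q b \<odot> v' = J.q r2 \<odot> (J.q i \<odot> v')"
        using S.Comp_assoc[OF v'(1) J.Q_arr[OF H(1)] J.Q_arr[OF H(6)]] J.Q_comp[OF H(1,6)] r2i by simp
      also have "\<dots> = J.q (r2 \<cdot> (k2 \<cdot> h0))" unfolding v'(2) by (rule J.Q_comp[OF kh H(6)])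
      also have "r2 \<cdot> (k2 \<cdot> h0) = h0"
        using Comp_assoc[OF h0(1) H(4,6)] r2i Ident_left[OF h0(1)] by simp
      finally show ?thesis using v'(1) h0(2) by auto
    qed
  next
    fix Y x assume x: "x \<in> Hom J.Q A Y" "x \<odot> J.q b = Zero J.Q B Y"
    obtain x0 where x0: "x0 \<in> Hom C A Y" "x = J.q x0" using x(1) by (rule J.Q_Hom_E)
    have Y: "Y \<in> Obj C" using Hom_objs[OF x0(1)] by simp
    have xr: "x0 \<cdot> r2 \<in> Hom C P Y" by (rule Comp_in[OF H(6) x0(1)])
    \<comment> \<open>\<open>x0\<close> is extended to \<open>P\<close> by zero on \<open>I\<close>;
      on \<open>i\<close> the extension restricts to \<open>x0 \<cdot> b\<close>.\<close>
    have "J.q (x0 \<cdot> r2) \<odot> J.q i = Zero J.Q B Y"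
      using J.Q_comp[OF H(1) xr] Comp_assoc[OF H(1,6) x0(1)] r2i J.Q_comp[OF b(1) x0(1)] x(2) x0(2)
      by simp
    then obtain c where c: "c \<in> Hom J.Q D Y" "c \<odot> J.q p = J.q (x0 \<cdot> r2)"
      using S.cone_D(2)[OF cone J.Q_arr[OF xr]] by blast
    have "c \<odot> J.q t = (c \<odot> J.q p) \<odot> J.q k2"
      using S.Comp_assoc[OF J.Q_arr[OF H(4)] J.Q_arr[OF H(2)] c(1)] J.Q_comp[OF H(4,2)] t_def by simp
    also have "\<dots> = J.q (x0 \<cdot> (r2 \<cdot> k2))"
      unfolding c(2) J.Q_comp[OF H(4) xr] Comp_assoc[OF H(4,6) x0(1)] ..
    also have "\<dots> = x" using r2i Ident_right[OF x0(1)] x0(2) by simp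
    finally show "\<exists>c \<in> Hom J.Q D Y. c \<odot> J.q t = x" using c(1) by blast
  qed
  then show ?thesis using D b(2) by blast
qed

text \<open>\<open>K\<close> is the pullback of the approximation \<open>a : A \<rightarrow> X\<close> and a deflation from a projective, and
  \<open>B\<close> approximates \<open>K\<close>.\<close>

lemma presentation_exists:
  assumes X: "X \<in> Obj C"
  shows "\<exists>B A \<beta> a. S.presents B A \<beta> X a"
proof -
  obtain A a where A: "A \<in> M" "a \<in> Hom C A X"
    and appr: "\<And>N f. N \<in> M \<Longrightarrow> f \<in> Hom C N X \<Longrightarrow> \<exists>g \<in> Hom C N A. a \<cdot> g = f"
    using M_cfinite X unfolding contravariantly_finite_def by blast
  obtain p where p: "deflation C p" "Cod C p = X" "Dom C p \<in> injectives C"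
    using enough_projectives[OF X] unfolding projectives_eq_injectives by blast
  have "a \<in> Arr C" "Cod C a = Cod C p" using A p by (auto simp: Hom_def)
  then obtain k2 k1 where pb: "is_pullback C p a k2 k1" using deflation_pullback[OF p(1)] by blast
  define K where "K = Dom C k1"
  have k: "k1 \<in> Hom C K A" "k2 \<in> Hom C K (Dom C p)" "p \<cdot> k2 = a \<cdot> k1" and K: "K \<in> Obj C"
    using pb A Dom_in by (auto simp: is_pullback_def Hom_def K_def)
  have pa: "p \<in> Hom C (Dom C p) X" using p(2) deflation_arr[OF p(1)] by (simp add: Hom_def)
  have U: "\<exists>u \<in> Hom C T K. k1 \<cdot> u = t"
    if "s \<in> Hom C T (Dom C p)" "t \<in> Hom C T A" "p \<cdot> s = a \<cdot> t" for s t T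
  proof -
    have "Dom C a = A" "T \<in> Obj C" using A Hom_objs[OF that(1)] by (auto simp: Hom_def)
    then show ?thesis using pb that unfolding is_pullback_def K_def by blast
  qed
  obtain B b where B: "B \<in> M" "b \<in> Hom C B K"
    and apprK: "\<And>N f. N \<in> M \<Longrightarrow> f \<in> Hom C N K \<Longrightarrow> \<exists>g \<in> Hom C N B. b \<cdot> g = f"
    using M_cfinite K unfolding contravariantly_finite_def by blast
  have kb: "k1 \<cdot> b \<in> Hom C B A" by (rule Comp_in[OF B(2) k(1)])
  have "S.presents B A (J.q (k1 \<cdot> b)) X (J.q a)"
    unfolding S.presents_def
  proof (intro conjI ballI impI)
    show "B \<in> M" "A \<in> M" by fact+
    show "J.q (k1 \<cdot> b) \<in> Hom J.Q B A" "J.q a \<in> Hom J.Q A X" using J.Q_arr kb A by auto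
    \<comment> \<open>The pullback square reroutes the composite through the injective domain of
      \<open>p\<close>.\<close>
    have "a \<cdot> (k1 \<cdot> b) = p \<cdot> (k2 \<cdot> b)"
      unfolding Comp_assoc[OF B(2) k(1) A(2), symmetric] k(3)[symmetric]
      by (rule Comp_assoc[OF B(2) k(2) pa])
    then show "J.q a \<odot> J.q (k1 \<cdot> b) = Zero J.Q B X"
      using q_comp_zero_iff[OF kb A(2)] J_I[OF Comp_in[OF B(2) k(2)] p(3) pa] by simp
    fix N assume N: "N \<in> M"
    show "\<exists>h' \<in> Hom J.Q N A. J.q a \<odot> h' = h" if hh: "h \<in> Hom J.Q N X" for h
    proof -
      obtain h0 where h0: "h0 \<in> Hom C N X" "h = J.q h0" using hh by (rule J.Q_Hom_E)
      obtain g where g: "g \<in> Hom C N A" "a \<cdot> g = h0" using appr[OF N h0(1)] by blast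
      then show ?thesis using J.Q_comp[OF g(1) A(2)] J.Q_arr[OF g(1)] h0(2) by auto
    qed
    show "\<exists>v \<in> Hom J.Q N B. J.q (k1 \<cdot> b) \<odot> v = h"
      if hh: "h \<in> Hom J.Q N A" "J.q a \<odot> h = Zero J.Q N X" for h
    proof -
      obtain h0 where h0: "h0 \<in> Hom C N A" "h = J.q h0" using hh(1) by (rule J.Q_Hom_E)
      \<comment> \<open>Being in \<open>J\<close>, \<open>a \<cdot> h0\<close> lifts along
        \<open>p\<close>. The lift and \<open>h0\<close> define a map to the pullback
        \<open>K\<close>, which factors through the approximation \<open>b\<close>.\<close>
      have "a \<cdot> h0 \<in> J" using hh(2) q_comp_zero_iff[OF h0(1) A(2)] h0(2) by simp
      then obtain l where l: "l \<in> Hom C N (Dom C p)" "p \<cdot> l = a \<cdot> h0"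
        using J_lift[OF p(1), of "a \<cdot> h0" N] Comp_in[OF h0(1) A(2)] p(2) by auto
      obtain u where u: "u \<in> Hom C N K" "k1 \<cdot> u = h0" using U[OF l(1) h0(1) l(2)] by blast
      obtain v where v: "v \<in> Hom C N B" "b \<cdot> v = u" using apprK[OF N u(1)] by blast
      have "(k1 \<cdot> b) \<cdot> v = h0" using Comp_assoc[OF v(1) B(2) k(1)] v(2) u(2) by simp
      then show ?thesis using J.Q_comp[OF v(1) kb] J.Q_arr[OF v(1)] h0(2) by auto
    qed
  qed
  then show ?thesis by blast
qed

text \<open>By rigidity a morphism from \<open>N\<close> in \<open>M\<close> to \<open>U\<close>
  lifts along the deflation from an injective onto \<open>U\<close>. So every morphism from
  \<open>M\<close> to \<open>U\<close> is stably zero.\<close>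

lemma mho_ghost:
  assumes f: "f \<in> factoring C (mho C M)"
  shows "S.ghost (J.q f)"
proof -
  have fa: "f \<in> Hom C (Dom C f) (Cod C f)" using f by (simp add: factoring_def Hom_def)
  obtain U a b where U: "U \<in> mho C M" and a: "a \<in> Hom C (Dom C f) U" and b: "b \<in> Hom C U (Cod C f)"
    and fba: "f = b \<cdot> a"
    using f fa by (rule factoring_E)
  obtain i p where c: "(i, p) \<in> conflations C" "Dom C i \<in> M" "Cod C i \<in> injectives C" "Cod C p = U"
    using U by (auto simp: mho_def)
  note ca = conflation_arrs[OF c(1)]
  have pa: "p \<in> Hom C (Cod C i) U" using ca c by (simp add: Hom_def)
  show ?thesis
  proof (rule S.ghostI[OF J.Q_arr[OF fa]])
    fix N h assume N: "N \<in> M" and "h \<in> Hom J.Q N (Dom C f)"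
    then obtain h0 where h0: "h0 \<in> Hom C N (Dom C f)" "h = J.q h0" by (blast elim: J.Q_Hom_E)
    have ah: "a \<cdot> h0 \<in> Hom C N U" by (rule Comp_in[OF h0(1) a])
    obtain l where l: "l \<in> Hom C N (Cod C i)" "p \<cdot> l = a \<cdot> h0"
      using conflation_lift[OF c(1,2) N, of "a \<cdot> h0"] ah c(4) ca by auto
    have "f \<cdot> h0 = (b \<cdot> p) \<cdot> l"
      using Comp_assoc[OF l(1) pa b] l(2) Comp_assoc[OF h0(1) a b] fba by simp
    then have "f \<cdot> h0 \<in> J" using J_I[OF l(1) c(3) Comp_in[OF pa b]] by simp
    then show "J.q f \<odot> h = Zero J.Q N (Cod C f)" using q_comp_zero_iff[OF h0(1) fa] h0(2) by simp
  qed
qed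

text \<open>If \<open>f \<cdot> p\<close> factors through an inflation \<open>k\<close> of \<open>M\<^sub>0\<close> into an injective, then \<open>f\<close> factors through the
  cokernel of \<open>k \<cdot> i\<close>.\<close>

lemma ghost_mho:
  assumes X: "X \<in> pr C M" and f: "f \<in> Hom C X Y" and gh: "S.ghost (J.q f)"
  shows "f \<in> factoring C (mho C M)"
proof -
  obtain i p where c: "(i, p) \<in> conflations C" "Dom C i \<in> M" "Cod C i \<in> M" "Cod C p = X"
    using X by (auto simp: pr_def)
  note ca = conflation_arrs[OF c(1)]
  define B A where "B = Dom C i" and "A = Cod C i"
  have i: "i \<in> Hom C B A" and p: "p \<in> Hom C A X" and pi: "p \<cdot> i = Zero C B X"
    using ca c by (auto simp: Hom_def A_def B_def)
  have fp: "f \<cdot> p \<in> Hom C A Y" by (rule Comp_in[OF p f])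
  \<comment> \<open>The domain \<open>A\<close> of \<open>p\<close> lies in \<open>M\<close>, so the
    ghost \<open>f\<close> is stably zero on \<open>p\<close>.\<close>
  have "f \<cdot> p \<in> J"
    using S.ghost_comp[OF gh J.Q_arr[OF f] _ J.Q_arr[OF p]] q_comp_zero_iff[OF p f] c(3) A_def by simp
  moreover obtain k where k: "inflation C k" "k \<in> Hom C A (Cod C k)" "Cod C k \<in> injectives C"
    using Hom_objs[OF p] embed_injective by blast
  ultimately obtain b where b: "b \<in> Hom C (Cod C k) Y" "f \<cdot> p = b \<cdot> k"
    using J_factor[OF _ fp k(1,2)] by blast
  have ki: "k \<cdot> i \<in> Hom C B (Cod C k)" by (rule Comp_in[OF i k(2)])
  have "inflation C (k \<cdot> i)"
    by (rule inflation_Comp[OF _ k(1)]) (use c k(2) A_def in \<open>auto simp: inflation_def Hom_def\<close>)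
  then obtain r where r: "(k \<cdot> i, r) \<in> conflations C" by (auto simp: inflation_def)
  note ra = conflation_arrs[OF r]
  define U where "U = Cod C r"
  have rH: "r \<in> Hom C (Cod C k) U" and rki: "r \<cdot> (k \<cdot> i) = Zero C B U"
    using ra ki by (auto simp: Hom_def U_def)
  have "Dom C (k \<cdot> i) \<in> M" "Cod C (k \<cdot> i) \<in> injectives C"
    using ki k(3) c(2) by (auto simp: B_def Hom_def)
  then have U: "U \<in> mho C M" "U \<in> Obj C"
    using r Hom_objs[OF rH] unfolding mho_def U_def by blast+
  \<comment> \<open>Both factors come from cokernels: \<open>b\<close> descends along
    \<open>r\<close> to \<open>v\<close> out of \<open>U\<close>, and \<open>r \<cdot> k\<close>
    descends along \<open>p\<close> to \<open>w\<close> into \<open>U\<close>.\<close>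
  have "b \<cdot> (k \<cdot> i) = f \<cdot> (p \<cdot> i)"
    using Comp_assoc[OF i k(2) b(1)] Comp_assoc[OF i p f] b(2) by simp
  also have "\<dots> = Zero C B Y" unfolding pi using f Hom_objs[OF i] by (simp add: Hom_def)
  finally obtain v where v: "v \<in> Hom C U Y" "v \<cdot> r = b"
    using cokernel_descend[OF r, of b Y] b(1) ki by (auto simp: Hom_def U_def)
  have rk: "r \<cdot> k \<in> Hom C A U" by (rule Comp_in[OF k(2) rH])
  have "(r \<cdot> k) \<cdot> i = Zero C B U" using Comp_assoc[OF i k(2) rH] rki by simp
  then obtain w where w: "w \<in> Hom C X U" "w \<cdot> p = r \<cdot> k"
    using cokernel_descend[OF c(1), of "r \<cdot> k" U] rk c(4) A_def B_def by auto
  have "(v \<cdot> w) \<cdot> p = f \<cdot> p"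
    using Comp_assoc[OF p w(1) v(1)] w(2) Comp_assoc[OF k(2) rH v(1)] v(2) b(2) by simp
  then have "v \<cdot> w = f"
    using cokernel_epi[OF c(1), of "v \<cdot> w" Y f] Comp_in[OF w(1) v(1)] f c(4) by simp
  then show ?thesis using U v w f by (auto simp: factoring_def Hom_def)
qed

end

section \<open>The homotopy category\<close>

context category
begin

definition loc :: "'m set \<Rightarrow> 'm \<Rightarrow> 'o \<times> 'm step list set \<times> 'o" where
  "loc W f = zarr W (Dom C f) [Fwd f] (Cod C f)"

lemma loc_eq: "f \<in> Hom C X Y \<Longrightarrow> loc W f = zarr W X [Fwd f] Y"
  by (simp add: loc_def Hom_def)

lemma loc_Hom: "f \<in> Hom C X Y \<Longrightarrow> loc W f \<in> Hom (localization C W) X Y"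
  using localization_Hom[OF zigzag_Fwd] by (simp add: loc_eq)

lemma loc_comp:
  assumes "f \<in> Hom C X Y" "g \<in> Hom C Y Z"
  shows "loc W (g \<cdot> f) = loc W g \<cdot>\<^bsub>localization C W\<^esub> loc W f"
  using localization_comp[OF zigzag_Fwd[OF assms(1)] zigzag_Fwd[OF assms(2)], of W]
    zigzag_eq_Fwd_comp[OF assms, of W] loc_eq[OF assms(1)] loc_eq[OF assms(2)]
    loc_eq[OF Comp_in[OF assms]] by simp

lemma loc_ident: "X \<in> Obj C \<Longrightarrow> loc W (Ident C X) = Ident (localization C W) X"
  using zarr_eqI[OF zigzag_eq.ident] loc_eq[OF Ident_in] by simp

lemma loc_iso: "w \<in> W \<Longrightarrow> w \<in> Hom C X Y \<Longrightarrow> is_iso (localization C W) (loc W w)"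
  using is_iso_localization loc_eq by simp

end

section \<open>Weak equivalences, homotopy and morphisms killed by \<open>G\<close>\<close>

context rigid_subcategory
begin

abbreviation W :: "'m set" where "W \<equiv> weak_equivalences C M"
abbreviation L where "L \<equiv> localization C W"

lemma stable_sub_eq: "stable_cat C = J.Q" "stable_sub C M = S.CS"
  by (simp_all add: stable_cat_def stable_sub_def)

text \<open>\<open>G_functor\<close> on \<open>w\<close> unfolds to \<open>rmap\<close> for the
  identity encoding, whose invertibility is pointwise bijectivity.\<close>

lemma weq_iff:
  assumes w: "w \<in> Hom C X Y" shows "w \<in> W \<longleftrightarrow> S.S_equiv (J.q w)"
proof -
  have wa: "w \<in> Arr C" "Dom C w = X" "Cod C w = Y" using w by (auto simp: Hom_def)
  note qw = J.Q_arr[OF w]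
  have "on_arr (G_functor C M) w = S.rmap (J.q w)"
    unfolding S.rmap_eq[OF qw] G_functor_def module_arr_def
    by (simp add: wa stable_sub_eq G_obj_def rep_id)
      (simp add: representable_def)
  then have "w \<in> W \<longleftrightarrow> is_iso (module_cat TYPE('m set) S.CS) (S.rmap (J.q w))"
    using wa by (simp add: weak_equivalences_def stable_sub_eq)
  also have "\<dots> \<longleftrightarrow> S.S_equiv (J.q w)"
    using S.rmap_iso_iff[OF qw S.S_sub] S.Hom_D[OF qw] by (simp add: S.S_equiv_def)
  finally show ?thesis .
qed

lemma ghost_iff:
  assumes f: "f \<in> Hom C X Y"
  shows "S.ghost (J.q f) \<longleftrightarrow> (\<forall>N \<in> M. \<forall>h \<in> Hom C N X. f \<cdot> h \<in> J)"
proof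
  assume g: "S.ghost (J.q f)"
  show "\<forall>N \<in> M. \<forall>h \<in> Hom C N X. f \<cdot> h \<in> J"
    using S.ghost_comp[OF g J.Q_arr[OF f] _ J.Q_arr] q_comp_zero_iff[OF _ f] by blast
next
  assume a: "\<forall>N \<in> M. \<forall>h \<in> Hom C N X. f \<cdot> h \<in> J"
  show "S.ghost (J.q f)"
  proof (rule S.ghostI[OF J.Q_arr[OF f]])
    fix N h assume N: "N \<in> M" and "h \<in> Hom J.Q N X"
    then obtain h0 where h0: "h0 \<in> Hom C N X" "h = J.q h0" by (blast elim: J.Q_Hom_E)
    then show "J.q f \<odot> h = Zero J.Q N Y" using a N q_comp_zero_iff[OF h0(1) f] by simp
  qed
qed

lemma q_neg: "f \<in> Hom C X Y \<Longrightarrow> J.q (neg f) = S.neg (J.q f)"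
  by (rule S.neg_unique)
    (use J.Q_arr[of f X Y] J.Q_arr[OF neg_Hom, of f X Y] J.Q_add[OF _ neg_Hom, of f X Y f] in
      \<open>auto simp: Hom_def\<close>)

lemma ghost_diff:
  assumes f: "f \<in> Hom C X Y" and g: "g \<in> Hom C X Y"
  shows "S.ghost (J.q (f \<boxplus> neg g)) \<longleftrightarrow> S.ghost (J.q f \<boxplus>\<^bsub>J.Q\<^esub> S.neg (J.q g))"
  using J.Q_add[OF f neg_Hom[OF g]] q_neg[OF g] by simp

lemma mho_Obj: "U \<in> mho C M \<Longrightarrow> U \<in> Obj C"
  using conflation_arrs(2) Cod_in by (auto simp: mho_def)

text \<open>Adding a summand from \<open>mho C M\<close> is a weak equivalence, so \<open>Y \<oplus> U\<close> is a path object of \<open>Y\<close>.\<close>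

lemma mho_inclusion_weq:
  assumes U: "U \<in> mho C M" and bp: "is_biproduct C Y U B i1 i2 p1 p2"
  shows "i1 \<in> W"
proof -
  note a = biproduct_arrs[OF bp]
  have H: "i1 \<in> Hom C Y B" "i2 \<in> Hom C U B" "p1 \<in> Hom C B Y" "p2 \<in> Hom C B U"
    using a by (auto simp: Hom_def)
  have "i2 \<cdot> p2 \<in> factoring C (mho C M)" using U H a by (auto simp: factoring_def)
  then have gh: "\<forall>N \<in> M. \<forall>h \<in> Hom C N B. (i2 \<cdot> p2) \<cdot> h \<in> J"
    using mho_ghost ghost_iff[OF Comp_in[OF H(4,2)]] by blast
  have "S.S_equiv (J.q i1)"
  proof (rule S.S_equivI[OF J.Q_arr[OF H(1)]])
    fix N h assume N: "N \<in> M" and "h \<in> Hom J.Q N B"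
    then obtain h0 where h0: "h0 \<in> Hom C N B" "h = J.q h0" by (blast elim: J.Q_Hom_E)
    have ha: "h0 \<in> Arr C" "Dom C h0 = N" "Cod C h0 = B" using h0 by (auto simp: Hom_def)
    have ph: "p1 \<cdot> h0 \<in> Hom C N Y" by (rule Comp_in[OF h0(1) H(3)])
    \<comment> \<open>This is the error between \<open>h0\<close> and
      \<open>i1 \<cdot> (p1 \<cdot> h0)\<close>; it is stably zero because it passes through
      \<open>U\<close>.\<close>
    have "(i2 \<cdot> p2) \<cdot> h0 \<in> J" using gh N h0(1) by blast
    also have "(i2 \<cdot> p2) \<cdot> h0 = (i1 \<cdot> (p1 \<cdot> h0) \<boxplus> i2 \<cdot> (p2 \<cdot> h0)) \<boxplus> neg (i1 \<cdot> (p1 \<cdot> h0))"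
      using add_diff_cancel(2)[of "i2 \<cdot> (p2 \<cdot> h0)" "i1 \<cdot> (p1 \<cdot> h0)"]
        add_commute[of "i2 \<cdot> (p2 \<cdot> h0)" "i1 \<cdot> (p1 \<cdot> h0)"] a ha by (simp add: comp_assoc)
    also have "i1 \<cdot> (p1 \<cdot> h0) \<boxplus> i2 \<cdot> (p2 \<cdot> h0) = h0" by (rule biproduct_decomp(1)[OF bp ha(1,3)])
    finally have "J.q i1 \<odot> J.q (p1 \<cdot> h0) = h"
      using J.Q_comp[OF ph H(1)] J.coset_eq_iff[OF h0(1) Comp_in[OF ph H(1)]] h0(2) by simp
    then show "\<exists>h' \<in> Hom J.Q N Y. J.q i1 \<odot> h' = h" using J.Q_arr[OF ph] by blast
  next
    fix N h assume N: "N \<in> M" and h: "h \<in> Hom J.Q N Y" and z: "J.q i1 \<odot> h = Zero J.Q N B"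
    have "h = (J.q p1 \<odot> J.q i1) \<odot> h"
      using J.Q_comp[OF H(1,3)] biproduct_comp[OF bp] S.Ident_left[OF h] by simp
    also have "\<dots> = J.q p1 \<odot> Zero J.Q N B"
      using S.Comp_assoc[OF h J.Q_arr[OF H(1)] J.Q_arr[OF H(3)]] z by simp
    also have "\<dots> = Zero J.Q N Y"
      using J.Q_arr[OF H(3)] S.Hom_objs[OF h] S.comp_zero(1)[of "J.q p1" B N] by (auto simp: Hom_def)
    finally show "h = Zero J.Q N Y" .
  qed
  then show ?thesis using weq_iff[OF H(1)] by simp
qed

text \<open>Write f - g as \<open>b \<cdot> a\<close> through \<open>U\<close>. The path object is Y
  \<oplus> U: the second leg is the projection to \<open>Y\<close>, the first adds \<open>b\<close>
  of the \<open>U\<close>-coordinate, and the homotopy is the pair of \<open>g\<close> and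
  \<open>a\<close>.\<close>

lemma homotopic_of_mho:
  assumes f: "f \<in> Hom C X Y" and g: "g \<in> Hom C X Y" and fg: "f \<boxplus> neg g \<in> factoring C (mho C M)"
  shows "homotopic C W f g"
proof -
  note o = Hom_objs[OF f]
  obtain U a b where U: "U \<in> mho C M" and a: "a \<in> Hom C X U" and b: "b \<in> Hom C U Y"
    and ba: "f \<boxplus> neg g = b \<cdot> a"
    using fg add_Hom[OF f neg_Hom[OF g]] by (rule factoring_E)
  obtain B i1 i2 p1 p2 where bp: "is_biproduct C Y Y B i1 i2 p1 p2"
    using biproduct_exists o by blast
  obtain P k1 k2 r1 r2 where bp': "is_biproduct C Y U P k1 k2 r1 r2"
    using biproduct_exists[OF _ mho_Obj[OF U]] o by blast
  note A = biproduct_arrs[OF bp] biproduct_arrs[OF bp'] biproduct_comp[OF bp] biproduct_comp[OF bp']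
  have fa: "f \<in> Arr C" "Dom C f = X" "Cod C f = Y" "g \<in> Arr C" "Dom C g = X" "Cod C g = Y"
    "a \<in> Arr C" "Dom C a = X" "Cod C a = U" "b \<in> Arr C" "Dom C b = U" "Cod C b = Y"
    using f g a b by (auto simp: Hom_def)
  define \<Delta> where "\<Delta> = i1 \<cdot> (r1 \<boxplus> b \<cdot> r2) \<boxplus> i2 \<cdot> r1"
  define k where "k = k1 \<cdot> g \<boxplus> k2 \<cdot> a"
  have \<Delta>: "\<Delta> \<in> Hom C P B" using A fa by (simp add: \<Delta>_def Hom_def)
  have k: "k \<in> Hom C X P" using A fa by (simp add: k_def Hom_def)
  have \<Delta>k1: "\<Delta> \<cdot> k1 = i1 \<boxplus> i2" unfolding \<Delta>_def using A fa by (simp add: comp_assoc)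
  have p\<Delta>: "p1 \<cdot> \<Delta> = r1 \<boxplus> b \<cdot> r2" "p2 \<cdot> \<Delta> = r1" unfolding \<Delta>_def using A fa by simp_all
  have rk: "r1 \<cdot> k = g" "r2 \<cdot> k = a" unfolding k_def using A fa by simp_all
  have ka: "k \<in> Arr C" "Dom C k = X" "Cod C k = P" using k by (auto simp: Hom_def)
  have "(p1 \<cdot> \<Delta>) \<cdot> k = g \<boxplus> b \<cdot> a" unfolding p\<Delta> using A fa ka rk by (simp add: comp_assoc)
  also have "\<dots> = f" unfolding ba[symmetric] using fa add_commute[of g "f \<boxplus> neg g"]
      add_diff_cancel(1)[of f g] by simp
  finally have 1: "(p1 \<cdot> \<Delta>) \<cdot> k = f" .
  have 2: "(p2 \<cdot> \<Delta>) \<cdot> k = g" unfolding p\<Delta> by (rule rk)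
  have po: "path_object C W Y P k1 B i1 i2 p1 p2 \<Delta>"
    unfolding path_object_def using bp mho_inclusion_weq[OF U bp'] \<Delta> \<Delta>k1 A by (simp add: Hom_def)
  show ?thesis
    unfolding homotopic_def fa
    by (intro conjI HOL.refl fa(1,4)) (intro exI conjI bexI, rule po, rule 1, rule 2, rule k)
qed

text \<open>All that is used of a homotopy: two retractions of one weak equivalence and a morphism
  \<open>k\<close> on which they take the values \<open>f\<close> and \<open>g\<close>.\<close>

lemma homotopic_E:
  assumes f: "f \<in> Hom C X Y" and hom: "homotopic C W f g"
  obtains Y' s k D1 D2 where "s \<in> W" "s \<in> Hom C Y Y'" "k \<in> Hom C X Y'" "D1 \<in> Hom C Y' Y" "D2 \<in> Hom C Y' Y"
    "D1 \<cdot> s = Ident C Y" "D2 \<cdot> s = Ident C Y" "D1 \<cdot> k = f" "D2 \<cdot> k = g"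
proof -
  have fa: "Dom C f = X" "Cod C f = Y" using f by (auto simp: Hom_def)
  obtain Y' s B i1 i2 p1 p2 \<Delta> k where po: "path_object C W Y Y' s B i1 i2 p1 p2 \<Delta>"
    and k: "k \<in> Hom C X Y'" "(p1 \<cdot> \<Delta>) \<cdot> k = f" "(p2 \<cdot> \<Delta>) \<cdot> k = g"
    using hom unfolding homotopic_def fa by blast
  have bp: "is_biproduct C Y Y B i1 i2 p1 p2" and s: "s \<in> W" "s \<in> Hom C Y Y'"
    and \<Delta>: "\<Delta> \<in> Hom C Y' B" "\<Delta> \<cdot> s = i1 \<boxplus> i2"
    using po by (auto simp: path_object_def)
  note A = biproduct_arrs[OF bp] biproduct_comp[OF bp]
  have p: "p1 \<in> Hom C B Y" "p2 \<in> Hom C B Y" using A by (auto simp: Hom_def)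
  have "(p1 \<cdot> \<Delta>) \<cdot> s = p1 \<cdot> (i1 \<boxplus> i2)" "(p2 \<cdot> \<Delta>) \<cdot> s = p2 \<cdot> (i1 \<boxplus> i2)"
    unfolding \<Delta>(2)[symmetric] by (rule Comp_assoc[OF s(2) \<Delta>(1)], fact p)+
  then have "(p1 \<cdot> \<Delta>) \<cdot> s = Ident C Y" "(p2 \<cdot> \<Delta>) \<cdot> s = Ident C Y"
    using A by simp_all
  then show ?thesis
    using that[OF s k(1) Comp_in[OF \<Delta>(1) p(1)] Comp_in[OF \<Delta>(1) p(2)]] k by blast
qed

text \<open>Every stable morphism from \<open>M\<close> to \<open>Y'\<close> factors through
  \<open>s\<close>, on which \<open>D1\<close> and \<open>D2\<close> agree. This holds for arbitrary
  \<open>X\<close>.\<close>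

lemma ghost_of_homotopic:
  assumes f: "f \<in> Hom C X Y" and g: "g \<in> Hom C X Y" and hom: "homotopic C W f g"
  shows "S.ghost (J.q (f \<boxplus> neg g))"
proof -
  obtain Y' s k D1 D2 where s: "s \<in> W" "s \<in> Hom C Y Y'" and k: "k \<in> Hom C X Y'"
    and D: "D1 \<in> Hom C Y' Y" "D2 \<in> Hom C Y' Y" and Ds: "D1 \<cdot> s = Ident C Y" "D2 \<cdot> s = Ident C Y"
    and Dk: "D1 \<cdot> k = f" "D2 \<cdot> k = g"
    using f hom by (rule homotopic_E)
  have "J.q f \<odot> h = J.q g \<odot> h" if N: "N \<in> M" and h: "h \<in> Hom J.Q N X" for N h
  proof -
    note qk = J.Q_arr[OF k] and qs = J.Q_arr[OF s(2)]
    obtain h' where h': "h' \<in> Hom J.Q N Y" "J.q s \<odot> h' = J.q k \<odot> h"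
      using S.S_equiv_D(1)[OF _ qs N S.Comp_in[OF h qk]] s weq_iff by blast
    have "J.q (D \<cdot> k) \<odot> h = h'" if D: "D \<in> Hom C Y' Y" "D \<cdot> s = Ident C Y" for D
    proof -
      have "J.q (D \<cdot> k) \<odot> h = J.q D \<odot> (J.q s \<odot> h')"
        using J.Q_comp[OF k D(1)] S.Comp_assoc[OF h qk J.Q_arr[OF D(1)]] h'(2) by simp
      also have "\<dots> = h'"
        using S.Comp_assoc[OF h'(1) qs J.Q_arr[OF D(1)], symmetric] J.Q_comp[OF s(2) D(1)] D(2)
          S.Ident_left[OF h'(1)] by simp
      finally show ?thesis .
    qed
    then show ?thesis using D Ds Dk by metis
  qed
  then show ?thesis
    using S.ghost_diff_iff[OF J.Q_arr[OF f] J.Q_arr[OF g]] ghost_diff[OF f g] by blast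
qed

text \<open>\<open>s\<close> is invertible in the localization, so its two retractions become equal
  there.\<close>

lemma loc_of_homotopic:
  assumes f: "f \<in> Hom C X Y" and hom: "homotopic C W f g"
  shows "loc W f = loc W g"
proof -
  interpret L: category L by (rule category_localization)
  obtain Y' s k D1 D2 where s: "s \<in> W" "s \<in> Hom C Y Y'" and k: "k \<in> Hom C X Y'"
    and D: "D1 \<in> Hom C Y' Y" "D2 \<in> Hom C Y' Y" and Ds: "D1 \<cdot> s = Ident C Y" "D2 \<cdot> s = Ident C Y"
    and Dk: "D1 \<cdot> k = f" "D2 \<cdot> k = g"
    using f hom by (rule homotopic_E)
  have "loc W D1 = loc W D2"
    by (rule L.iso_cancel_right[OF loc_iso[OF s] loc_Hom[OF s(2)] loc_Hom[OF D(1)] loc_Hom[OF D(2)]])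
      (simp add: loc_comp[OF s(2) D(1), symmetric] loc_comp[OF s(2) D(2), symmetric] Ds)
  then show ?thesis using loc_comp[OF k D(1)] loc_comp[OF k D(2)] Dk by simp
qed

text \<open>A circle of implications: factoring gives homotopic, homotopic gives ghost, ghost gives
  factoring. The last one uses the conflation that puts \<open>X\<close> in
  \<open>pr C M\<close>.\<close>

lemma homotopic_iff_mho:
  assumes "X \<in> pr C M" and f: "f \<in> Hom C X Y" and g: "g \<in> Hom C X Y"
  shows "homotopic C W f g \<longleftrightarrow> f \<boxplus> neg g \<in> factoring C (mho C M)"
  using homotopic_of_mho[OF f g] ghost_of_homotopic[OF f g]
    ghost_mho[OF assms(1) add_Hom[OF f neg_Hom[OF g]]] by blast

lemma loc_of_ghost:
  assumes "X \<in> pr C M" and f: "f \<in> Hom C X Y" and g: "g \<in> Hom C X Y"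
    and gh: "S.ghost (J.q (f \<boxplus> neg g))"
  shows "loc W f = loc W g"
  using ghost_mho[OF assms(1) add_Hom[OF f neg_Hom[OF g]] gh] homotopic_of_mho[OF f g]
    loc_of_homotopic[OF f] by blast

text \<open>Removing the last step keeps the source \<open>X\<close>, whose cone lets morphisms lift
  along weak equivalences. A backward step is absorbed by \<open>lift_S_equiv\<close>, and its ghost
  error disappears in the localization by \<open>loc_of_ghost\<close>.\<close>

lemma loc_full:
  assumes X: "X \<in> pr C M"
  shows "zigzag C W X p Y \<Longrightarrow> \<exists>f \<in> Hom C X Y. zarr W X p Y = loc W f"
proof (induction p arbitrary: Y rule: rev_induct)
  case Nil
  then show ?case using loc_ident[of X W] Ident_in[of X] by (auto intro!: bexI[of _ "Ident C X"])
next
  case (snoc s p)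
  interpret L: category L by (rule category_localization)
  obtain Z where p: "zigzag C W X p Z" and s: "zigzag C W Z [s] Y"
    using snoc.prems unfolding zigzag_append by blast
  obtain f where f: "f \<in> Hom C X Z" "zarr W X p Z = loc W f" using snoc.IH[OF p] by blast
  have comp: "zarr W X (p @ [s]) Y = zarr W Z [s] Y \<cdot>\<^bsub>L\<^esub> loc W f"
    using localization_comp[OF p s] f(2) by simp
  show ?case
  proof (cases s)
    case (Fwd g)
    then have g: "g \<in> Hom C Z Y" using s by simp
    have "zarr W X (p @ [s]) Y = loc W (g \<cdot> f)"
      unfolding comp unfolding Fwd loc_comp[OF f(1) g] loc_eq[OF g] ..
    then show ?thesis using Comp_in[OF f(1) g] by blast
  next
    case (Bwd w)
    then have w: "w \<in> W" "w \<in> Hom C Y Z" using s by auto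
    obtain B A \<beta> t where c: "S.cone B A \<beta> X t" using pr_cone[OF X] by blast
    obtain f'' where f'': "f'' \<in> Hom J.Q X Y" "S.ghost (J.q f \<boxplus>\<^bsub>J.Q\<^esub> S.neg (J.q w \<odot> f''))"
      using S.lift_S_equiv[OF c _ J.Q_arr[OF w(2)] J.Q_arr[OF f(1)]] w weq_iff by blast
    obtain f' where f': "f' \<in> Hom C X Y" "f'' = J.q f'" using f''(1) by (rule J.Q_Hom_E)
    have wf: "w \<cdot> f' \<in> Hom C X Z" by (rule Comp_in[OF f'(1) w(2)])
    have "loc W f = loc W (w \<cdot> f')"
      by (rule loc_of_ghost[OF X f(1) wf])
        (use f''(2) f'(2) J.Q_comp[OF f'(1) w(2)] ghost_diff[OF f(1) wf] in simp)
    then have "zarr W X (p @ [s]) Y = zarr W Z [Bwd w] Y \<cdot>\<^bsub>L\<^esub> (loc W w \<cdot>\<^bsub>L\<^esub> loc W f')"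
      unfolding comp unfolding Bwd using loc_comp[OF f'(1) w(2)] by simp
    also have "\<dots> = (zarr W Z [Bwd w] Y \<cdot>\<^bsub>L\<^esub> loc W w) \<cdot>\<^bsub>L\<^esub> loc W f'"
      using L.Comp_assoc[OF loc_Hom[OF f'(1)] loc_Hom[OF w(2)] localization_Hom[OF zigzag_Bwd[OF w]]]
      by simp
    also have "zarr W Z [Bwd w] Y \<cdot>\<^bsub>L\<^esub> loc W w = Ident L Y"
      using localization_comp[OF zigzag_Fwd[OF w(2)] zigzag_Bwd[OF w]]
        zarr_eqI[OF zigzag_eq.Fwd_Bwd[OF w]] loc_eq[OF w(2)] by simp
    also have "Ident L Y \<cdot>\<^bsub>L\<^esub> loc W f' = loc W f'" by (rule L.Ident_left[OF loc_Hom[OF f'(1)]])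
    finally show ?thesis using f'(1) by blast
  qed
qed

text \<open>A cofibrant replacement: the \<open>\<beta>\<close> that presents \<open>Y\<close> also
  has a cone \<open>X\<close> in \<open>pr C M\<close>, and the comparison from \<open>X\<close> to
  \<open>Y\<close> is a weak equivalence.\<close>

lemma pr_approximation:
  assumes Y: "Y \<in> Obj C"
  shows "\<exists>X \<in> pr C M. \<exists>w \<in> Hom C X Y. w \<in> W"
proof -
  obtain B A \<beta> a where p: "S.presents B A \<beta> Y a" using presentation_exists[OF Y] by blast
  obtain X t where X: "X \<in> pr C M" and c: "S.cone B A \<beta> X t"
    using cone_exists[OF S.presents_D(2,1,3)[OF p]] by blast
  obtain w' where w': "w' \<in> Hom J.Q X Y" "S.S_equiv w'" using S.cone_approximates[OF c p] by blast
  obtain w where "w \<in> Hom C X Y" "w' = J.q w" using w'(1) by (rule J.Q_Hom_E)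
  then show ?thesis using X w' weq_iff by blast
qed

section \<open>The ideal of morphisms of \<open>pr M\<close> factoring through
  \<open>mho M\<close>\<close>

abbreviation PC where "PC \<equiv> full_sub C (pr C M)"
abbreviation mho_ideal :: "'m set" where "mho_ideal \<equiv> factoring C (mho C M)"

lemma PC_Hom: "f \<in> Hom PC X Y \<longleftrightarrow> X \<in> pr C M \<and> Y \<in> pr C M \<and> f \<in> Hom C X Y"
  by (auto simp: Hom_full_sub)

text \<open>Out of \<open>pr C M\<close> the ideal consists of the ghosts. The ideal axioms are read
  off this pointwise description instead of from direct sums in \<open>mho C M\<close>.\<close>

lemma mho_iff:
  assumes "X \<in> pr C M" "f \<in> Hom C X Y"
  shows "f \<in> mho_ideal \<longleftrightarrow> (\<forall>N \<in> M. \<forall>h \<in> Hom C N X. f \<cdot> h \<in> J)"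
  using ghost_iff[OF assms(2)] mho_ghost ghost_mho[OF assms] by blast

text \<open>\<open>neg\<close> is formed in the Hom groups of the given category; those of
  \<open>PC\<close> and \<open>C\<close> agree at objects of \<open>pr C M\<close>.\<close>

lemma PC_neg: "f \<in> Hom PC X Y \<Longrightarrow> preadditive_category.neg PC f = neg f"
  unfolding preadditive_category.neg_def[OF preadditive_full_sub] neg_def
  by (auto simp: PC_Hom Hom_def homgrp_full_sub)

lemma ideal_mho: "ideal PC mho_ideal"
proof (rule ideal.intro[OF preadditive_full_sub], unfold ideal_axioms_def, intro conjI allI impI)
  fix X Y assume "X \<in> Obj PC" "Y \<in> Obj PC"
  then have X: "X \<in> pr C M" "X \<in> Obj C" "Y \<in> Obj C" by auto
  show "Zero PC X Y \<in> mho_ideal"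
    using mho_iff[OF X(1) zero_Hom[OF X(2,3)]] X M_sub
    by (auto simp: Hom_def J.zero_J)
next
  fix f X Y g assume f: "f \<in> Hom PC X Y" "f \<in> mho_ideal" and g: "g \<in> Hom PC X Y" "g \<in> mho_ideal"
  have X: "X \<in> pr C M" and f0: "f \<in> Hom C X Y" and g0: "g \<in> Hom C X Y" using f g PC_Hom by auto
  have "(f \<boxplus> neg g) \<cdot> h \<in> J" if N: "N \<in> M" and h: "h \<in> Hom C N X" for N h
  proof -
    have "(f \<boxplus> neg g) \<cdot> h = f \<cdot> h \<boxplus> neg (g \<cdot> h)" using f0 g0 h by (simp add: Hom_def)
    then show ?thesis
      using mho_iff[OF X f0] mho_iff[OF X g0] f(2) g(2) N h
        J.diff_J[OF Comp_in[OF h f0] Comp_in[OF h g0]] by simp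
  qed
  then show "f \<boxplus>\<^bsub>PC\<^esub> preadditive_category.neg PC g \<in> mho_ideal"
    using mho_iff[OF X add_Hom[OF f0 neg_Hom[OF g0]]] PC_neg[OF g(1)] by simp
next
  fix f X Y g Z assume "f \<in> Hom PC X Y" and "g \<in> Hom PC Y Z"
  then have X: "X \<in> pr C M" "Y \<in> pr C M" and f: "f \<in> Hom C X Y" and g: "g \<in> Hom C Y Z"
    by (auto simp: PC_Hom)
  note iff = mho_iff[OF X(1) Comp_in[OF f g]]
  have assoc: "(g \<cdot> f) \<cdot> h = g \<cdot> (f \<cdot> h)" if "h \<in> Hom C N X" for N h by (rule Comp_assoc[OF that f g])
  show "g \<cdot>\<^bsub>PC\<^esub> f \<in> mho_ideal" if "f \<in> mho_ideal"
    using that mho_iff[OF X(1) f] iff assoc J.comp_J_left[OF Comp_in[OF _ f] g] by simp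
  show "g \<cdot>\<^bsub>PC\<^esub> f \<in> mho_ideal" if "g \<in> mho_ideal"
    using that mho_iff[OF X(2) g] iff assoc Comp_in[OF _ f] by simp
qed

end

text \<open>A coset is encoded by the image under the injection \<open>\<iota>\<close> of a chosen representative.\<close>

locale rigid_encoded = rigid_subcategory C M
  for C :: "('o, 'm, 'x) excat_scheme" (structure) and M :: "'o set" +
  fixes \<iota> :: "'m \<Rightarrow> 'g"
  assumes inj_\<iota>: "inj \<iota>"
begin

definition enc :: "'m set \<Rightarrow> 'g" where "enc c = \<iota> (SOME f. f \<in> c)"
definition dec :: "'g \<Rightarrow> 'm set" where "dec x = J.q (inv_into UNIV \<iota> x)"

lemma dec_enc: "c \<in> Arr J.Q \<Longrightarrow> dec (enc c) = c"
proof -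
  assume "c \<in> Arr J.Q"
  then obtain f where f: "f \<in> Hom C (Dom J.Q c) (Cod J.Q c)" "c = J.q f"
    using S.Hom_I by (blast elim: J.Q_Hom_E)
  then have "(SOME f. f \<in> c) \<in> J.q f" using J.self_in_coset[OF f(1)] by (metis someI)
  then show ?thesis using J.coset_eq_D[OF f(1)] f(2) inj_\<iota> by (simp add: enc_def dec_def)
qed

text \<open>The second instance, for modules carried by 'g. Notions such as \<open>cone\<close> do
  not mention the encoding, so facts obtained through \<open>S\<close> apply here.\<close>

sublocale E: encoded_sub J.Q M enc dec
  by (simp add: encoded_sub_def encoded_sub_axioms_def encoded_def encoded_axioms_def
    J.preadditive_Q M_sub dec_enc)

abbreviation Mod where "Mod \<equiv> module_cat TYPE('g) S.CS"
abbreviation FP where "FP \<equiv> fp_module_cat TYPE('g) S.CS"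

lemma FP_Hom: "c \<in> Hom FP F F' \<longleftrightarrow>
    finitely_presented S.CS F \<and> finitely_presented S.CS F' \<and> c \<in> Hom Mod F F'"
  by (auto simp: fp_module_cat_def Hom_full_sub)

text \<open>Presentations exist for all objects by contravariant finiteness, so \<open>G\<close>
  takes values in finitely presented modules on all of \<open>C\<close>.\<close>

lemma rep_fp: "X \<in> Obj C \<Longrightarrow> finitely_presented S.CS (E.R X)"
  using presentation_exists E.fp_of_presentation by blast

text \<open>The copy of \<open>G_functor\<close> whose groups are carried by 'g.\<close>

definition G where "G = \<lparr>on_obj = E.R, on_arr = (\<lambda>f. E.rmap (J.q f))\<rparr>"

lemma G_functorial: "is_functor C FP G"
  unfolding is_functor_def G_def cat_functor.simps
proof (intro conjI ballI)
  fix X assume X: "X \<in> Obj C"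
  show "E.R X \<in> Obj FP" using rep_fp[OF X] by (simp add: fp_module_cat_def finitely_presented_def)
  show "E.rmap (J.q (Ident C X)) = Ident FP (E.R X)"
    using E.rmap_ident[of X "TYPE('g)"] X by (simp add: fp_module_cat_def)
next
  fix X Y f assume "X \<in> Obj C" "Y \<in> Obj C" "f \<in> Hom C X Y"
  then show "E.rmap (J.q f) \<in> Hom FP (E.R X) (E.R Y)"
    using rep_fp E.rmap_Hom[OF J.Q_arr] by (simp add: FP_Hom)
next
  fix X Y Z f g assume f: "f \<in> Hom C X Y" and g: "g \<in> Hom C Y Z"
  show "E.rmap (J.q (g \<cdot> f)) = E.rmap (J.q g) \<cdot>\<^bsub>FP\<^esub> E.rmap (J.q f)"
    using E.rmap_comp[OF J.Q_arr[OF f] J.Q_arr[OF g], of "TYPE('g)"] J.Q_comp[OF f g]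
    by (simp add: fp_module_cat_def)
qed

lemma FP_iso:
  assumes "is_iso Mod c" "c \<in> Hom FP F F'" shows "is_iso FP c"
proof -
  interpret Mod: category Mod by (rule S.CS.category_module_cat)
  have "finitely_presented S.CS (Dom Mod c)" "finitely_presented S.CS (Cod Mod c)"
    using assms(2) by (auto simp: FP_Hom Mod.Hom_D)
  then show ?thesis
    unfolding fp_module_cat_def using assms(1) by (intro Mod.is_iso_full_sub) auto
qed

lemma category_FP: "category FP"
  unfolding fp_module_cat_def
  by (rule category.category_full_sub[OF S.CS.category_module_cat])

text \<open>\<open>W\<close> is defined by modules over another carrier type, but both encodings
  reduce invertibility to the same bijectivity on Hom sets.\<close>

lemma G_inverts:
  assumes "w \<in> W" "w \<in> Arr C" shows "is_iso FP (on_arr G w)"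
proof -
  have w: "w \<in> Hom C (Dom C w) (Cod C w)" using assms by (simp add: Hom_def)
  note qw = J.Q_arr[OF w]
  have "is_iso Mod (E.rmap (J.q w))"
    using weq_iff[OF w] assms(1) E.rmap_iso_iff[OF qw S.S_sub] S.Hom_D[OF qw]
    by (simp add: S.S_equiv_def)
  then show ?thesis
    using FP_iso[OF _ functor_hom[OF G_functorial w]] by (simp add: G_def)
qed

sublocale G: inverting_functor C FP W G
  by (intro inverting_functor.intro inverting_functor_axioms.intro category_FP G_functorial G_inverts)
    unfold_locales

text \<open>The choice of a member is immaterial: members of one coset are homotopic, hence equal in
  the localization.\<close>

definition F where "F = \<lparr>on_obj = (\<lambda>X. X), on_arr = (\<lambda>c. loc W (SOME f. f \<in> c))\<rparr>"

lemma equivalences: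
  "\<exists>F. is_equivalence (pr_mod_mho C M) L F" "\<exists>H. is_equivalence L FP H"
proof -
  interpret P: ideal PC mho_ideal by (rule ideal_mho)
  define H where "H = localization_lift C FP G"
  have F_eq: "on_arr F (P.q f) = loc W f" if f: "f \<in> Hom PC X Y" for X Y f
  proof -
    have "(SOME g. g \<in> P.q f) \<in> P.q f" using P.self_in_coset[OF f] by (rule someI)
    then have g: "(SOME g. g \<in> P.q f) \<in> Hom PC X Y" "(SOME g. g \<in> P.q f) \<boxplus> P.neg f \<in> mho_ideal"
      using P.mem_coset[OF f] by auto
    have X: "X \<in> pr C M" and f0: "f \<in> Hom C X Y" using f PC_Hom by auto
    have g0: "(SOME g. g \<in> P.q f) \<in> Hom C X Y" using g(1) PC_Hom by auto
    have "homotopic C W (SOME g. g \<in> P.q f) f"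
      using g(2) PC_neg[OF f] homotopic_of_mho[OF g0 f0] by simp
    then show ?thesis using loc_of_homotopic[OF g0] by (simp add: F_def)
  qed
  have F: "is_functor P.Q L F"
    unfolding is_functor_def
  proof (intro conjI ballI)
    fix X assume "X \<in> Obj P.Q"
    then have X: "X \<in> Obj PC" "X \<in> Obj C" by auto
    show "on_obj F X \<in> Obj L" using X by (simp add: F_def)
    show "on_arr F (Ident P.Q X) = Ident L (on_obj F X)"
      using F_eq[OF P.Ident_in[OF X(1)]] loc_ident[OF X(2), of W] by (simp add: F_def)
  next
    fix X Y c assume "c \<in> Hom P.Q X Y"
    then obtain f where f: "f \<in> Hom PC X Y" "c = P.q f" by (rule P.Q_Hom_E)
    then show "on_arr F c \<in> Hom L (on_obj F X) (on_obj F Y)"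
      using F_eq[OF f(1)] loc_Hom[of f X Y W] PC_Hom by (simp add: F_def)
  next
    fix X Y Z c d assume c: "c \<in> Hom P.Q X Y" and d: "d \<in> Hom P.Q Y Z"
    obtain f where f: "f \<in> Hom PC X Y" "c = P.q f" using c by (rule P.Q_Hom_E)
    obtain g where g: "g \<in> Hom PC Y Z" "d = P.q g" using d by (rule P.Q_Hom_E)
    show "on_arr F (d \<cdot>\<^bsub>P.Q\<^esub> c) = on_arr F d \<cdot>\<^bsub>L\<^esub> on_arr F c"
      unfolding f(2) g(2) P.Q_comp[OF f(1) g(1)] F_eq[OF P.Comp_in[OF f(1) g(1)]] F_eq[OF f(1)]
        F_eq[OF g(1)]
      using loc_comp[of f X Y g Z W] f(1) g(1) unfolding PC_Hom by simp
  qed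
  have F_obj: "on_obj F X = X" "on_obj H X = E.R X" for X by (simp_all add: F_def H_def) (simp add: G_def)
  \<comment> \<open>On \<open>pr C M\<close> the composite of \<open>F\<close> and \<open>H\<close>
    is \<open>G\<close>, so equality of images becomes equality of natural maps.\<close>
  have HF: "on_arr H (on_arr F (P.q f)) = E.rmap (J.q f)" if f: "f \<in> Hom PC X Y" for X Y f
  proof -
    have f0: "f \<in> Hom C X Y" using f PC_Hom by auto
    show ?thesis
      unfolding F_eq[OF f] H_def loc_eq[OF f0] G.lift_zarr[OF zigzag_Fwd[OF f0]] G.zeval_Fwd[OF f0]
      by (simp add: G_def)
  qed
  have F_full: "\<exists>c \<in> Hom P.Q X Y. on_arr F c = g"
    if XY: "X \<in> Obj P.Q" "Y \<in> Obj P.Q" and g: "g \<in> Hom L (on_obj F X) (on_obj F Y)" for X Y g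
  proof -
    have X: "X \<in> pr C M" "Y \<in> pr C M" using XY by auto
    have "g \<in> Hom L X Y" using g F_obj by simp
    then obtain p where p: "zigzag C W X p Y" "g = zarr W X p Y" by (rule localization_Hom_E)
    obtain f where f: "f \<in> Hom C X Y" "g = loc W f" using loc_full[OF X(1) p(1)] p(2) by auto
    then have "f \<in> Hom PC X Y" using X by (simp add: PC_Hom)
    then show ?thesis using F_eq P.Q_arr f(2) by blast
  qed
  have F_ess: "\<exists>X \<in> Obj P.Q. \<exists>f \<in> Hom L (on_obj F X) Y. is_iso L f" if "Y \<in> Obj L" for Y
  proof -
    have Y: "Y \<in> Obj C" using that by simp
    obtain X w where X: "X \<in> pr C M" and w: "w \<in> Hom C X Y" "w \<in> W"
      using pr_approximation[OF Y] by blast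
    then show ?thesis using loc_iso[OF w(2,1)] loc_Hom[OF w(1), of W] F_obj pr_Obj[OF X] by auto
  qed
  \<comment> \<open>Equal images mean that \<open>f\<close> and \<open>g\<close> agree on all stable
    morphisms from \<open>M\<close>, so their difference is a ghost out of \<open>X\<close> and
    \<open>ghost_mho\<close> applies.\<close>
  have faithful: "c = d" if c: "c \<in> Hom P.Q X Y" and d: "d \<in> Hom P.Q X Y"
    and eq: "on_arr H (on_arr F c) = on_arr H (on_arr F d)" for X Y c d
  proof -
    obtain f where f: "f \<in> Hom PC X Y" "c = P.q f" using c by (rule P.Q_Hom_E)
    obtain g where g: "g \<in> Hom PC X Y" "d = P.q g" using d by (rule P.Q_Hom_E)
    have X: "X \<in> pr C M" and f0: "f \<in> Hom C X Y" and g0: "g \<in> Hom C X Y"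
      using f g PC_Hom by auto
    note qf = J.Q_arr[OF f0] and qg = J.Q_arr[OF g0]
    have "E.rmap (J.q f) = E.rmap (J.q g)" using eq unfolding f(2) g(2) HF[OF f(1)] HF[OF g(1)] .
    then have *: "\<forall>N \<in> Obj S.CS. \<forall>x \<in> carrier (Sect (E.R X) N).
        enc (J.q f \<odot> dec x) = enc (J.q g \<odot> dec x)"
      unfolding E.rmap_eq[OF qf] E.rmap_eq[OF qg] module_arr_eq_iff .
    have "J.q f \<odot> h = J.q g \<odot> h" if N: "N \<in> M" and h: "h \<in> Hom J.Q N X" for N h
    proof -
      have "N \<in> Obj S.CS" "enc h \<in> carrier (Sect (E.R X) N)" using N h M_sub by auto
      with * have "enc (J.q f \<odot> dec (enc h)) = enc (J.q g \<odot> dec (enc h))" by blast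
      then show ?thesis
        using E.encode_eq[OF S.Comp_in[OF h qf] S.Comp_in[OF h qg]] E.decode_Hom[OF h] by simp
    qed
    then have "S.ghost (J.q (f \<boxplus> neg g))"
      using S.ghost_diff_iff[OF qf qg] ghost_diff[OF f0 g0] by blast
    then have "f \<boxplus> neg g \<in> mho_ideal" by (rule ghost_mho[OF X add_Hom[OF f0 neg_Hom[OF g0]]])
    then show "c = d" using P.coset_eq_iff[OF f(1) g(1)] PC_neg[OF g(1)] f(2) g(2) by simp
  qed
  have full: "\<exists>c \<in> Hom P.Q X Y. on_arr H (on_arr F c) = g"
    if XY: "X \<in> Obj P.Q" "Y \<in> Obj P.Q"
      and g: "g \<in> Hom FP (on_obj H (on_obj F X)) (on_obj H (on_obj F Y))" for X Y g
  proof -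
    have X: "X \<in> pr C M" "Y \<in> pr C M" using XY by auto
    have "g \<in> Hom Mod (E.R X) (E.R Y)" using g F_obj by (simp add: FP_Hom)
    then obtain \<eta> where \<eta>: "natural_map S.CS (E.R X) (E.R Y) \<eta>"
      "g = module_arr S.CS (E.R X) \<eta> (E.R Y)" by (rule S.CS.module_Hom_E)
    obtain B A \<beta> t where c: "S.cone B A \<beta> X t" using pr_cone[OF X(1)] by blast
    obtain f' where f': "f' \<in> Hom J.Q X Y" "g = E.rmap f'"
      using E.natural_map_of_cone[OF c \<eta>(1)] \<eta>(2) pr_Obj[OF X(2)] by auto
    obtain f where f: "f \<in> Hom C X Y" "f' = J.q f" using f'(1) by (rule J.Q_Hom_E)
    have "f \<in> Hom PC X Y" using f X by (simp add: PC_Hom)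
    then show ?thesis using HF P.Q_arr f(2) f'(2) by blast
  qed
  have ess: "\<exists>X \<in> Obj P.Q. \<exists>f \<in> Hom FP (on_obj H (on_obj F X)) Y. is_iso FP f"
    if Y: "Y \<in> Obj FP" for Y
  proof -
    have fp: "finitely_presented S.CS Y" using Y by (simp add: fp_module_cat_def)
    have "\<exists>D \<in> pr C M. \<exists>t. S.presents B A \<beta> D t" if "A \<in> M" "B \<in> M" "\<beta> \<in> Hom J.Q B A" for A B \<beta>
      using cone_exists[OF that] S.cone_D(1) by blast
    from E.fp_iso_rep[OF fp this, of "TYPE('g)"]
    obtain X c where X: "X \<in> pr C M" and c: "c \<in> Hom Mod (E.R X) Y" "is_iso Mod c" by blast
    have c': "c \<in> Hom FP (E.R X) Y" using c fp rep_fp[OF pr_Obj[OF X]] by (simp add: FP_Hom)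
    then show ?thesis using FP_iso[OF c(2) c'] X pr_Obj[OF X] F_obj by auto
  qed
  have "is_equivalence P.Q L F" "is_equivalence L FP H"
    by (rule equivalences_from_composite[OF P.category_Q category_localization category_FP F
        G.lift_functor[folded H_def] F_full F_ess faithful full ess]; assumption)+
  then show "\<exists>F. is_equivalence (pr_mod_mho C M) L F" "\<exists>H. is_equivalence L FP H"
    by (auto simp: pr_mod_mho_def)
qed

end

text \<open>\<open>\<iota>\<close> makes 'g large enough: a coset is stored as the image of one of
  its members. In the first part factorization gives homotopy for every \<open>X\<close>; the
  converse is for cofibrant \<open>X\<close>, where \<open>ghost_mho\<close> is available.\<close>

theorem corollary0p2:
  fixes E :: "('o, 'm, 'x) excat_scheme" and M :: "'o set" and \<iota> :: "'m \<Rightarrow> 'g"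
  assumes "frobenius_category E"
    and "weakly_idempotent_complete E"
    and "M \<subseteq> Obj E"
    and "additive_category (full_sub E M)"
    and "rigid E M"
    and "contravariantly_finite E M"
    and "injectives E \<subseteq> M"
    and "inj \<iota>"
  shows
    "(\<forall>X \<in> Obj E. \<forall>Y \<in> Obj E. \<forall>f \<in> Hom E X Y. \<forall>g \<in> Hom E X Y.
        (Minus E f g \<in> factoring E (mho E M) \<longrightarrow> homotopic E (weak_equivalences E M) f g) \<and>
        (X \<in> pr E M \<longrightarrow>
           (homotopic E (weak_equivalences E M) f g \<longleftrightarrow> Minus E f g \<in> factoring E (mho E M)))) \<and>
     (\<exists>F. is_equivalence (pr_mod_mho E M) (Ho E M) F) \<and>
     (\<exists>F. is_equivalence (Ho E M) (fp_module_cat TYPE('g) (stable_sub E M)) F)"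
proof -
  interpret rigid_encoded E M \<iota>
    using assms by (simp add: rigid_encoded_def rigid_encoded_axioms_def rigid_subcategory_def
      rigid_subcategory_axioms_def)
  show ?thesis
    unfolding Minus_neg Ho_def stable_sub_eq
    using homotopic_of_mho homotopic_iff_mho equivalences by blast
qed

end
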